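(* (i) Every o-minimal expansion of $(\mathbb{R},<)$ is PCC, CC and QCC. (ii) Every expansion of $(\mathbb{R},+,\cdot,\mathbb{N})$ is PCC, CC and QCC.
   Context: $\mathbb{N}$ is the set of nonnegative integers. All structures are first-order structures with underlying set $\mathbb{R}$. "Definable" means definable with parameters; definable sets are subsets of $\mathbb{R}^n$ for arbitrary $n$. Each $\mathbb{R}^n$ has its usual topology and subsets carry the subspace topology. An expansion of a structure is any structure (on the same underlying set) in which all primitives of the original structure are definable. A structure on $\mathbb{R}$ is PCC (path-component closed) if for every definable set $E$, each path component of $E$ is definable; it is CC (component closed) if for every definable set $E$, each connected component of $E$ is definable; it is QCC (quasicomponent closed) if for every definable set $E$, each quasicomponent of $E$ is definable. (The quasicomponent of a point $x$ in a space $E$ is the intersection of all clopen subsets of $E$ containing $x$.) An expansion of $(\mathbb{R},<)$ is o-minimal if every definable subset of $\mathbb{R}$ is a finite union of points and open intervals. *)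

theory Defs
  imports "HOL-Analysis.Analysis"
begin

section \<open>First-order structures with underlying set the reals\<close>

text \<open>
  A structure interprets the function symbols in \<open>fsyms\<close> and the relation symbols in \<open>rsyms\<close>
  (both possibly empty; constants are function symbols of arity 0).
  Interpretations take argument lists; only their values on lists whose length is the arity matter.
\<close>

record ('f, 'r) real_structure =
  fsyms :: "'f set"
  rsyms :: "'r set"
  farity :: "'f \<Rightarrow> nat"
  rarity :: "'r \<Rightarrow> nat"
  finterp :: "'f \<Rightarrow> real list \<Rightarrow> real"
  rinterp :: "'r \<Rightarrow> real list \<Rightarrow> bool"

datatype 'f fo_term = Var nat | Fn 'f "'f fo_term list"

datatype ('f, 'r) formula =
    Eq "'f fo_term" "'f fo_term"
  | Rel 'r "'f fo_term list"
  | Neg "('f, 'r) formula"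
  | Conj "('f, 'r) formula" "('f, 'r) formula"
  | Exi nat "('f, 'r) formula"

primrec wf_term :: "('f, 'r) real_structure \<Rightarrow> 'f fo_term \<Rightarrow> bool" where
  "wf_term M (Var i) \<longleftrightarrow> True"
| "wf_term M (Fn f ts) \<longleftrightarrow> f \<in> fsyms M \<and> length ts = farity M f \<and> list_all (wf_term M) ts"

primrec wf_formula :: "('f, 'r) real_structure \<Rightarrow> ('f, 'r) formula \<Rightarrow> bool" where
  "wf_formula M (Eq s t) \<longleftrightarrow> wf_term M s \<and> wf_term M t"
| "wf_formula M (Rel r ts) \<longleftrightarrow> r \<in> rsyms M \<and> length ts = rarity M r \<and> list_all (wf_term M) ts"
| "wf_formula M (Neg \<phi>) \<longleftrightarrow> wf_formula M \<phi>"
| "wf_formula M (Conj \<phi> \<psi>) \<longleftrightarrow> wf_formula M \<phi> \<and> wf_formula M \<psi>"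
| "wf_formula M (Exi i \<phi>) \<longleftrightarrow> wf_formula M \<phi>"

primrec eval_term :: "('f, 'r) real_structure \<Rightarrow> (nat \<Rightarrow> real) \<Rightarrow> 'f fo_term \<Rightarrow> real" where
  "eval_term M \<nu> (Var i) = \<nu> i"
| "eval_term M \<nu> (Fn f ts) = finterp M f (map (eval_term M \<nu>) ts)"

primrec sat :: "('f, 'r) real_structure \<Rightarrow> (nat \<Rightarrow> real) \<Rightarrow> ('f, 'r) formula \<Rightarrow> bool" where
  "sat M \<nu> (Eq s t) \<longleftrightarrow> eval_term M \<nu> s = eval_term M \<nu> t"
| "sat M \<nu> (Rel r ts) \<longleftrightarrow> rinterp M r (map (eval_term M \<nu>) ts)"
| "sat M \<nu> (Neg \<phi>) \<longleftrightarrow> \<not> sat M \<nu> \<phi>"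
| "sat M \<nu> (Conj \<phi> \<psi>) \<longleftrightarrow> sat M \<nu> \<phi> \<and> sat M \<nu> \<psi>"
| "sat M \<nu> (Exi i \<phi>) \<longleftrightarrow> (\<exists>a. sat M (\<nu>(i := a)) \<phi>)"


section \<open>Definable sets\<close>

text \<open>
  The \<open>n\<close>-dimensional space is \<^const>\<open>Euclidean_space\<close> \<open>n\<close>: its points are functions on the naturals
  vanishing from index \<open>n\<close> on, so the coordinates are those with index below \<open>n\<close>.
  In \<open>definable\<close>, the variables with index below \<open>n\<close> stand for the point, and all others
  (of which a formula mentions only finitely many) are parameters, with values given by \<open>p\<close>.
\<close>

definition definable :: "('f, 'r) real_structure \<Rightarrow> nat \<Rightarrow> (nat \<Rightarrow> real) set \<Rightarrow> bool" where
  "definable M n E \<longleftrightarrow>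
     (\<exists>\<phi> p. wf_formula M \<phi> \<and>
        E = {x \<in> topspace (Euclidean_space n). sat M (\<lambda>i. if i < n then x i else p i) \<phi>})"

definition rel_set :: "('f, 'r) real_structure \<Rightarrow> 'r \<Rightarrow> (nat \<Rightarrow> real) set" where
  "rel_set M r =
     {x \<in> topspace (Euclidean_space (rarity M r)). rinterp M r (map x [0..<rarity M r])}"

definition fun_graph :: "('f, 'r) real_structure \<Rightarrow> 'f \<Rightarrow> (nat \<Rightarrow> real) set" where
  "fun_graph M f =
     {x \<in> topspace (Euclidean_space (Suc (farity M f))).
        finterp M f (map x [0..<farity M f]) = x (farity M f)}"

definition expansion_of :: "('f, 'r) real_structure \<Rightarrow> ('g, 's) real_structure \<Rightarrow> bool" where
  "expansion_of M N \<longleftrightarrow>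
     (\<forall>r \<in> rsyms N. definable M (rarity N r) (rel_set N r)) \<and>
     (\<forall>f \<in> fsyms N. definable M (Suc (farity N f)) (fun_graph N f))"

definition PCC :: "('f, 'r) real_structure \<Rightarrow> bool" where
  "PCC M \<longleftrightarrow> (\<forall>n E. definable M n E \<longrightarrow>
     (\<forall>C \<in> path_components_of (subtopology (Euclidean_space n) E). definable M n C))"

definition CC :: "('f, 'r) real_structure \<Rightarrow> bool" where
  "CC M \<longleftrightarrow> (\<forall>n E. definable M n E \<longrightarrow>
     (\<forall>C \<in> connected_components_of (subtopology (Euclidean_space n) E). definable M n C))"

definition QCC :: "('f, 'r) real_structure \<Rightarrow> bool" where
  "QCC M \<longleftrightarrow> (\<forall>n E. definable M n E \<longrightarrow>
     (\<forall>C \<in> quasi_components_of (subtopology (Euclidean_space n) E). definable M n C))"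

definition open_interval :: "real set \<Rightarrow> bool" where
  "open_interval I \<longleftrightarrow> (\<exists>a b :: ereal. I = {x. a < ereal x \<and> ereal x < b})"

text \<open>O-minimality is only meant for expansions of \<open>real_order\<close> below.\<close>

definition o_minimal :: "('f, 'r) real_structure \<Rightarrow> bool" where
  "o_minimal M \<longleftrightarrow>
     (\<forall>A :: real set. definable M 1 {x \<in> topspace (Euclidean_space 1). x 0 \<in> A} \<longrightarrow>
        (\<exists>\<U>. finite \<U> \<and> (\<forall>U \<in> \<U>. (\<exists>a. U = {a}) \<or> open_interval U) \<and> A = \<Union>\<U>))"


section \<open>The two base structures\<close>

definition real_order :: "(unit, unit) real_structure" where
  "real_order =
     \<lparr>fsyms = {}, rsyms = {()}, farity = (\<lambda>_. 0), rarity = (\<lambda>_. 2),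
      finterp = (\<lambda>_ _. 0), rinterp = (\<lambda>_ xs. xs ! 0 < xs ! 1)\<rparr>"

datatype ring_op = Plus | Times

definition real_field_nat :: "(ring_op, unit) real_structure" where
  "real_field_nat =
     \<lparr>fsyms = {Plus, Times}, rsyms = {()}, farity = (\<lambda>_. 2), rarity = (\<lambda>_. 1),
      finterp = (\<lambda>f xs. case f of Plus \<Rightarrow> xs ! 0 + xs ! 1 | Times \<Rightarrow> xs ! 0 * xs ! 1),
      rinterp = (\<lambda>_ xs. xs ! 0 \<in> \<nat>)\<rparr>"

end

theory Submission
  imports Defs
begin

text \<open>
  (i) Over the reals, Baire category replaces the monotonicity theorem of o-minimality. By induction on the
  number of coordinates, every definable set is a finite union of path connected definable pieces, each of
  which is open, or else meager and homeomorphic to its image under forgetting a coordinate. Consequently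
  definable sets are open up to meager sets, so a definable function is continuous outside a meager set
  (compare the preimages of rational intervals with their interiors). Likewise, if all fibres of a definable
  set over a coordinate subspace are finite, then their size is locally constant outside a meager set.
  The exceptional sets are covered by the induction hypothesis, which gives piecewise continuity and a uniform
  bound on the size of the fibres. Applied to the boundary points of the fibres of \<open>A\<close>, this
  cuts \<open>A\<close> into finitely many graphs and bands over pieces. Every component of whichever kind is
  then a union of pieces.

  (ii) When \<open>+\<close>, \<open>*\<close> and the set of naturals are available, a definable sequence of sufficiently
  fast growth allows any set of naturals to be coded by a real number, hence also any open subset of Euclidean
  space. Quasicomponents are defined by quantifying over open sets, components by quantifying over
  relatively closed connected sets, and path components by quantifying over the graphs of paths, which are compact.
\<close>

section \<open>Definable predicates\<close>

text \<open>Since the underlying set is the real line, an exceptional set can be controlled by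
  countably many rational intervals. O-minimality is then used only through the fact that a
  definable subset of the line has a finite boundary. In (i) nothing but the order is known to be
  definable. Whatever has to be definable is therefore phrased with intervals and boxes, while
  auxiliary objects (a height inside a band, a separating distance) may use real arithmetic, because
  only their topological effect matters. The dichotomy open or meager takes the place of a dimension
  theory. In (ii) sets of naturals can be quantified over only through reals. Binary digits would
  require powers of two, hence a recursion, hence a coding of finite sequences in the first place. A
  least common multiple is definable without recursion, as a minimum, and this breaks the circle. As
  parameters are arbitrary reals, one code also makes fixed countable data definable, such as an
  enumeration of all rational boxes.\<close>

primrec fv_term :: "'f fo_term \<Rightarrow> nat set" where
  "fv_term (Var i) = {i}"
| "fv_term (Fn f ts) = \<Union>(set (map fv_term ts))"

primrec fv :: "('f, 'r) formula \<Rightarrow> nat set" where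
  "fv (Eq s t) = fv_term s \<union> fv_term t"
| "fv (Rel r ts) = \<Union>(set (map fv_term ts))"
| "fv (Neg \<phi>) = fv \<phi>"
| "fv (Conj \<phi> \<psi>) = fv \<phi> \<union> fv \<psi>"
| "fv (Exi i \<phi>) = fv \<phi> - {i}"

primrec rename_term :: "(nat \<Rightarrow> nat) \<Rightarrow> 'f fo_term \<Rightarrow> 'f fo_term" where
  "rename_term g (Var i) = Var (g i)"
| "rename_term g (Fn f ts) = Fn f (map (rename_term g) ts)"

definition fresh :: "nat set \<Rightarrow> nat" where
  "fresh A = (SOME j. j \<notin> A)"

text \<open>The bound variable is replaced by one outside the image of the other free variables, so
  no capture occurs even when \<open>g\<close> is not injective. Non-injective renamings do arise
  when several variables stand for the same coordinate.\<close>

primrec rename :: "('f, 'r) formula \<Rightarrow> (nat \<Rightarrow> nat) \<Rightarrow> ('f, 'r) formula" where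
  "rename (Eq s t) g = Eq (rename_term g s) (rename_term g t)"
| "rename (Rel r ts) g = Rel r (map (rename_term g) ts)"
| "rename (Neg \<phi>) g = Neg (rename \<phi> g)"
| "rename (Conj \<phi> \<psi>) g = Conj (rename \<phi> g) (rename \<psi> g)"
| "rename (Exi i \<phi>) g =
     Exi (fresh (g ` (fv \<phi> - {i}))) (rename \<phi> (g(i := fresh (g ` (fv \<phi> - {i})))))"

lemma finite_fv_term: "finite (fv_term t)"
  by (induction t) auto

lemma finite_fv: "finite (fv \<phi>)"
  by (induction \<phi>) (auto simp: finite_fv_term)

lemma fresh_notin: "finite A \<Longrightarrow> fresh A \<notin> A"
  unfolding fresh_def by (rule someI_ex) (use ex_new_if_finite infinite_UNIV_nat in blast)

lemma eval_term_cong: "(\<And>i. i \<in> fv_term t \<Longrightarrow> \<nu> i = \<mu> i) \<Longrightarrow> eval_term M \<nu> t = eval_term M \<mu> t"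
proof (induction t)
  case (Fn f ts)
  have "map (eval_term M \<nu>) ts = map (eval_term M \<mu>) ts"
    by (rule map_cong) (use Fn in auto)
  then show ?case by (metis eval_term.simps(2))
qed auto

lemma sat_cong: "(\<And>i. i \<in> fv \<phi> \<Longrightarrow> \<nu> i = \<mu> i) \<Longrightarrow> sat M \<nu> \<phi> \<longleftrightarrow> sat M \<mu> \<phi>"
proof (induction \<phi> arbitrary: \<nu> \<mu>)
  case (Eq s t)
  then show ?case by (metis eval_term_cong fv.simps(1) Un_iff sat.simps(1))
next
  case (Rel r ts)
  have "map (eval_term M \<nu>) ts = map (eval_term M \<mu>) ts"
    by (rule map_cong) (use Rel in \<open>auto intro!: eval_term_cong\<close>)
  then show ?case by (metis sat.simps(2))
next
  case (Neg \<phi>)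
  then show ?case by (metis fv.simps(3) sat.simps(3))
next
  case (Conj \<phi> \<psi>)
  then show ?case by (metis fv.simps(4) sat.simps(4) Un_iff)
next
  case (Exi j \<phi>)
  have "sat M (\<nu>(j := a)) \<phi> \<longleftrightarrow> sat M (\<mu>(j := a)) \<phi>" for a
    by (rule Exi.IH) (use Exi.prems in auto)
  then show ?case by simp
qed

lemma eval_rename_term: "eval_term M \<nu> (rename_term g t) = eval_term M (\<lambda>i. \<nu> (g i)) t"
proof (induction t)
  case (Fn f ts)
  have "map (eval_term M \<nu> \<circ> rename_term g) ts = map (eval_term M (\<lambda>i. \<nu> (g i))) ts"
    by (rule map_cong) (use Fn in auto)
  then show ?case by (metis eval_term.simps(2) rename_term.simps(2) map_map)
qed auto

lemma wf_rename_term: "wf_term M t \<Longrightarrow> wf_term M (rename_term g t)"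
  by (induction t) (auto simp: list_all_iff)

lemma wf_rename: "wf_formula M \<phi> \<Longrightarrow> wf_formula M (rename \<phi> g)"
  by (induction \<phi> arbitrary: g) (auto simp: list_all_iff wf_rename_term)

lemma sat_rename: "sat M \<nu> (rename \<phi> g) \<longleftrightarrow> sat M (\<nu> \<circ> g) \<phi>"
proof (induction \<phi> arbitrary: g \<nu>)
  case (Eq s t)
  then show ?case by (simp add: eval_rename_term comp_def)
next
  case (Rel r ts)
  have "map (eval_term M \<nu> \<circ> rename_term g) ts = map (eval_term M (\<nu> \<circ> g)) ts"
    by (simp add: eval_rename_term comp_def)
  then show ?case by (metis rename.simps(2) sat.simps(2) map_map)
next
  case (Exi j \<phi>)
  define k where "k = fresh (g ` (fv \<phi> - {j}))"
  have k: "k \<notin> g ` (fv \<phi> - {j})"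
    unfolding k_def by (rule fresh_notin) (simp add: finite_fv)
  have "sat M (\<nu>(k := a)) (rename \<phi> (g(j := k))) \<longleftrightarrow> sat M ((\<nu> \<circ> g)(j := a)) \<phi>" for a
  proof -
    have "sat M (\<nu>(k := a) \<circ> g(j := k)) \<phi> \<longleftrightarrow> sat M ((\<nu> \<circ> g)(j := a)) \<phi>"
      by (rule sat_cong) (use k in auto)
    then show ?thesis using Exi.IH by (simp only:)
  qed
  then show ?case by (simp add: k_def [symmetric] comp_def)
qed auto

text \<open>
  A context is a domain together with the coordinate functions on it that a formula may mention.
  \<open>RR I\<close> is the Euclidean space with coordinates in \<open>I\<close>: forgetting the coordinate \<open>i\<close> is
  \<open>x(i := 0)\<close>, so that no reindexing is needed in inductions on the dimension.
\<close>

datatype 'c ctx = Ctx (cdom: "'c set") (coords: "('c \<Rightarrow> real) set")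

definition RR :: "nat set \<Rightarrow> (nat \<Rightarrow> real) set" where
  "RR I = {x. \<forall>i. i \<notin> I \<longrightarrow> x i = 0}"

definition real_ctx :: "real ctx" where
  "real_ctx = Ctx UNIV {\<lambda>a. a}"

definition vec_ctx :: "nat set \<Rightarrow> (nat \<Rightarrow> real) ctx" where
  "vec_ctx I = Ctx (RR I) ((\<lambda>i x. x i) ` I)"

definition prod_ctx :: "'c ctx \<Rightarrow> 'd ctx \<Rightarrow> ('c \<times> 'd) ctx" (infixl "\<otimes>\<^sub>c" 70) where
  "\<Gamma> \<otimes>\<^sub>c \<Delta> = Ctx (cdom \<Gamma> \<times> cdom \<Delta>) ((\<lambda>v c. v (fst c)) ` coords \<Gamma> \<union> (\<lambda>v c. v (snd c)) ` coords \<Delta>)"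

text \<open>The constant functions are the parameters: each variable of a formula stands either for
  a coordinate or for a fixed real.\<close>

definition basic :: "'c ctx \<Rightarrow> ('c \<Rightarrow> real) \<Rightarrow> bool" where
  "basic \<Gamma> v \<longleftrightarrow> v \<in> coords \<Gamma> \<or> (\<exists>k. v = (\<lambda>_. k))"

lemma basic_const: "basic \<Gamma> (\<lambda>_. k)"
  by (auto simp: basic_def)

lemma basic_fst: "basic \<Gamma> v \<Longrightarrow> basic (\<Gamma> \<otimes>\<^sub>c \<Delta>) (\<lambda>c. v (fst c))"
  by (auto simp: basic_def prod_ctx_def)

lemma basic_snd: "basic \<Delta> v \<Longrightarrow> basic (\<Gamma> \<otimes>\<^sub>c \<Delta>) (\<lambda>c. v (snd c))"
  by (auto simp: basic_def prod_ctx_def)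

lemma basic_real: "basic real_ctx (\<lambda>a. a)"
  by (auto simp: basic_def real_ctx_def)

lemma basic_snd_real: "basic (\<Gamma> \<otimes>\<^sub>c real_ctx) snd"
  using basic_snd [OF basic_real, of \<Gamma>] by simp

lemma basic_snd_fst_real: "basic (\<Gamma> \<otimes>\<^sub>c real_ctx \<otimes>\<^sub>c \<Delta>) (\<lambda>c. snd (fst c))"
  by (rule basic_fst [OF basic_snd_real])

lemma mem_prod_ctx [simp]: "c \<in> cdom (\<Gamma> \<otimes>\<^sub>c \<Delta>) \<longleftrightarrow> fst c \<in> cdom \<Gamma> \<and> snd c \<in> cdom \<Delta>"
  by (cases c) (auto simp: prod_ctx_def)

lemma mem_real_ctx [simp]: "a \<in> cdom real_ctx"
  by (auto simp: real_ctx_def)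

lemma mem_vec_ctx [simp]: "x \<in> cdom (vec_ctx I) \<longleftrightarrow> x \<in> RR I"
  by (auto simp: vec_ctx_def)

section \<open>Definability over a context and its closure properties\<close>

definition Def :: "('f, 'r) real_structure \<Rightarrow> 'c ctx \<Rightarrow> ('c \<Rightarrow> bool) \<Rightarrow> bool" where
  "Def M \<Gamma> P \<longleftrightarrow> (\<exists>\<phi> \<sigma>. wf_formula M \<phi> \<and> (\<forall>i::nat. basic \<Gamma> (\<sigma> i)) \<and>
     (\<forall>c\<in>cdom \<Gamma>. P c \<longleftrightarrow> sat M (\<lambda>i. \<sigma> i c) \<phi>))"

text \<open>Functions enter through their graphs, because the language may have no terms for them.
  Substituting a function therefore costs a quantifier over its value.\<close>

definition DefF :: "('f, 'r) real_structure \<Rightarrow> 'c ctx \<Rightarrow> ('c \<Rightarrow> real) \<Rightarrow> bool" where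
  "DefF M \<Gamma> f \<longleftrightarrow> Def M (\<Gamma> \<otimes>\<^sub>c real_ctx) (\<lambda>c. f (fst c) = snd c)"

definition DefV :: "('f, 'r) real_structure \<Rightarrow> 'c ctx \<Rightarrow> nat set \<Rightarrow> ('c \<Rightarrow> nat \<Rightarrow> real) \<Rightarrow> bool" where
  "DefV M \<Gamma> I h \<longleftrightarrow> (\<forall>c\<in>cdom \<Gamma>. h c \<in> RR I) \<and> (\<forall>i\<in>I. DefF M \<Gamma> (\<lambda>c. h c i))"

context
  fixes M :: "('f, 'r) real_structure"
begin

lemma Def_cong: "(\<And>c. c \<in> cdom \<Gamma> \<Longrightarrow> P c \<longleftrightarrow> Q c) \<Longrightarrow> Def M \<Gamma> P \<longleftrightarrow> Def M \<Gamma> Q"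
  unfolding Def_def by (intro iff_exI conj_cong refl ball_cong) auto

lemma Def_eqI: "Def M \<Gamma> Q \<Longrightarrow> (\<And>c. c \<in> cdom \<Gamma> \<Longrightarrow> P c \<longleftrightarrow> Q c) \<Longrightarrow> Def M \<Gamma> P"
  by (simp add: Def_cong [of \<Gamma> P Q])

lemma Def_not: "Def M \<Gamma> P \<Longrightarrow> Def M \<Gamma> (\<lambda>c. \<not> P c)"
  unfolding Def_def by (metis wf_formula.simps(3) sat.simps(3))

lemma Def_conj:
  assumes "Def M \<Gamma> P" "Def M \<Gamma> Q"
  shows "Def M \<Gamma> (\<lambda>c. P c \<and> Q c)"
proof -
  obtain \<phi> \<sigma> where P: "wf_formula M \<phi>" "\<And>i. basic \<Gamma> (\<sigma> i)"
    "\<And>c. c \<in> cdom \<Gamma> \<Longrightarrow> P c \<longleftrightarrow> sat M (\<lambda>i. \<sigma> i c) \<phi>"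
    using assms(1) unfolding Def_def by blast
  obtain \<psi> \<tau> where Q: "wf_formula M \<psi>" "\<And>i. basic \<Gamma> (\<tau> i)"
    "\<And>c. c \<in> cdom \<Gamma> \<Longrightarrow> Q c \<longleftrightarrow> sat M (\<lambda>i. \<tau> i c) \<psi>"
    using assms(2) unfolding Def_def by blast
  \<comment> \<open>The two formulas may assign the same variable differently; even and odd indices
    keep their assignments apart.\<close>
  define \<theta> where "\<theta> = Conj (rename \<phi> (\<lambda>i. 2 * i)) (rename \<psi> (\<lambda>i. Suc (2 * i)))"
  define \<rho> where "\<rho> = (\<lambda>i. if even i then \<sigma> (i div 2) else \<tau> (i div 2))"
  have *: "((\<lambda>i. \<rho> i c) \<circ> (\<lambda>i. 2 * i)) = (\<lambda>i. \<sigma> i c)"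
    "((\<lambda>i. \<rho> i c) \<circ> (\<lambda>i. Suc (2 * i))) = (\<lambda>i. \<tau> i c)" for c
    by (auto simp: \<rho>_def)
  have "wf_formula M \<theta>" using P Q by (simp add: \<theta>_def wf_rename)
  moreover have "basic \<Gamma> (\<rho> i)" for i using P Q by (simp add: \<rho>_def)
  moreover have "(P c \<and> Q c) \<longleftrightarrow> sat M (\<lambda>i. \<rho> i c) \<theta>" if "c \<in> cdom \<Gamma>" for c
    using P(3) Q(3) that by (simp add: \<theta>_def sat_rename *)
  ultimately show ?thesis unfolding Def_def by blast
qed

lemma Def_disj:
  assumes "Def M \<Gamma> P" "Def M \<Gamma> Q"
  shows "Def M \<Gamma> (\<lambda>c. P c \<or> Q c)"
  by (rule Def_eqI [OF Def_not [OF Def_conj [OF Def_not [OF assms(1)] Def_not [OF assms(2)]]]]) simp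

lemma Def_imp:
  assumes "Def M \<Gamma> P" "Def M \<Gamma> Q"
  shows "Def M \<Gamma> (\<lambda>c. P c \<longrightarrow> Q c)"
  by (rule Def_eqI [OF Def_disj [OF Def_not [OF assms(1)] assms(2)]]) blast

lemma Def_iff:
  assumes "Def M \<Gamma> P" "Def M \<Gamma> Q"
  shows "Def M \<Gamma> (\<lambda>c. P c \<longleftrightarrow> Q c)"
  by (rule Def_eqI [OF Def_conj [OF Def_imp [OF assms] Def_imp [OF assms(2,1)]]]) blast

lemma Def_const: "Def M \<Gamma> (\<lambda>_. b)"
proof -
  have "Def M \<Gamma> (\<lambda>_. True)" unfolding Def_def
    by (rule exI [of _ "Eq (Var 0) (Var 0)"], rule exI [of _ "\<lambda>_ _. 0"]) (auto simp: basic_const)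
  then show ?thesis using Def_not by (cases b) fastforce+
qed

lemma Def_ex:
  assumes "Def M (\<Gamma> \<otimes>\<^sub>c real_ctx) (\<lambda>c. P (fst c) (snd c))"
  shows "Def M \<Gamma> (\<lambda>c. \<exists>a. P c a)"
proof -
  obtain \<phi> \<sigma> where \<phi>: "wf_formula M \<phi>" "\<And>i. basic (\<Gamma> \<otimes>\<^sub>c real_ctx) (\<sigma> i)"
    "\<And>c. c \<in> cdom (\<Gamma> \<otimes>\<^sub>c real_ctx) \<Longrightarrow> P (fst c) (snd c) \<longleftrightarrow> sat M (\<lambda>i. \<sigma> i c) \<phi>"
    using assms unfolding Def_def by blast
  have "\<exists>w. basic \<Gamma> w \<and> (\<sigma> i = snd \<or> \<sigma> i = (\<lambda>c. w (fst c)))" for i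
  proof -
    have "\<sigma> i \<in> coords (\<Gamma> \<otimes>\<^sub>c real_ctx) \<or> (\<exists>k. \<sigma> i = (\<lambda>_. k))"
      using \<phi>(2) unfolding basic_def by blast
    then consider v where "v \<in> coords \<Gamma>" "\<sigma> i = (\<lambda>c. v (fst c))" | "\<sigma> i = snd" | k where "\<sigma> i = (\<lambda>_. k)"
      by (auto simp: prod_ctx_def real_ctx_def)
    then show ?thesis
      by cases (auto simp: basic_def)
  qed
  then obtain w where w: "\<And>i. basic \<Gamma> (w i)" "\<And>i. \<sigma> i = snd \<or> \<sigma> i = (\<lambda>c. w i (fst c))"
    by metis
  \<comment> \<open>All variables standing for the quantified coordinate are merged into variable 0.
    The others depend on the context alone and are shifted by one to make room.\<close>
  define g where "g i = (if \<sigma> i = snd then 0 else Suc i)" for i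
  define \<tau> where "\<tau> i = (case i of 0 \<Rightarrow> (\<lambda>_. 0) | Suc k \<Rightarrow> w k)" for i
  have *: "((\<lambda>i. \<tau> i c)(0 := a)) \<circ> g = (\<lambda>i. \<sigma> i (c, a))" for c a
  proof
    fix i show "(((\<lambda>i. \<tau> i c)(0 := a)) \<circ> g) i = \<sigma> i (c, a)"
      using w(2) [of i] by (auto simp: g_def \<tau>_def)
  qed
  have "wf_formula M (Exi 0 (rename \<phi> g))" by (simp add: wf_rename \<phi>)
  moreover have "basic \<Gamma> (\<tau> i)" for i by (auto simp: \<tau>_def w basic_const split: nat.split)
  moreover have "(\<exists>a. P c a) \<longleftrightarrow> sat M (\<lambda>i. \<tau> i c) (Exi 0 (rename \<phi> g))" if "c \<in> cdom \<Gamma>" for c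
    using \<phi>(3) [of "(c, _)"] that by (simp add: sat_rename *)
  ultimately show ?thesis unfolding Def_def by blast
qed

lemma Def_all:
  assumes "Def M (\<Gamma> \<otimes>\<^sub>c real_ctx) (\<lambda>c. P (fst c) (snd c))"
  shows "Def M \<Gamma> (\<lambda>c. \<forall>a. P c a)"
  by (rule Def_eqI [OF Def_not [OF Def_ex [of _ "\<lambda>c a. \<not> P c a"]]]) (auto intro: Def_not assms)

text \<open>The formula stays the same and only the meaning of its variables changes. This works as
  long as each coordinate, composed with \<open>h\<close>, is again a coordinate or a
  constant.\<close>

lemma Def_subst:
  assumes "Def M \<Gamma> P" "\<And>c. c \<in> cdom \<Delta> \<Longrightarrow> h c \<in> cdom \<Gamma>"
    and "\<And>v. v \<in> coords \<Gamma> \<Longrightarrow> \<exists>w. basic \<Delta> w \<and> (\<forall>c\<in>cdom \<Delta>. v (h c) = w c)"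
  shows "Def M \<Delta> (\<lambda>c. P (h c))"
proof -
  obtain \<phi> \<sigma> where \<phi>: "wf_formula M \<phi>" "\<And>i. basic \<Gamma> (\<sigma> i)"
    "\<And>c. c \<in> cdom \<Gamma> \<Longrightarrow> P c \<longleftrightarrow> sat M (\<lambda>i. \<sigma> i c) \<phi>"
    using assms unfolding Def_def by blast
  have "\<exists>w. basic \<Delta> w \<and> (\<forall>c\<in>cdom \<Delta>. \<sigma> i (h c) = w c)" for i
    using \<phi>(2) [of i] assms(3) unfolding basic_def by metis
  then obtain w where w: "\<And>i. basic \<Delta> (w i)" "\<And>i c. c \<in> cdom \<Delta> \<Longrightarrow> \<sigma> i (h c) = w i c"
    by metis
  have "P (h c) \<longleftrightarrow> sat M (\<lambda>i. w i c) \<phi>" if "c \<in> cdom \<Delta>" for c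
    using \<phi>(3) assms(2) w(2) that by simp
  then show ?thesis unfolding Def_def using \<phi>(1) w(1) by blast
qed

lemma Def_snd:
  assumes "Def M \<Delta> P"
  shows "Def M (\<Gamma> \<otimes>\<^sub>c \<Delta>) (\<lambda>c. P (snd c))"
  by (rule Def_subst [OF assms]) (use basic_snd basic_def in fastforce)+

lemma Def_subst2:
  assumes "Def M (\<Gamma> \<otimes>\<^sub>c \<Delta>) (\<lambda>c. P (fst c) (snd c))" "\<And>c. c \<in> cdom \<Theta> \<Longrightarrow> g c \<in> cdom \<Gamma> \<and> h c \<in> cdom \<Delta>"
    and "\<And>v. v \<in> coords \<Gamma> \<Longrightarrow> \<exists>w. basic \<Theta> w \<and> (\<forall>c\<in>cdom \<Theta>. v (g c) = w c)"
    and "\<And>v. v \<in> coords \<Delta> \<Longrightarrow> \<exists>w. basic \<Theta> w \<and> (\<forall>c\<in>cdom \<Theta>. v (h c) = w c)"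
  shows "Def M \<Theta> (\<lambda>c. P (g c) (h c))"
proof -
  have "Def M \<Theta> (\<lambda>c. P (fst (g c, h c)) (snd (g c, h c)))"
    by (rule Def_subst [OF assms(1)]) (use assms in \<open>auto simp: prod_ctx_def\<close>)
  then show ?thesis by simp
qed

lemma basic_subst_real: "basic \<Theta> u \<Longrightarrow> v \<in> coords real_ctx \<Longrightarrow> \<exists>w. basic \<Theta> w \<and> (\<forall>c\<in>cdom \<Theta>. v (u c) = w c)"
  by (auto simp: real_ctx_def)

lemma DefF_basic:
  assumes "basic \<Gamma> v"
  shows "DefF M \<Gamma> v"
  unfolding DefF_def Def_def
  apply (rule exI [of _ "Eq (Var 0) (Var 1)"])
  apply (rule exI [of _ "\<lambda>i. case i of 0 \<Rightarrow> (\<lambda>c. v (fst c)) | Suc _ \<Rightarrow> snd"])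
  using basic_fst [OF assms] basic_snd [OF basic_real]
  by (auto split: nat.split)

lemma DefF_const: "DefF M \<Gamma> (\<lambda>_. k)"
  by (rule DefF_basic [OF basic_const])

lemma DefF_snd: "DefF M (\<Gamma> \<otimes>\<^sub>c real_ctx) snd"
  by (rule DefF_basic) (rule basic_snd [OF basic_real])

lemma DefF_fst:
  assumes "DefF M \<Gamma> f"
  shows "DefF M (\<Gamma> \<otimes>\<^sub>c \<Delta>) (\<lambda>c. f (fst c))"
proof -
  have "Def M (\<Gamma> \<otimes>\<^sub>c \<Delta> \<otimes>\<^sub>c real_ctx) (\<lambda>c. f (fst (fst c)) = snd c)"
    apply (rule Def_subst2 [OF assms [unfolded DefF_def]])
      apply simp
    subgoal for v using basic_fst [OF basic_fst [of \<Gamma> v \<Delta>]] unfolding basic_def by blast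
    subgoal for v by (rule basic_subst_real [OF basic_snd_real])
    done
  then show ?thesis by (simp add: DefF_def)
qed

lemma DefF_eqI:
  assumes "DefF M \<Gamma> g" "\<And>c. c \<in> cdom \<Gamma> \<Longrightarrow> f c = g c"
  shows "DefF M \<Gamma> f"
  using assms(1) unfolding DefF_def by (rule Def_eqI) (simp add: assms(2))

text \<open>The value of \<open>f\<close> is named by an existential quantifier, which its graph
  determines uniquely.\<close>

lemma Def_comp:
  assumes "Def M (\<Gamma> \<otimes>\<^sub>c real_ctx) (\<lambda>c. P (fst c) (snd c))" "DefF M \<Gamma> f"
  shows "Def M \<Gamma> (\<lambda>c. P c (f c))"
  by (rule Def_eqI [OF Def_ex [of _ "\<lambda>c a. f c = a \<and> P c a"]])
    (auto intro!: Def_conj assms(1) assms(2) [unfolded DefF_def])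

lemma Def_eq:
  assumes "DefF M \<Gamma> f" "DefF M \<Gamma> g"
  shows "Def M \<Gamma> (\<lambda>c. f c = g c)"
  by (rule Def_comp [OF _ assms(2), of "\<lambda>c a. f c = a"]) (use assms(1) in \<open>simp add: DefF_def\<close>)

lemma Def_real:
  assumes "Def M real_ctx P" "DefF M \<Gamma> f"
  shows "Def M \<Gamma> (\<lambda>c. P (f c))"
  by (rule Def_comp [OF Def_snd [OF assms(1)] assms(2)])

lemma Def_real2:
  assumes P: "Def M (real_ctx \<otimes>\<^sub>c real_ctx) (\<lambda>c. P (fst c) (snd c))" and f: "DefF M \<Gamma> f" "DefF M \<Gamma> g"
  shows "Def M \<Gamma> (\<lambda>c. P (f c) (g c))"
proof -
  have "Def M (\<Gamma> \<otimes>\<^sub>c real_ctx \<otimes>\<^sub>c real_ctx) (\<lambda>c. P (snd (fst c)) (snd c))"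
    by (rule Def_subst2 [OF P])
      (auto intro: basic_subst_real [OF basic_snd_real] basic_subst_real [OF basic_snd_fst_real])
  from Def_comp [where P = "\<lambda>c b. P (snd c) b", OF this DefF_fst [OF f(2)]]
  show ?thesis by (rule Def_comp [where P = "\<lambda>c a. P a (g c)"]) (rule f)
qed

lemma RR_insert: "RR (insert j I) = {x(j := a) | x a. x \<in> RR I}" (is "_ = ?R")
proof
  show "RR (insert j I) \<subseteq> ?R"
  proof
    fix x assume "x \<in> RR (insert j I)"
    then have "x = (x(j := 0))(j := x j) \<and> x(j := 0) \<in> RR I" by (auto simp: RR_def)
    then show "x \<in> ?R" by blast
  qed
qed (auto simp: RR_def)

lemma Def_exV:
  assumes "finite I" "Def M (\<Gamma> \<otimes>\<^sub>c vec_ctx I) (\<lambda>c. P (fst c) (snd c))"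
  shows "Def M \<Gamma> (\<lambda>c. \<exists>x\<in>RR I. P c x)"
  using assms
proof (induction I arbitrary: P rule: finite_induct)
  case empty
  have *: "RR {} = {\<lambda>_. 0}" by (auto simp: RR_def)
  have "Def M \<Gamma> (\<lambda>c. P c (\<lambda>_. 0))"
    by (rule Def_subst2 [OF empty.prems, where g = "\<lambda>c. c"]) (auto simp: vec_ctx_def * basic_def)
  then show ?case by (simp add: *)
next
  case (insert j I)
  have "Def M (\<Gamma> \<otimes>\<^sub>c vec_ctx I \<otimes>\<^sub>c real_ctx) (\<lambda>c. P (fst (fst c)) ((snd (fst c))(j := snd c)))"
  proof (rule Def_subst2 [OF insert.prems])
    fix v assume "v \<in> coords \<Gamma>"
    then show "\<exists>w. basic (\<Gamma> \<otimes>\<^sub>c vec_ctx I \<otimes>\<^sub>c real_ctx) w \<and>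
         (\<forall>c\<in>cdom (\<Gamma> \<otimes>\<^sub>c vec_ctx I \<otimes>\<^sub>c real_ctx). v (fst (fst c)) = w c)"
      using basic_fst [OF basic_fst [of \<Gamma> v "vec_ctx I"]] unfolding basic_def by blast
  next
    fix v assume "v \<in> coords (vec_ctx (insert j I))"
    then obtain i where v: "v = (\<lambda>x. x i)" "i = j \<or> i \<in> I" by (auto simp: vec_ctx_def)
    have "basic (\<Gamma> \<otimes>\<^sub>c vec_ctx I \<otimes>\<^sub>c real_ctx) (\<lambda>c. (if i = j then snd c else snd (fst c) i))"
    proof (cases "i = j")
      case True
      then show ?thesis using basic_snd [OF basic_real, of "\<Gamma> \<otimes>\<^sub>c vec_ctx I"] by simp
    next
      case False
      then have "basic (vec_ctx I) (\<lambda>x. x i)" using v by (auto simp: basic_def vec_ctx_def)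
      then show ?thesis using basic_fst [OF basic_snd, of "vec_ctx I"] False by fastforce
    qed
    then show "\<exists>w. basic (\<Gamma> \<otimes>\<^sub>c vec_ctx I \<otimes>\<^sub>c real_ctx) w \<and>
         (\<forall>c\<in>cdom (\<Gamma> \<otimes>\<^sub>c vec_ctx I \<otimes>\<^sub>c real_ctx). v ((snd (fst c))(j := snd c)) = w c)"
      by (intro exI conjI, assumption) (auto simp: v)
  qed (auto simp: RR_def)
  then have "Def M (\<Gamma> \<otimes>\<^sub>c vec_ctx I) (\<lambda>c. \<exists>a. P (fst c) ((snd c)(j := a)))"
    by (rule Def_ex)
  then have "Def M \<Gamma> (\<lambda>c. \<exists>x\<in>RR I. \<exists>a. P c (x(j := a)))"
    by (rule insert.IH)
  then show ?case
    by (rule Def_eqI) (auto simp: RR_insert)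
qed

lemma Def_allV:
  assumes "finite I" "Def M (\<Gamma> \<otimes>\<^sub>c vec_ctx I) (\<lambda>c. P (fst c) (snd c))"
  shows "Def M \<Gamma> (\<lambda>c. \<forall>x\<in>RR I. P c x)"
  by (rule Def_eqI [OF Def_not [OF Def_exV [of _ _ "\<lambda>c a. \<not> P c a"]]]) (auto intro: Def_not assms)

lemma Def_Ball_finite:
  assumes "finite I" "\<And>i. i \<in> I \<Longrightarrow> Def M \<Gamma> (P i)"
  shows "Def M \<Gamma> (\<lambda>c. \<forall>i\<in>I. P i c)"
  using assms
proof (induction I rule: finite_induct)
  case (insert j I)
  then show ?case by (simp add: Def_conj)
qed (simp add: Def_const)

lemma DefF_coord: "DefF M (vec_ctx I) (\<lambda>x. x i)"
proof (cases "i \<in> I")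
  case True
  then show ?thesis by (intro DefF_basic) (auto simp: basic_def vec_ctx_def)
next
  case False
  then show ?thesis by (intro DefF_eqI [OF DefF_const [of _ 0]]) (auto simp: RR_def)
qed

lemma DefF_coord_snd: "DefF M (\<Gamma> \<otimes>\<^sub>c vec_ctx I) (\<lambda>c. snd c i)"
proof (cases "i \<in> I")
  case True
  then have "basic (vec_ctx I) (\<lambda>x. x i)" by (auto simp: basic_def vec_ctx_def)
  then show ?thesis by (intro DefF_basic basic_snd)
next
  case False
  then show ?thesis by (intro DefF_eqI [OF DefF_const [of _ 0]]) (auto simp: RR_def)
qed

text \<open>As for a single real value, the vector is named by a quantifier. The coordinates in
  \<open>I\<close> determine it because vectors of \<open>RR I\<close> vanish elsewhere.\<close>

lemma Def_compV:
  assumes I: "finite I" and P: "Def M (\<Gamma> \<otimes>\<^sub>c vec_ctx I) (\<lambda>c. P (fst c) (snd c))" and h: "DefV M \<Gamma> I h"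
  shows "Def M \<Gamma> (\<lambda>c. P c (h c))"
proof -
  have "Def M \<Gamma> (\<lambda>c. \<exists>x\<in>RR I. (\<forall>i\<in>I. h c i = x i) \<and> P c x)"
    using h by (intro Def_exV I Def_conj Def_Ball_finite Def_eq DefF_coord_snd P DefF_fst)
      (auto simp: DefV_def)
  then show ?thesis
  proof (rule Def_eqI)
    fix c assume c: "c \<in> cdom \<Gamma>"
    then have hc: "h c \<in> RR I" using h by (auto simp: DefV_def)
    have "x = h c" if "x \<in> RR I" "\<forall>i\<in>I. h c i = x i" for x
    proof
      fix i show "x i = h c i"
        using that hc by (cases "i \<in> I") (auto simp: RR_def)
    qed
    then show "P c (h c) = (\<exists>x\<in>RR I. (\<forall>i\<in>I. h c i = x i) \<and> P c x)"
      using hc by auto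
  qed
qed

lemma Def_vec:
  assumes "finite I" "Def M (vec_ctx I) P" "DefV M \<Gamma> I h"
  shows "Def M \<Gamma> (\<lambda>c. P (h c))"
  by (rule Def_compV [OF assms(1) Def_snd [OF assms(2)] assms(3)])

lemma DefF_vec:
  assumes "finite I" "DefF M (vec_ctx I) f" "DefV M \<Gamma> I h"
  shows "DefF M \<Gamma> (\<lambda>c. f (h c))"
proof -
  have "Def M (\<Gamma> \<otimes>\<^sub>c real_ctx) (\<lambda>c. f (h (fst c)) = snd c)"
  proof (rule Def_compV [OF assms(1), where P = "\<lambda>c x. f x = snd c"])
    show "Def M (\<Gamma> \<otimes>\<^sub>c real_ctx \<otimes>\<^sub>c vec_ctx I) (\<lambda>c. f (snd c) = snd (fst c))"
    proof (rule Def_subst2 [OF assms(2) [unfolded DefF_def]])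
      fix v assume "v \<in> coords (vec_ctx I)"
      then have "basic (vec_ctx I) v" by (simp add: basic_def)
      then show "\<exists>w. basic (\<Gamma> \<otimes>\<^sub>c real_ctx \<otimes>\<^sub>c vec_ctx I) w \<and>
          (\<forall>c\<in>cdom (\<Gamma> \<otimes>\<^sub>c real_ctx \<otimes>\<^sub>c vec_ctx I). v (snd c) = w c)"
        using basic_snd by blast
    qed (auto intro: basic_subst_real [OF basic_snd_fst_real])
    show "DefV M (\<Gamma> \<otimes>\<^sub>c real_ctx) I (\<lambda>c. h (fst c))"
      using assms(3) by (auto simp: DefV_def intro: DefF_fst)
  qed
  then show ?thesis by (simp add: DefF_def)
qed

lemma DefV_fst: "DefV M \<Gamma> I h \<Longrightarrow> DefV M (\<Gamma> \<otimes>\<^sub>c \<Delta>) I (\<lambda>c. h (fst c))"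
  by (auto simp: DefV_def intro: DefF_fst)

lemma DefV_snd: "DefV M (\<Gamma> \<otimes>\<^sub>c vec_ctx I) I snd"
  by (auto simp: DefV_def intro: DefF_coord_snd)

lemma DefV_id: "DefV M (vec_ctx I) I (\<lambda>x. x)"
  by (auto simp: DefV_def intro: DefF_coord)

lemma DefV_const: "x \<in> RR I \<Longrightarrow> DefV M \<Gamma> I (\<lambda>_. x)"
  by (auto simp: DefV_def intro: DefF_const)

lemma DefF_app:
  assumes "DefV M \<Gamma> I h"
  shows "DefF M \<Gamma> (\<lambda>c. h c i)"
proof (cases "i \<in> I")
  case False
  then show ?thesis by (intro DefF_eqI [OF DefF_const [of _ 0]]) (use assms in \<open>auto simp: DefV_def RR_def\<close>)
qed (use assms in \<open>auto simp: DefV_def\<close>)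

lemma DefV_upd:
  assumes "DefV M \<Gamma> J h" "J \<subseteq> insert j I" "DefF M \<Gamma> f" "j \<in> I"
  shows "DefV M \<Gamma> I (\<lambda>c. (h c)(j := f c))"
  unfolding DefV_def
proof (intro conjI ballI)
  fix i
  show "DefF M \<Gamma> (\<lambda>c. ((h c)(j := f c)) i)"
    using assms(3) DefF_app [OF assms(1)] by (cases "i = j") auto
qed (use assms in \<open>auto simp: DefV_def RR_def\<close>)

lemma DefV_drop:
  assumes "DefV M \<Gamma> J h" "J \<subseteq> insert j I"
  shows "DefV M \<Gamma> I (\<lambda>c. (h c)(j := 0))"
  unfolding DefV_def
proof (intro conjI ballI)
  fix i
  show "DefF M \<Gamma> (\<lambda>c. ((h c)(j := 0)) i)"
    using DefF_const [of \<Gamma> 0] DefF_app [OF assms(1)] by (cases "i = j") auto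
qed (use assms in \<open>auto simp: DefV_def RR_def\<close>)

lemma topspace_eq_RR: "topspace (Euclidean_space n) = RR {..<n}"
  by (auto simp: topspace_Euclidean_space RR_def)

text \<open>The only bridge to the fixed numbering of variables in \<open>definable\<close>. For the
  converse, the variable \<open>i\<close> moves to \<open>n + i\<close> if it stands for a
  parameter, so it cannot collide with a coordinate.\<close>

lemma definable_iff_Def: "definable M n E \<longleftrightarrow> E \<subseteq> RR {..<n} \<and> Def M (vec_ctx {..<n}) (\<lambda>x. x \<in> E)"
proof
  assume "definable M n E"
  then obtain \<phi> p where \<phi>: "wf_formula M \<phi>"
    "E = {x \<in> RR {..<n}. sat M (\<lambda>i. if i < n then x i else p i) \<phi>}"
    by (auto simp: definable_def topspace_eq_RR)
  define \<sigma> where "\<sigma> i = (if i < n then (\<lambda>x::nat \<Rightarrow> real. x i) else (\<lambda>_. p i))" for i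
  have "basic (vec_ctx {..<n}) (\<sigma> i)" for i
    by (auto simp: basic_def vec_ctx_def \<sigma>_def)
  moreover have "(\<lambda>i. \<sigma> i x) = (\<lambda>i. if i < n then x i else p i)" for x
    by (auto simp: \<sigma>_def)
  then have "\<forall>x\<in>RR {..<n}. x \<in> E \<longleftrightarrow> sat M (\<lambda>i. \<sigma> i x) \<phi>"
    by (subst \<phi>(2)) simp
  ultimately have "Def M (vec_ctx {..<n}) (\<lambda>x. x \<in> E)"
    unfolding Def_def by (intro exI [of _ \<phi>] exI [of _ \<sigma>]) (simp add: \<phi>(1))
  moreover have "E \<subseteq> RR {..<n}"
    by (subst \<phi>(2)) blast
  ultimately show "E \<subseteq> RR {..<n} \<and> Def M (vec_ctx {..<n}) (\<lambda>x. x \<in> E)"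
    by blast
next
  assume E: "E \<subseteq> RR {..<n} \<and> Def M (vec_ctx {..<n}) (\<lambda>x. x \<in> E)"
  then obtain \<phi> \<sigma> where *: "wf_formula M \<phi> \<and> (\<forall>i. basic (vec_ctx {..<n}) (\<sigma> i)) \<and>
      (\<forall>x\<in>cdom (vec_ctx {..<n}). x \<in> E \<longleftrightarrow> sat M (\<lambda>i. \<sigma> i x) \<phi>)"
    unfolding Def_def by blast
  have \<phi>: "wf_formula M \<phi>" "\<And>i. basic (vec_ctx {..<n}) (\<sigma> i)"
    "\<And>x. x \<in> RR {..<n} \<Longrightarrow> x \<in> E \<longleftrightarrow> sat M (\<lambda>i. \<sigma> i x) \<phi>"
    using * by simp_all
  have "\<forall>i. \<exists>q. (fst q < n \<and> \<sigma> i = (\<lambda>x. x (fst q))) \<or> (fst q = n + i \<and> \<sigma> i = (\<lambda>_. snd q))"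
  proof
    fix i
    consider j where "j < n" "\<sigma> i = (\<lambda>x. x j)" | k where "\<sigma> i = (\<lambda>_. k)"
      using \<phi>(2) [of i] unfolding basic_def vec_ctx_def by fastforce
    then show "\<exists>q. (fst q < n \<and> \<sigma> i = (\<lambda>x. x (fst q))) \<or> (fst q = n + i \<and> \<sigma> i = (\<lambda>_. snd q))"
    proof cases
      case 1 then show ?thesis by (intro exI [of _ "(j, 0)"]) simp
    next
      case 2 then show ?thesis by (intro exI [of _ "(n + i, k)"]) simp
    qed
  qed
  from choice [OF this] obtain q where q: "\<And>i. (fst (q i) < n \<and> \<sigma> i = (\<lambda>x. x (fst (q i)))) \<or>
      (fst (q i) = n + i \<and> \<sigma> i = (\<lambda>_. snd (q i)))"
    by blast
  define g k where "g i = fst (q i)" and "k i = snd (q i)" for i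
  have g: "\<And>i. (g i < n \<and> \<sigma> i = (\<lambda>x. x (g i))) \<or> (g i = n + i \<and> \<sigma> i = (\<lambda>_. k i))"
    using q by (simp add: g_def k_def)
  define p where "p i = k (i - n)" for i
  have *: "(\<lambda>i. if i < n then x i else p i) \<circ> g = (\<lambda>i. \<sigma> i x)" for x
  proof
    fix i show "((\<lambda>i. if i < n then x i else p i) \<circ> g) i = \<sigma> i x"
      using g [of i] by (auto simp: p_def)
  qed
  have "sat M (\<lambda>i. if i < n then x i else p i) (rename \<phi> g) \<longleftrightarrow> sat M (\<lambda>i. \<sigma> i x) \<phi>" for x
    unfolding sat_rename * ..
  then have "E = {x \<in> RR {..<n}. sat M (\<lambda>i. if i < n then x i else p i) (rename \<phi> g)}"
    using \<phi>(3) E by blast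
  then show "definable M n E"
    unfolding definable_def topspace_eq_RR
    by (intro exI [of _ "rename \<phi> g"] exI [of _ p] conjI wf_rename [OF \<phi>(1)])
qed

end

section \<open>Topology of coordinate subspaces\<close>

definition XX :: "nat set \<Rightarrow> (nat \<Rightarrow> real) topology" where
  "XX I = top_of_set (RR I)"

lemma topspace_XX [simp]: "topspace (XX I) = RR I"
  by (simp add: XX_def)

lemma Euclidean_space_eq_XX: "Euclidean_space n = XX {..<n}"
  unfolding Euclidean_space_def XX_def euclidean_product_topology
  by (rule arg_cong [where f = "subtopology euclidean"]) (auto simp: RR_def)

lemma continuous_on_upd:
  assumes "continuous_on S h" "continuous_on S f"
  shows "continuous_on S (\<lambda>x. (h x)(j := f x :: real))"
proof (rule continuous_on_coordinatewise_then_product)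
  fix i show "continuous_on S (\<lambda>x. ((h x)(j := f x)) i)"
    using continuous_on_product_then_coordinatewise [OF assms(1)] assms(2) by (cases "i = j") auto
qed

lemma continuous_on_coord: "continuous_on S (\<lambda>x::nat \<Rightarrow> real. x i)"
  by (rule continuous_on_product_then_coordinatewise) (rule continuous_on_id)

lemma continuous_on_drop: "continuous_on S (\<lambda>x. x(j := 0::real))"
  by (intro continuous_on_upd continuous_on_id continuous_on_const)

lemma closed_RR: "closed (RR I)"
proof -
  have "closed {x::nat \<Rightarrow> real. x i = 0}" for i
    by (rule closed_Collect_eq) (intro continuous_on_coord continuous_on_const)+
  then have "closed (\<Inter>i\<in>-I. {x. x i = (0::real)})" by blast
  moreover have "RR I = (\<Inter>i\<in>-I. {x. x i = 0})" by (auto simp: RR_def)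
  ultimately show ?thesis by simp
qed

lemma drop_in_RR: "j \<notin> I \<Longrightarrow> z \<in> RR (insert j I) \<Longrightarrow> z(j := 0) \<in> RR I"
  by (auto simp: RR_def)

lemma upd_in_RR: "x \<in> RR I \<Longrightarrow> x(j := a) \<in> RR (insert j I)"
  by (auto simp: RR_def)

lemma RR_zero: "x \<in> RR I \<Longrightarrow> j \<notin> I \<Longrightarrow> x j = 0"
  by (auto simp: RR_def)

lemma drop_RR: "x \<in> RR I \<Longrightarrow> j \<notin> I \<Longrightarrow> x(j := 0) = x"
  by (metis RR_zero fun_upd_triv)

lemma drop_in_RR_iff: "j \<notin> I \<Longrightarrow> z(j := 0) \<in> RR I \<longleftrightarrow> z \<in> RR (insert j I)"
  by (auto simp: RR_def)

lemma RR_empty: "RR {} = {\<lambda>_. 0}"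
  by (auto simp: RR_def)

subsection \<open>Boxes\<close>

definition obox :: "nat set \<Rightarrow> (nat \<Rightarrow> real) \<Rightarrow> (nat \<Rightarrow> real) \<Rightarrow> (nat \<Rightarrow> real) set" where
  "obox I l u = {z \<in> RR I. \<forall>i\<in>I. l i < z i \<and> z i < u i}"

lemma openin_obox: "finite I \<Longrightarrow> openin (XX I) (obox I l u)"
proof -
  assume "finite I"
  have "open {z::nat \<Rightarrow> real. l i < z i \<and> z i < u i}" for i
    by (intro open_Collect_conj open_Collect_less continuous_on_coord continuous_on_const)
  then have "open (\<Inter>i\<in>I. {z. l i < z i \<and> z i < u i})"
    using \<open>finite I\<close> by blast
  then have "openin (XX I) (RR I \<inter> (\<Inter>i\<in>I. {z. l i < z i \<and> z i < u i}))"
    unfolding XX_def by (rule openin_open_Int)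
  also have "RR I \<inter> (\<Inter>i\<in>I. {z. l i < z i \<and> z i < u i}) = obox I l u"
    by (auto simp: obox_def)
  finally show ?thesis .
qed

lemma open_contains_box:
  assumes "openin (XX I) U" "x \<in> U"
  obtains e where "e > 0" "\<And>z. z \<in> RR I \<Longrightarrow> (\<And>i. i \<in> I \<Longrightarrow> \<bar>z i - x i\<bar> < e) \<Longrightarrow> z \<in> U"
proof -
  obtain T where T: "open T" "U = RR I \<inter> T"
    using assms(1) by (auto simp: XX_def openin_open)
  have "openin (product_topology (\<lambda>_. euclidean) UNIV) T"
    using T(1) by (simp add: euclidean_product_topology)
  then obtain X where X: "x \<in> (\<Pi>\<^sub>E i\<in>UNIV. X i)" "\<And>i. open (X i)"
      "finite {i. X i \<noteq> UNIV}" "(\<Pi>\<^sub>E i\<in>UNIV. X i) \<subseteq> T"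
    using product_topology_open_contains_basis [of "\<lambda>_. euclidean" UNIV T x] assms(2) T(2) by auto
  have "\<exists>e>0. ball (x i) e \<subseteq> X i" for i
    using X(1,2) by (simp add: PiE_iff open_contains_ball)
  then obtain e where e: "\<And>i. e i > 0" "\<And>i. ball (x i) (e i) \<subseteq> X i"
    by metis
  \<comment> \<open>The element 1 keeps the set nonempty when no factor of the basic open set is
    restricted.\<close>
  define d where "d = Min (insert 1 (e ` {i. X i \<noteq> UNIV}))"
  have d: "d > 0" "\<And>i. X i \<noteq> UNIV \<Longrightarrow> d \<le> e i"
    using X(3) e by (auto simp: d_def)
  have "z \<in> U" if z: "z \<in> RR I" "\<And>i. i \<in> I \<Longrightarrow> \<bar>z i - x i\<bar> < d" for z
  proof -
    have "z i \<in> X i" for i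
    proof (cases "X i = UNIV")
      case False
      have "\<bar>z i - x i\<bar> < d"
        using z d(1) assms(2) T(2) by (cases "i \<in> I") (auto simp: RR_def)
      then show ?thesis using d(2) [OF False] e(2) [of i] by (auto simp: dist_real_def)
    qed auto
    then show ?thesis using z(1) T(2) X(4) by auto
  qed
  then show ?thesis using d(1) that by blast
qed

definition near :: "nat set \<Rightarrow> (nat \<Rightarrow> real) \<Rightarrow> ((nat \<Rightarrow> real) \<Rightarrow> bool) \<Rightarrow> bool" where
  "near I x Q \<longleftrightarrow> (\<exists>U. openin (XX I) U \<and> x \<in> U \<and> (\<forall>z\<in>U. Q z))"

lemma near_conj: "near I x Q \<Longrightarrow> near I x R \<Longrightarrow> near I x (\<lambda>z. Q z \<and> R z)"
  unfolding near_def by (metis IntE IntI openin_Int)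

lemma near_mono: "near I x Q \<Longrightarrow> (\<And>z. z \<in> RR I \<Longrightarrow> Q z \<Longrightarrow> R z) \<Longrightarrow> near I x R"
  unfolding near_def by (metis openin_subset subsetD topspace_XX)

lemma near_Ball:
  assumes "finite A" "\<And>a. a \<in> A \<Longrightarrow> near I x (Q a)" "x \<in> RR I"
  shows "near I x (\<lambda>z. \<forall>a\<in>A. Q a z)"
  using assms(1,2)
proof (induction A rule: finite_induct)
  case empty
  show ?case using assms(3) openin_topspace [of "XX I"] by (auto simp: near_def simp del: openin_topspace)
next
  case (insert a A)
  then show ?case using near_conj [of I x "Q a" "\<lambda>z. \<forall>a\<in>A. Q a z"] by simp
qed

text \<open>Neighbourhoods are replaced by boxes with real corners \<open>l\<close> and
  \<open>u\<close>. This turns a quantifier over open sets into first-order quantifiers that mention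
  only the order.\<close>

lemma near_iff_box:
  assumes "finite I" "x \<in> RR I"
  shows "near I x Q \<longleftrightarrow> (\<exists>l\<in>RR I. \<exists>u\<in>RR I. (\<forall>i\<in>I. l i < x i \<and> x i < u i) \<and>
           (\<forall>z\<in>RR I. (\<forall>i\<in>I. l i < z i \<and> z i < u i) \<longrightarrow> Q z))" (is "_ \<longleftrightarrow> ?R")
proof
  assume "near I x Q"
  then obtain U where U: "openin (XX I) U" "x \<in> U" "\<And>z. z \<in> U \<Longrightarrow> Q z"
    by (auto simp: near_def)
  obtain e where e: "e > 0" "\<And>z. z \<in> RR I \<Longrightarrow> (\<And>i. i \<in> I \<Longrightarrow> \<bar>z i - x i\<bar> < e) \<Longrightarrow> z \<in> U"
    using open_contains_box [OF U(1,2)] by blast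
  define l u where "l = (\<lambda>i. if i \<in> I then x i - e else 0)" and "u = (\<lambda>i. if i \<in> I then x i + e else 0)"
  have "l \<in> RR I" "u \<in> RR I" by (auto simp: l_def u_def RR_def)
  moreover have "\<forall>i\<in>I. l i < x i \<and> x i < u i" using e(1) by (auto simp: l_def u_def)
  moreover have "Q z" if "z \<in> RR I" "\<forall>i\<in>I. l i < z i \<and> z i < u i" for z
    by (rule U(3), rule e(2)) (use that in \<open>auto simp: l_def u_def abs_less_iff\<close>)
  ultimately show ?R by blast
next
  assume ?R
  then obtain l u where "\<forall>i\<in>I. l i < x i \<and> x i < u i"
    "\<forall>z\<in>RR I. (\<forall>i\<in>I. l i < z i \<and> z i < u i) \<longrightarrow> Q z"
    by blast
  then show "near I x Q"
    unfolding near_def using openin_obox [OF assms(1), of l u] assms(2)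
    by (intro exI [of _ "obox I l u"]) (auto simp: obox_def)
qed

subsection \<open>Meager sets\<close>

definition meager :: "nat set \<Rightarrow> (nat \<Rightarrow> real) set \<Rightarrow> bool" where
  "meager I N \<longleftrightarrow> (\<exists>\<G>. countable \<G> \<and> (\<forall>T\<in>\<G>. closedin (XX I) T \<and> XX I interior_of T = {}) \<and> N \<subseteq> \<Union>\<G>)"

lemma meager_subset: "meager I N \<Longrightarrow> N' \<subseteq> N \<Longrightarrow> meager I N'"
  unfolding meager_def by (meson order_trans)

lemma meager_empty: "meager I {}"
  unfolding meager_def by (rule exI [of _ "{}"]) simp

lemma meager_UN:
  assumes "countable A" "\<And>a. a \<in> A \<Longrightarrow> meager I (N a)"
  shows "meager I (\<Union>a\<in>A. N a)"
proof -
  obtain G where G: "\<And>a. a \<in> A \<Longrightarrow> countable (G a) \<and>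
      (\<forall>T\<in>G a. closedin (XX I) T \<and> XX I interior_of T = {}) \<and> N a \<subseteq> \<Union>(G a)"
    using assms(2) unfolding meager_def by metis
  then show ?thesis unfolding meager_def
    using assms(1) by (intro exI [of _ "\<Union>a\<in>A. G a"]) (auto, blast)
qed

lemma completely_metrizable_XX: "completely_metrizable_space (XX I)"
  unfolding XX_def
  by (rule completely_metrizable_space_closedin [OF completely_metrizable_space_euclidean])
    (simp add: closed_RR flip: closed_closedin)

lemma metrizable_XX: "metrizable_space (XX I)"
  by (rule completely_metrizable_imp_metrizable_space [OF completely_metrizable_XX])

lemma not_meager_open:
  assumes "openin (XX I) U" "U \<noteq> {}"
  shows "\<not> meager I U"
proof
  assume "meager I U"
  then obtain \<G> where \<G>: "countable \<G>" "\<And>T. T \<in> \<G> \<Longrightarrow> closedin (XX I) T \<and> XX I interior_of T = {}" "U \<subseteq> \<Union>\<G>"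
    unfolding meager_def by blast
  have "XX I interior_of \<Union>\<G> = {}"
    by (rule Baire_category_alt) (use completely_metrizable_XX \<G> in auto)
  then show False using interior_of_maximal [OF \<G>(3) assms(1)] assms(2) by blast
qed

lemma continuous_map_drop: "j \<notin> I \<Longrightarrow> continuous_map (XX (insert j I)) (XX I) (\<lambda>z. z(j := 0))"
  unfolding XX_def by (auto simp: continuous_on_drop intro: drop_in_RR)

lemma continuous_map_slice: "continuous_map (XX I) (XX (insert j I)) (\<lambda>x. x(j := a))"
  unfolding XX_def by (auto intro!: continuous_on_upd continuous_on_id continuous_on_const intro: upd_in_RR)

text \<open>An open set inside the cylinder over \<open>T\<close> has an open slice at the height of
  each of its points, and that slice would be an open subset of \<open>T\<close>.\<close>

lemma meager_cylinder:
  assumes "j \<notin> I" "meager I N"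
  shows "meager (insert j I) {z \<in> RR (insert j I). z(j := 0) \<in> N}"
proof -
  obtain \<G> where \<G>: "countable \<G>" "\<And>T. T \<in> \<G> \<Longrightarrow> closedin (XX I) T \<and> XX I interior_of T = {}" "N \<subseteq> \<Union>\<G>"
    using assms(2) unfolding meager_def by blast
  define cyl where "cyl T = {z \<in> topspace (XX (insert j I)). z(j := 0) \<in> T}" for T
  have "closedin (XX (insert j I)) (cyl T) \<and> XX (insert j I) interior_of (cyl T) = {}" if T: "T \<in> \<G>" for T
  proof
    show "closedin (XX (insert j I)) (cyl T)"
      unfolding cyl_def by (rule closedin_continuous_map_preimage [OF continuous_map_drop]) (use assms \<G> T in auto)
    have False if z: "z \<in> XX (insert j I) interior_of (cyl T)" for z
    proof -
      obtain U where U: "openin (XX (insert j I)) U" "z \<in> U" "U \<subseteq> cyl T"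
        using z by (auto simp: interior_of_def)
      have zR: "z \<in> RR (insert j I)" using U openin_subset by fastforce
      have "openin (XX I) {x \<in> topspace (XX I). x(j := z j) \<in> U}"
        by (rule openin_continuous_map_preimage [OF continuous_map_slice U(1)])
      moreover have "{x \<in> topspace (XX I). x(j := z j) \<in> U} \<subseteq> T"
      proof
        fix x assume x: "x \<in> {x \<in> topspace (XX I). x(j := z j) \<in> U}"
        then have "(x(j := z j))(j := 0) \<in> T" using U(3) by (force simp: cyl_def)
        moreover have "x j = 0" using x assms(1) by (auto simp: RR_def)
        ultimately show "x \<in> T" by (metis fun_upd_triv fun_upd_upd)
      qed
      moreover have "z(j := 0) \<in> {x \<in> topspace (XX I). x(j := z j) \<in> U}"
        using U(2) zR assms(1) by (auto intro: drop_in_RR)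
      ultimately show False using \<G>(2) [OF T] interior_of_maximal by blast
    qed
    then show "XX (insert j I) interior_of (cyl T) = {}" by blast
  qed
  moreover have "{z \<in> RR (insert j I). z(j := 0) \<in> N} \<subseteq> \<Union>(cyl ` \<G>)"
    using \<G>(3) by (auto simp: cyl_def)
  ultimately show ?thesis
    unfolding meager_def using \<G>(1) by (intro exI [of _ "cyl ` \<G>"]) blast
qed

lemma openin_fiber:
  assumes "openin (XX (insert j I)) U" "x \<in> RR I"
  shows "open {a. x(j := a) \<in> U}"
proof -
  have "continuous_map euclideanreal (XX (insert j I)) (\<lambda>a. x(j := a))"
    using upd_in_RR [OF assms(2)] continuous_on_upd [OF continuous_on_const continuous_on_id, of UNIV x j]
    by (auto simp: XX_def continuous_map_in_subtopology)
  from openin_continuous_map_preimage [OF this assms(1)] show ?thesis by simp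
qed

text \<open>The graph is the zero set of a continuous function on a closed cylinder. An open set
  inside it would have an open fibre consisting of one point.\<close>

lemma graph_nowhere_dense:
  assumes "j \<notin> I" "closedin (XX I) F" "continuous_on F f"
  defines "G \<equiv> (\<lambda>x. x(j := f x)) ` F"
  shows "closedin (XX (insert j I)) G" "XX (insert j I) interior_of G = {}"
proof -
  have F: "closed F" "F \<subseteq> RR I"
    using assms(2) closed_RR closedin_closed_trans unfolding XX_def
    by (blast, metis closedin_subset topspace_euclidean_subtopology)
  have x: "(x(j := f x))(j := 0) = x" if "x \<in> F" for x
    using that F(2) assms(1) by (metis drop_RR fun_upd_upd subsetD)
  define K where "K = {z \<in> topspace (XX (insert j I)). z(j := 0) \<in> F}"
  have K: "closedin (XX (insert j I)) K"
    unfolding K_def by (rule closedin_continuous_map_preimage [OF continuous_map_drop]) (use assms in auto)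
  then have "closed K" using closed_RR closedin_closed_trans unfolding XX_def by blast
  moreover have "continuous_on K (\<lambda>z. f (z(j := 0)) - z j)"
    by (intro continuous_intros continuous_on_coord continuous_on_compose2 [OF assms(3) continuous_on_drop])
      (auto simp: K_def)
  ultimately have "closed {z \<in> K. f (z(j := 0)) - z j = 0}"
    using continuous_closed_preimage_constant by blast
  moreover have "G = {z \<in> K. f (z(j := 0)) - z j = 0}"
  proof
    show "G \<subseteq> {z \<in> K. f (z(j := 0)) - z j = 0}"
      using F(2) x by (auto simp: G_def K_def intro: upd_in_RR)
    show "{z \<in> K. f (z(j := 0)) - z j = 0} \<subseteq> G"
    proof
      fix z assume "z \<in> {z \<in> K. f (z(j := 0)) - z j = 0}"
      then have "z(j := 0) \<in> F" "z = (z(j := 0))(j := f (z(j := 0)))" by (auto simp: K_def)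
      then show "z \<in> G" unfolding G_def by blast
    qed
  qed
  ultimately have "closed G" by simp
  moreover have "G \<subseteq> RR (insert j I)" using F(2) by (auto simp: G_def intro: upd_in_RR)
  ultimately show "closedin (XX (insert j I)) G"
    by (simp add: XX_def closed_subset)
  have False if U: "openin (XX (insert j I)) U" "z \<in> U" "U \<subseteq> G" for U z
  proof -
    obtain y where y: "y \<in> F" "z = y(j := f y)" using U by (auto simp: G_def)
    have "open {a. y(j := a) \<in> U}" using openin_fiber [OF U(1)] y F(2) by blast
    moreover have "{a. y(j := a) \<in> U} \<subseteq> {f y}"
    proof
      fix a assume "a \<in> {a. y(j := a) \<in> U}"
      then obtain w where w: "w \<in> F" "y(j := a) = w(j := f w)" using U(3) by (auto simp: G_def)
      have "y = w" using w y(1) x by (metis fun_upd_upd)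
      then show "a \<in> {f y}" using w(2) by (metis fun_upd_same singletonI)
    qed
    moreover have "f y \<in> {a. y(j := a) \<in> U}" using y U(2) by simp
    ultimately have "{a. y(j := a) \<in> U} = {f y}" by blast
    then show False using \<open>open {a. y(j := a) \<in> U}\<close> not_open_singleton by metis
  qed
  then show "XX (insert j I) interior_of G = {}" by (auto simp: interior_of_def)
qed

text \<open>Over an open base the graph may fail to be closed, so the base is first written as a
  countable union of closed sets.\<close>

lemma meager_graph:
  assumes "j \<notin> I" "openin (XX I) V" "continuous_on V f"
  shows "meager (insert j I) ((\<lambda>x. x(j := f x)) ` V)"
proof -
  obtain \<F> where \<F>: "countable \<F>" "\<And>F. F \<in> \<F> \<Longrightarrow> closedin (XX I) F" "\<Union>\<F> = V"
    using open_imp_fsigma_in [OF metrizable_XX assms(2)]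
    unfolding fsigma_in_def union_of_def by auto
  have "meager (insert j I) ((\<lambda>x. x(j := f x)) ` F)" if "F \<in> \<F>" for F
    unfolding meager_def
    using graph_nowhere_dense [OF assms(1) \<F>(2) [OF that] continuous_on_subset [OF assms(3)]] \<F>(3) that
    by (intro exI [of _ "{(\<lambda>x. x(j := f x)) ` F}"]) auto
  then have "meager (insert j I) (\<Union>F\<in>\<F>. (\<lambda>x. x(j := f x)) ` F)"
    by (rule meager_UN [OF \<F>(1)])
  then show ?thesis by (rule meager_subset) (use \<F>(3) in blast)
qed

subsection \<open>Bands\<close>

text \<open>The flags \<open>L\<close> and \<open>U\<close> switch the lower and the upper bound on, so that unbounded bands are covered.\<close>

definition band ::
  "nat \<Rightarrow> bool \<Rightarrow> bool \<Rightarrow> (nat \<Rightarrow> real) set \<Rightarrow> ((nat \<Rightarrow> real) \<Rightarrow> real) \<Rightarrow> ((nat \<Rightarrow> real) \<Rightarrow> real) \<Rightarrow>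
    (nat \<Rightarrow> real) set" where
  "band j L U B g f =
     {z. z(j := 0) \<in> B \<and> (L \<longrightarrow> g (z(j := 0)) < z j) \<and> (U \<longrightarrow> z j < f (z(j := 0)))}"

lemma openin_band:
  assumes "j \<notin> I" "openin (XX I) B" "continuous_on B g" "continuous_on B f"
  shows "openin (XX (insert j I)) (band j L U B g f)"
proof -
  have B: "B \<subseteq> RR I" using openin_subset [OF assms(2)] by simp
  define O' where "O' = {z \<in> topspace (XX (insert j I)). z(j := 0) \<in> B}"
  have O': "openin (XX (insert j I)) O'"
    unfolding O'_def by (rule openin_continuous_map_preimage [OF continuous_map_drop]) (use assms in auto)
  have gf: "continuous_on O' (\<lambda>z. z j - g (z(j := 0)))" "continuous_on O' (\<lambda>z. f (z(j := 0)) - z j)"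
    by (intro continuous_intros continuous_on_coord continuous_on_compose2 [OF assms(3) continuous_on_drop]
        continuous_on_compose2 [OF assms(4) continuous_on_drop]; auto simp: O'_def)+
  have "openin (top_of_set O') (O' \<inter> (\<lambda>z. z j - g (z(j := 0))) -` {0<..})"
       "openin (top_of_set O') (O' \<inter> (\<lambda>z. f (z(j := 0)) - z j) -` {0<..})"
    using gf continuous_openin_preimage_gen open_greaterThan by blast+
  then have 1: "openin (top_of_set O') (if L then O' \<inter> (\<lambda>z. z j - g (z(j := 0))) -` {0<..} else O')"
    "openin (top_of_set O') (if U then O' \<inter> (\<lambda>z. f (z(j := 0)) - z j) -` {0<..} else O')"
    by auto
  have "band j L U B g f = (if L then O' \<inter> (\<lambda>z. z j - g (z(j := 0))) -` {0<..} else O') \<inter>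
     (if U then O' \<inter> (\<lambda>z. f (z(j := 0)) - z j) -` {0<..} else O')"
    using B assms(1) drop_in_RR_iff by (auto simp: band_def O'_def)
  then have "openin (top_of_set O') (band j L U B g f)" using openin_Int [OF 1] by simp
  then show ?thesis using O' unfolding XX_def by (rule openin_trans)
qed

text \<open>Every point moves vertically, within its convex fibre, to a continuous section of the
  band, and the section is a continuous image of the path connected base.\<close>

lemma path_connected_band:
  assumes j: "j \<notin> I" and B: "B \<subseteq> RR I" "path_connected B"
    and gf: "continuous_on B g" "continuous_on B f" "L \<Longrightarrow> U \<Longrightarrow> \<forall>x\<in>B. g x < f x"
  shows "path_connected (band j L U B g f)"
proof -
  \<comment> \<open>The section: the midpoint of two bounds, distance 1 from a single bound, 0
    without bounds. It is not claimed to be definable, so division and addition are harmless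
    here.\<close>
  define h where "h x = (if L then (if U then (g x + f x) / 2 else g x + 1) else (if U then f x - 1 else 0))" for x
  have h: "continuous_on B h"
    unfolding h_def using gf(1,2) by (cases L; cases U) (auto intro!: continuous_intros)
  define W where "W = band j L U B g f"
  define s where "s x = x(j := h x)" for x
  have x0: "x j = 0" if "x \<in> B" for x using B(1) j that by (auto simp: RR_def)
  have xj: "x(j := 0) = x" if "x \<in> B" for x using x0 [OF that] by (metis fun_upd_triv)
  have hT: "(L \<longrightarrow> g x < h x) \<and> (U \<longrightarrow> h x < f x)" if "x \<in> B" for x
    using gf(3) that by (auto simp: h_def field_simps)
  have sW: "s ` B \<subseteq> W"
    using hT by (auto simp: W_def band_def s_def xj)
  have "path_connected (s ` B)"
    unfolding s_def by (intro path_connected_continuous_image continuous_on_upd h continuous_on_id B)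
  then have base: "path_component W (s x) (s y)" if "x \<in> B" "y \<in> B" for x y
    using that sW by (meson imageI path_component_of_subset path_connected_component)
  have vert: "path_component W z (s (z(j := 0)))" if z: "z \<in> W" for z
  proof -
    define x where "x = z(j := 0)"
    have xB: "x \<in> B" using z by (simp add: x_def W_def band_def)
    define T where "T = {a. (L \<longrightarrow> g x < a) \<and> (U \<longrightarrow> a < f x)}"
    have "T = (if L then {g x<..} else UNIV) \<inter> (if U then {..<f x} else UNIV)"
      by (auto simp: T_def)
    then have "convex T" by (auto intro!: convex_Int convex_real_interval)
    then have "path_connected T" by (rule convex_imp_path_connected)
    then have pc: "path_connected ((\<lambda>a. x(j := a)) ` T)"
      by (rule path_connected_continuous_image [rotated]) (intro continuous_on_upd continuous_on_id continuous_on_const)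
    have "(\<lambda>a. x(j := a)) ` T \<subseteq> W"
      using xB xj by (auto simp: W_def band_def T_def)
    moreover have "z \<in> (\<lambda>a. x(j := a)) ` T"
      by (rule image_eqI [of _ _ "z j"]) (use z in \<open>auto simp: x_def W_def band_def T_def\<close>)
    moreover have "s x \<in> (\<lambda>a. x(j := a)) ` T"
      unfolding s_def by (rule imageI) (use hT [OF xB] in \<open>simp add: T_def\<close>)
    moreover have "path_component ((\<lambda>a. x(j := a)) ` T) z (s x)"
      using pc calculation(2,3) unfolding path_connected_component by blast
    ultimately show ?thesis unfolding x_def by (simp add: path_component_of_subset)
  qed
  have "path_component W z w" if "z \<in> W" "w \<in> W" for z w
  proof -
    have "z(j := 0) \<in> B" "w(j := 0) \<in> B" using that by (auto simp: W_def band_def)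
    then show ?thesis
      using vert [OF that(1)] vert [OF that(2)] base path_component_trans path_component_sym by metis
  qed
  then show ?thesis unfolding W_def [symmetric] path_connected_component by blast
qed

section \<open>O-minimal structures\<close>

locale ordered_structure =
  fixes M :: "('f, 'r) real_structure"
  assumes Def_less_base: "Def M (real_ctx \<otimes>\<^sub>c real_ctx) (\<lambda>c. fst c < snd c)"
begin

lemma Def_less:
  assumes "DefF M \<Gamma> f" "DefF M \<Gamma> g"
  shows "Def M \<Gamma> (\<lambda>c. f c < g c)"
  by (rule Def_real2 [OF Def_less_base assms])

definition dset :: "nat set \<Rightarrow> (nat \<Rightarrow> real) set \<Rightarrow> bool" where
  "dset I A \<longleftrightarrow> A \<subseteq> RR I \<and> Def M (vec_ctx I) (\<lambda>x. x \<in> A)"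

lemma dset_subset: "dset I A \<Longrightarrow> A \<subseteq> RR I"
  by (simp add: dset_def)

lemma dset_Collect:
  assumes "Def M (vec_ctx I) P"
  shows "dset I {x \<in> RR I. P x}"
  unfolding dset_def by (auto intro: Def_eqI [OF assms])

lemma Def_mem:
  assumes "finite I" "dset I A" "DefV M \<Gamma> I h"
  shows "Def M \<Gamma> (\<lambda>c. h c \<in> A)"
  using assms by (auto simp: dset_def intro: Def_vec)

lemma dset_Int: "finite I \<Longrightarrow> dset I A \<Longrightarrow> dset I B \<Longrightarrow> dset I (A \<inter> B)"
  unfolding dset_def by (auto intro: Def_conj)

lemma dset_Diff: "finite I \<Longrightarrow> dset I A \<Longrightarrow> dset I B \<Longrightarrow> dset I (A - B)"
  unfolding dset_def by (auto intro: Def_conj Def_not)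

lemma dset_RR: "dset I (RR I)"
  using dset_Collect [OF Def_const [of M "vec_ctx I" True]] by simp

lemma dset_empty: "dset I {}"
  using dset_Collect [OF Def_const [of M "vec_ctx I" False]] by simp

lemma Def_near:
  assumes I: "finite I" and h: "DefV M \<Gamma> I h" and Q: "Def M (\<Gamma> \<otimes>\<^sub>c vec_ctx I) (\<lambda>c. Q (fst c) (snd c))"
  shows "Def M \<Gamma> (\<lambda>c. near I (h c) (Q c))"
proof -
  have Q': "Def M (\<Gamma> \<otimes>\<^sub>c vec_ctx I \<otimes>\<^sub>c vec_ctx I \<otimes>\<^sub>c vec_ctx I) (\<lambda>c. Q (fst (fst (fst c))) (snd c))"
  proof (rule Def_subst2 [OF Q])
    fix v assume "v \<in> coords \<Gamma>"
    then have "basic \<Gamma> v" by (simp add: basic_def)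
    then have "basic (\<Gamma> \<otimes>\<^sub>c vec_ctx I \<otimes>\<^sub>c vec_ctx I \<otimes>\<^sub>c vec_ctx I) (\<lambda>c. v (fst (fst (fst c))))"
      by (intro basic_fst)
    then show "\<exists>w. basic (\<Gamma> \<otimes>\<^sub>c vec_ctx I \<otimes>\<^sub>c vec_ctx I \<otimes>\<^sub>c vec_ctx I) w \<and>
        (\<forall>c\<in>cdom (\<Gamma> \<otimes>\<^sub>c vec_ctx I \<otimes>\<^sub>c vec_ctx I \<otimes>\<^sub>c vec_ctx I). v (fst (fst (fst c))) = w c)"
      by blast
  next
    fix v assume "v \<in> coords (vec_ctx I)"
    then have "basic (vec_ctx I) v" by (simp add: basic_def)
    then have "basic (\<Gamma> \<otimes>\<^sub>c vec_ctx I \<otimes>\<^sub>c vec_ctx I \<otimes>\<^sub>c vec_ctx I) (\<lambda>c. v (snd c))"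
      by (intro basic_snd)
    then show "\<exists>w. basic (\<Gamma> \<otimes>\<^sub>c vec_ctx I \<otimes>\<^sub>c vec_ctx I \<otimes>\<^sub>c vec_ctx I) w \<and>
        (\<forall>c\<in>cdom (\<Gamma> \<otimes>\<^sub>c vec_ctx I \<otimes>\<^sub>c vec_ctx I \<otimes>\<^sub>c vec_ctx I). v (snd c) = w c)"
      by blast
  qed auto
  have "Def M \<Gamma> (\<lambda>c. \<exists>l\<in>RR I. \<exists>u\<in>RR I. (\<forall>i\<in>I. l i < h c i \<and> h c i < u i) \<and>
           (\<forall>z\<in>RR I. (\<forall>i\<in>I. l i < z i \<and> z i < u i) \<longrightarrow> Q c z))"
    by (intro Def_exV Def_allV I Def_conj Def_imp Def_Ball_finite Def_less Q' DefF_coord_snd DefF_fst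
        DefF_app [OF h])
  then show ?thesis
    by (rule Def_eqI) (use h near_iff_box [OF I] in \<open>auto simp: DefV_def\<close>)
qed

text \<open>
  The pieces replace the cells of the cell decomposition theorem: all that is needed of a piece which is
  not open is that forgetting one coordinate maps it homeomorphically onto its image.
\<close>

definition thin :: "nat set \<Rightarrow> (nat \<Rightarrow> real) set \<Rightarrow> bool" where
  "thin I C \<longleftrightarrow> meager I C \<and> (\<exists>i\<in>I. \<exists>g. continuous_on ((\<lambda>x. x(i := 0)) ` C) g \<and> (\<forall>x\<in>C. x i = g (x(i := 0))))"

definition piece :: "nat set \<Rightarrow> (nat \<Rightarrow> real) set \<Rightarrow> bool" where
  "piece I C \<longleftrightarrow> dset I C \<and> path_connected C \<and> (openin (XX I) C \<or> thin I C)"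

text \<open>A finite cover in which pieces may overlap. This suffices for components, and the covers
  of several sets can simply be united.\<close>

definition decomposable :: "nat set \<Rightarrow> ((nat \<Rightarrow> real) set \<Rightarrow> bool) \<Rightarrow> (nat \<Rightarrow> real) set \<Rightarrow> bool" where
  "decomposable I Q A \<longleftrightarrow> (\<exists>\<C>. finite \<C> \<and> (\<forall>C\<in>\<C>. piece I C \<and> Q C) \<and> A = \<Union>\<C>)"

definition Decomp :: "nat set \<Rightarrow> bool" where
  "Decomp I \<longleftrightarrow> (\<forall>A. dset I A \<longrightarrow> decomposable I (\<lambda>_. True) A)"

definition Cont :: "nat set \<Rightarrow> bool" where
  "Cont I \<longleftrightarrow> (\<forall>A f. dset I A \<longrightarrow> DefF M (vec_ctx I) f \<longrightarrow> decomposable I (\<lambda>C. continuous_on C f) A)"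

definition fib :: "nat \<Rightarrow> (nat \<Rightarrow> real) set \<Rightarrow> (nat \<Rightarrow> real) \<Rightarrow> real set" where
  "fib j A x = {a. x(j := a) \<in> A}"

definition UF :: "nat set \<Rightarrow> bool" where
  "UF I \<longleftrightarrow> (\<forall>j A. j \<notin> I \<longrightarrow> dset (insert j I) A \<longrightarrow> (\<forall>x\<in>RR I. finite (fib j A x)) \<longrightarrow>
     (\<exists>K. \<forall>x\<in>RR I. card (fib j A x) \<le> K))"

lemma DecompD: "Decomp I \<Longrightarrow> dset I A \<Longrightarrow> \<exists>\<C>. finite \<C> \<and> (\<forall>C\<in>\<C>. piece I C) \<and> A = \<Union>\<C>"
  by (simp add: Decomp_def decomposable_def)

lemma decomposable_empty: "decomposable I Q {}"
  unfolding decomposable_def by (rule exI [of _ "{}"]) simp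

lemma decomposable_piece: "piece I C \<Longrightarrow> Q C \<Longrightarrow> decomposable I Q C"
  unfolding decomposable_def by (rule exI [of _ "{C}"]) simp

lemma decomposable_Un:
  assumes "decomposable I Q A" "decomposable I Q B"
  shows "decomposable I Q (A \<union> B)"
proof -
  obtain \<C> \<D> where "finite \<C>" "\<forall>C\<in>\<C>. piece I C \<and> Q C" "A = \<Union>\<C>"
    "finite \<D>" "\<forall>C\<in>\<D>. piece I C \<and> Q C" "B = \<Union>\<D>"
    using assms unfolding decomposable_def by blast
  then show ?thesis unfolding decomposable_def by (intro exI [of _ "\<C> \<union> \<D>"]) auto
qed

lemma decomposable_UN:
  assumes "finite S" "\<And>s. s \<in> S \<Longrightarrow> decomposable I Q (A s)"
  shows "decomposable I Q (\<Union>s\<in>S. A s)"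
  using assms
proof (induction S rule: finite_induct)
  case (insert s S)
  then show ?case using decomposable_Un [of I Q "A s" "\<Union>s\<in>S. A s"] by simp
qed (simp add: decomposable_empty)

lemma decomposable_Union:
  assumes "finite \<C>" "\<And>C. C \<in> \<C> \<Longrightarrow> decomposable I Q C"
  shows "decomposable I Q (\<Union>\<C>)"
  using decomposable_UN [OF assms(1), of I Q "\<lambda>C. C"] assms(2) by simp

text \<open>The problem moves to the image of \<open>C\<close> under forgetting \<open>i\<close>,
  where one coordinate fewer is left. It is solved there, and the resulting pieces are lifted back
  along the homeomorphism.\<close>

lemma decomposable_thin:
  assumes I: "finite I" and C: "dset I C" "thin I C" and Cont: "\<And>i. i \<in> I \<Longrightarrow> Cont (I - {i})"
    and f: "DefF M (vec_ctx I) f"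
  shows "decomposable I (\<lambda>C. continuous_on C f) C"
proof -
  obtain i g where i: "i \<in> I" and g: "continuous_on ((\<lambda>x. x(i := 0)) ` C) g" "\<And>x. x \<in> C \<Longrightarrow> x i = g (x(i := 0))"
    and mC: "meager I C"
    using C(2) unfolding thin_def by blast
  define J where "J = I - {i}"
  have J: "finite J" "i \<notin> J" "I = insert i J" "J \<subseteq> insert i I" using I i by (auto simp: J_def)
  have CR: "C \<subseteq> RR (insert i J)" using C(1) J(3) by (simp add: dset_def)
  define C' where "C' = {x \<in> RR J. \<exists>a. x(i := a) \<in> C}"
  have C'_eq: "C' = (\<lambda>x. x(i := 0)) ` C"
  proof
    show "C' \<subseteq> (\<lambda>x. x(i := 0)) ` C"
    proof
      fix x assume "x \<in> C'"
      then obtain a where "x \<in> RR J" "x(i := a) \<in> C" by (auto simp: C'_def)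
      moreover have "x = (x(i := a))(i := 0)" using \<open>x \<in> RR J\<close> J(2) by (simp add: drop_RR)
      ultimately show "x \<in> (\<lambda>x. x(i := 0)) ` C" by blast
    qed
    show "(\<lambda>x. x(i := 0)) ` C \<subseteq> C'"
    proof clarify
      fix x assume x: "x \<in> C"
      then have "(x(i := 0))(i := x i) \<in> C" by simp
      then show "x(i := 0) \<in> C'" using x CR drop_in_RR [OF J(2)] unfolding C'_def by blast
    qed
  qed
  have gC: "x(i := g x) \<in> C" "\<And>a. x(i := a) \<in> C \<Longrightarrow> a = g x" if xC: "x \<in> C'" for x
  proof -
    obtain y where y: "y \<in> C" "x = y(i := 0)" using xC C'_eq by blast
    then show "x(i := g x) \<in> C" using g(2) [OF y(1)] by (metis fun_upd_triv fun_upd_upd)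
    fix a assume "x(i := a) \<in> C"
    from g(2) [OF this] show "a = g x" using y(2) by simp
  qed
  have up: "DefV M (vec_ctx J \<otimes>\<^sub>c \<Delta>) J fst" for \<Delta> :: "real ctx"
    by (rule DefV_fst [OF DefV_id])
  have up2: "DefV M (vec_ctx J \<otimes>\<^sub>c real_ctx) I (\<lambda>c. (fst c)(i := snd c))"
    by (rule DefV_upd [OF up J(4) DefF_snd i])
  have up3: "DefV M (vec_ctx J \<otimes>\<^sub>c real_ctx \<otimes>\<^sub>c real_ctx) I (\<lambda>c. (fst (fst c))(i := snd c))"
    by (rule DefV_upd [OF DefV_fst [OF up] J(4) DefF_snd i])
  have dC': "dset J C'"
    unfolding C'_def by (intro dset_Collect Def_ex Def_mem [OF I C(1)] up2)
  \<comment> \<open>The value 0 off \<open>C'\<close> makes \<open>f'\<close> total. Its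
    definability does not go through \<open>g\<close>, about which only continuity is known: the
    missing coordinate is described as the \<open>a\<close> with \<open>x(i := a)\<close> in
    \<open>C\<close>.\<close>
  define f' where "f' x = (if x \<in> C' then f (x(i := g x)) else 0)" for x
  have f': "DefF M (vec_ctx J) f'"
  proof -
    have "Def M (vec_ctx J \<otimes>\<^sub>c real_ctx)
      (\<lambda>c. (fst c \<in> C' \<and> (\<exists>a. (fst c)(i := a) \<in> C \<and> f ((fst c)(i := a)) = snd c)) \<or> (fst c \<notin> C' \<and> 0 = snd c))"
      by (intro Def_disj Def_conj Def_not Def_mem [OF J(1) dC'] Def_ex Def_mem [OF I C(1)] Def_eq
          DefF_vec [OF I f] up up3 DefF_snd DefF_const DefF_fst)
    then show ?thesis unfolding DefF_def
      by (rule Def_eqI) (use gC in \<open>auto simp: f'_def\<close>)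
  qed
  obtain \<C>' where \<C>': "finite \<C>'" "\<And>B. B \<in> \<C>' \<Longrightarrow> piece J B \<and> continuous_on B f'" "C' = \<Union>\<C>'"
    using Cont [OF i, folded J_def, unfolded Cont_def, rule_format, OF dC' f']
    unfolding decomposable_def by blast
  define \<phi> where "\<phi> x = x(i := g x)" for x
  have drop\<phi>: "(\<phi> x)(i := 0) = x" if "x \<in> C'" for x
    using that J(2) by (auto simp: \<phi>_def C'_def drop_RR)
  have "piece I (\<phi> ` B) \<and> continuous_on (\<phi> ` B) f" if B: "B \<in> \<C>'" for B
  proof
    have BC: "B \<subseteq> C'" and B': "dset J B" "path_connected B" using \<C>' B by (auto simp: piece_def)
    have sub: "\<phi> ` B \<subseteq> C" using gC BC by (auto simp: \<phi>_def)
    have gB: "continuous_on B g" using g(1) BC C'_eq continuous_on_subset by blast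
    have "(\<lambda>x. x(i := 0)) ` \<phi> ` B = (\<lambda>x. x) ` B"
      unfolding image_image by (rule image_cong [OF refl]) (use drop\<phi> BC in blast)
    then have drop: "(\<lambda>x. x(i := 0)) ` \<phi> ` B = B" by simp
    have eq: "\<phi> ` B = {x \<in> RR I. x \<in> C \<and> x(i := 0) \<in> B}"
    proof
      show "\<phi> ` B \<subseteq> {x \<in> RR I. x \<in> C \<and> x(i := 0) \<in> B}"
        using sub dset_subset [OF C(1)] drop\<phi> BC by auto
      show "{x \<in> RR I. x \<in> C \<and> x(i := 0) \<in> B} \<subseteq> \<phi> ` B"
      proof
        fix x assume x: "x \<in> {x \<in> RR I. x \<in> C \<and> x(i := 0) \<in> B}"
        then have "x = \<phi> (x(i := 0))" using g(2) [of x] by (simp add: \<phi>_def) (metis fun_upd_triv)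
        then show "x \<in> \<phi> ` B" using x by blast
      qed
    qed
    have "dset I (\<phi> ` B)"
      unfolding eq
      by (intro dset_Collect Def_conj Def_mem [OF I C(1)] Def_mem [OF J(1) B'(1)] DefV_id DefV_drop [OF DefV_id])
        (use J in auto)
    moreover have "path_connected (\<phi> ` B)"
      unfolding \<phi>_def by (intro path_connected_continuous_image B' continuous_on_upd gB continuous_on_id)
    moreover have "thin I (\<phi> ` B)"
      unfolding thin_def
    proof (intro conjI bexI exI)
      show "meager I (\<phi> ` B)" using mC sub by (rule meager_subset)
      show "continuous_on ((\<lambda>x. x(i := 0)) ` \<phi> ` B) g" unfolding drop by (rule gB)
      show "\<forall>x\<in>\<phi> ` B. x i = g (x(i := 0))" using sub g(2) by blast
    qed (rule i)
    ultimately show "piece I (\<phi> ` B)" by (simp add: piece_def)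
    \<comment> \<open>On the lifted piece \<open>f\<close> is \<open>f'\<close> composed with
      forgetting \<open>i\<close>, so continuity comes back along a continuous map.\<close>
    have "continuous_on (\<phi> ` B) (\<lambda>x. f' (x(i := 0)))"
      using \<C>'(2) [OF B] by (intro continuous_on_compose2 [OF _ continuous_on_drop]) (auto simp: drop)
    moreover have "f' (x(i := 0)) = f x" if "x \<in> \<phi> ` B" for x
      using that drop\<phi> BC by (auto simp: f'_def \<phi>_def)
    ultimately show "continuous_on (\<phi> ` B) f" by (simp cong: continuous_on_cong)
  qed
  moreover have "C = (\<Union>B\<in>\<C>'. \<phi> ` B)"
  proof -
    have "C = \<phi> ` C'"
    proof
      show "\<phi> ` C' \<subseteq> C" using gC by (auto simp: \<phi>_def)
      show "C \<subseteq> \<phi> ` C'"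
      proof
        fix x assume x: "x \<in> C"
        have "x = \<phi> (x(i := 0))" using g(2) [OF x] by (simp add: \<phi>_def) (metis fun_upd_triv)
        then show "x \<in> \<phi> ` C'" using x C'_eq by blast
      qed
    qed
    then show ?thesis using \<C>'(3) by blast
  qed
  ultimately show ?thesis
    unfolding decomposable_def using \<C>'(1) by (intro exI [of _ "(\<lambda>B. \<phi> ` B) ` \<C>'"]) auto
qed

text \<open>On a thin piece the coordinate \<open>i\<close> of the base point is determined by the
  others and can be eliminated, leaving a family of fibres over a smaller coordinate space.\<close>

lemma UF_thin:
  assumes I: "finite I" and C: "dset I C" "thin I C" and UF: "\<And>i. i \<in> I \<Longrightarrow> UF (I - {i})"
    and A: "j \<notin> I" "dset (insert j I) A" "\<forall>x\<in>RR I. finite (fib j A x)"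
  shows "\<exists>K. \<forall>x\<in>C. card (fib j A x) \<le> K"
proof -
  obtain i g where i: "i \<in> I" and g: "\<And>x. x \<in> C \<Longrightarrow> x i = g (x(i := 0))"
    using C(2) unfolding thin_def by blast
  define J where "J = I - {i}"
  have J: "finite J" "i \<notin> J" "j \<notin> J" "i \<noteq> j" "I = insert i J" using I i A(1) by (auto simp: J_def)
  have CR: "C \<subseteq> RR (insert i J)" using C(1) J by (simp add: dset_def)
  \<comment> \<open>The fibre over \<open>x\<close> is that of \<open>A\<close> over the unique lift
    of \<open>x\<close> to \<open>C\<close>, and empty if there is no lift. Thus all fibres are
    finite over the whole of \<open>RR J\<close>, as \<open>UF\<close> demands.\<close>
  define A' where "A' = {z \<in> RR (insert j J). \<exists>a. z(j := 0, i := a) \<in> C \<and> z(i := a) \<in> A}"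
  have up: "DefV M (vec_ctx (insert j J) \<otimes>\<^sub>c real_ctx) (insert j J) fst"
    by (rule DefV_fst [OF DefV_id])
  have "dset (insert j J) A'"
    unfolding A'_def
    by (intro dset_Collect Def_ex Def_conj Def_mem [OF I C(1)] Def_mem [OF _ A(2)]
        DefV_upd [OF up] DefV_upd [OF DefV_drop [OF up, where I = J]] DefF_snd)
      (use I i J in auto)
  moreover have fibA': "fib j A' x = (if \<exists>a. x(i := a) \<in> C then fib j A (x(i := SOME a. x(i := a) \<in> C)) else {})"
    if x: "x \<in> RR J" for x
  proof -
    have *: "a = g x" if "x(i := a) \<in> C" for a
      using g [OF that] x J(2) by (simp add: drop_RR)
    have xj: "x j = 0" using x J(3) by (simp add: RR_def)
    have "b \<in> fib j A' x \<longleftrightarrow> (\<exists>a. x(i := a) \<in> C \<and> x(i := a, j := b) \<in> A)" for b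
      using upd_in_RR [OF x, of j b] drop_RR [OF x J(3)]
      by (simp add: fib_def A'_def fun_upd_twist [OF J(4), of x])
    moreover have "(SOME a. x(i := a) \<in> C) = a" if "x(i := a) \<in> C" for a
      using * that by (metis (mono_tags, lifting) someI_ex)
    ultimately show ?thesis by (auto simp: fib_def)
  qed
  moreover have "finite (fib j A' x)" if "x \<in> RR J" for x
  proof (cases "\<exists>a. x(i := a) \<in> C")
    case True
    then have "x(i := SOME a. x(i := a) \<in> C) \<in> RR I"
      using someI_ex [OF True] dset_subset [OF C(1)] by blast
    then show ?thesis using A(3) fibA' [OF that] True by auto
  qed (simp add: fibA' that)
  ultimately obtain K where K: "\<And>x. x \<in> RR J \<Longrightarrow> card (fib j A' x) \<le> K"
    using UF [OF i] J(3) unfolding UF_def J_def [symmetric] by blast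
  have "card (fib j A x) \<le> K" if x: "x \<in> C" for x
  proof -
    define y where "y = x(i := 0)"
    have y: "y \<in> RR J" using x CR drop_in_RR [OF J(2)] by (auto simp: y_def)
    have "y(i := a) \<in> C \<Longrightarrow> a = x i" for a
      using g [of "y(i := a)"] g [OF x] by (simp add: y_def)
    moreover have yC: "y(i := x i) \<in> C" using x by (simp add: y_def)
    ultimately have some: "(SOME a. y(i := a) \<in> C) = x i" by (rule some_equality [rotated])
    have "fib j A' y = fib j A (y(i := SOME a. y(i := a) \<in> C))"
      by (subst fibA' [OF y], rule if_P) (use yC in blast)
    also have "\<dots> = fib j A x"
      unfolding some by (simp add: y_def)
    finally have "fib j A' y = fib j A x" .
    then show ?thesis using K [OF y] by simp
  qed
  then show ?thesis by blast
qed

section \<open>Baire category: meager exceptional sets and piecewise continuity\<close>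

text \<open>An open piece of \<open>A\<close> lies in the interior of \<open>A\<close>, and each of
  the finitely many remaining pieces is meager.\<close>

lemma meager_boundary:
  assumes "Decomp I" "dset I A"
  shows "meager I (A - XX I interior_of A)"
proof -
  obtain \<C> where \<C>: "finite \<C>" "\<forall>C\<in>\<C>. piece I C" "A = \<Union>\<C>"
    using DecompD [OF assms] by blast
  have "meager I (C - XX I interior_of A)" if "C \<in> \<C>" for C
  proof (cases "openin (XX I) C")
    case True
    then have "C - XX I interior_of A = {}"
      using interior_of_maximal [OF _ True] that \<C>(3) by blast
    then show ?thesis using meager_empty by metis
  next
    case False
    then have "meager I C" using \<C>(2) that by (auto simp: piece_def thin_def)
    then show ?thesis by (rule meager_subset) blast
  qed
  then have "meager I (\<Union>C\<in>\<C>. C - XX I interior_of A)"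
    using \<C>(1) by (intro meager_UN countable_finite)
  then show ?thesis by (rule meager_subset) (use \<C>(3) in blast)
qed

lemma meager_boundaries:
  assumes "Decomp I" "countable \<S>" "\<And>S. S \<in> \<S> \<Longrightarrow> dset I S"
  shows "meager I (\<Union>S\<in>\<S>. S - XX I interior_of S)"
  using assms by (intro meager_UN meager_boundary)

text \<open>Outside one meager set, whichever of countably many chosen definable properties holds at
  a point also holds near it.\<close>

lemma not_in_boundaries:
  assumes "x \<notin> (\<Union>S\<in>\<S>. S - XX I interior_of S)" "{z \<in> RR I. P z} \<in> \<S>" "x \<in> RR I" "P x"
  shows "near I x P"
proof -
  have "x \<in> XX I interior_of {z \<in> RR I. P z}" using assms by blast
  then show ?thesis unfolding near_def interior_of_def by blast
qed

text \<open>By Baire's theorem no nonempty piece of a meager set is open, so all its nonempty pieces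
  are thin and lose a coordinate.\<close>

lemma decomposable_meager:
  assumes I: "finite I" "Decomp I" and A: "dset I A" "meager I A" and Cont: "\<And>i. i \<in> I \<Longrightarrow> Cont (I - {i})"
    and f: "DefF M (vec_ctx I) f"
  shows "decomposable I (\<lambda>C. continuous_on C f) A"
proof -
  obtain \<C> where \<C>: "finite \<C>" "\<forall>C\<in>\<C>. piece I C" "A = \<Union>\<C>"
    using DecompD [OF I(2) A(1)] by blast
  have "decomposable I (\<lambda>C. continuous_on C f) C" if C: "C \<in> \<C>" for C
  proof (cases "C = {}")
    case False
    have "meager I C" using A(2) by (rule meager_subset) (use C \<C>(3) in blast)
    then have "\<not> openin (XX I) C" using not_meager_open False by blast
    then have "thin I C" "dset I C" using \<C>(2) C by (auto simp: piece_def)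
    then show ?thesis using decomposable_thin I(1) Cont f by blast
  qed (simp add: decomposable_empty)
  then show ?thesis unfolding \<C>(3) by (rule decomposable_Union [OF \<C>(1)])
qed

lemma Cont_step:
  assumes I: "finite I" "Decomp I" and Cont: "\<And>i. i \<in> I \<Longrightarrow> Cont (I - {i})"
  shows "Cont I"
  unfolding Cont_def
proof (intro allI impI)
  fix A f assume A: "dset I A" and f: "DefF M (vec_ctx I) f"
  \<comment> \<open>Continuity at \<open>x\<close>, with real bounds so that the condition is first
    order. The rational bounds in \<open>\<S>\<close> serve only to show that the complement of
    \<open>D\<close> is meager.\<close>
  define D where "D = {x \<in> RR I. \<forall>a b. a < f x \<and> f x < b \<longrightarrow> near I x (\<lambda>z. a < f z \<and> f z < b)}"
  have v: "DefV M (vec_ctx I \<otimes>\<^sub>c real_ctx \<otimes>\<^sub>c real_ctx) I (\<lambda>c. fst (fst c))"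
    by (intro DefV_fst DefV_id)
  have D: "dset I D"
    unfolding D_def
    by (intro dset_Collect Def_all Def_imp Def_conj Def_near [OF I(1)] Def_less DefF_vec [OF I(1) f] v
        DefV_snd DefF_snd DefF_fst)
  define \<S> where "\<S> = (\<lambda>(q, r). {z \<in> RR I. of_rat q < f z \<and> f z < of_rat r}) ` (UNIV :: (rat \<times> rat) set)"
  have "dset I S" if "S \<in> \<S>" for S
    using that unfolding \<S>_def
    by (auto intro!: dset_Collect Def_conj Def_less DefF_const f simp del: of_rat_less)
  then have m: "meager I (\<Union>S\<in>\<S>. S - XX I interior_of S)"
    by (intro meager_boundaries I) (auto simp: \<S>_def)
  have "RR I - D \<subseteq> (\<Union>S\<in>\<S>. S - XX I interior_of S)"
  proof (rule ccontr)
    assume "\<not> ?thesis"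
    then obtain x where x: "x \<in> RR I" "x \<notin> D" and nx: "x \<notin> (\<Union>S\<in>\<S>. S - XX I interior_of S)" by blast
    have "near I x (\<lambda>z. a < f z \<and> f z < b)" if ab: "a < f x" "f x < b" for a b
    proof -
      obtain q r where qr: "a < of_rat q" "of_rat q < f x" "f x < of_rat r" "of_rat r < b"
        using of_rat_dense ab by metis
      have "near I x (\<lambda>z. of_rat q < f z \<and> f z < of_rat r)"
        by (rule not_in_boundaries [OF nx]) (use x qr in \<open>auto simp: \<S>_def\<close>)
      then show ?thesis by (rule near_mono) (use qr in auto)
    qed
    then show False using x by (auto simp: D_def)
  qed
  then have "meager I (A - D)"
    using dset_subset [OF A] by (intro meager_subset [OF m]) blast
  then have 1: "decomposable I (\<lambda>C. continuous_on C f) (A - D)"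
    using decomposable_meager [OF I _ _ Cont f] dset_Diff [OF I(1) A D] by blast
  have "decomposable I (\<lambda>_. True) (A \<inter> D)"
    using I(2) dset_Int [OF I(1) A D] unfolding Decomp_def by blast
  moreover have contD: "continuous_on D f"
    unfolding continuous_on_def
  proof (intro ballI order_tendstoI)
    fix x a assume x: "x \<in> D" and a: "a < f x"
    \<comment> \<open>The condition defining \<open>D\<close> concerns two-sided intervals, so a
      one-sided bound is completed by an arbitrary second one.\<close>
    have "near I x (\<lambda>z. a < f z \<and> f z < f x + 1)"
      using x a by (auto simp: D_def)
    then obtain T where "open T" "x \<in> T" "\<forall>z\<in>RR I \<inter> T. a < f z"
      unfolding near_def XX_def openin_open by blast
    then show "\<forall>\<^sub>F z in at x within D. a < f z"
      unfolding eventually_at_topological by (auto simp: D_def)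
  next
    fix x a assume x: "x \<in> D" and a: "f x < a"
    have "near I x (\<lambda>z. f x - 1 < f z \<and> f z < a)"
      using x a by (auto simp: D_def)
    then obtain T where "open T" "x \<in> T" "\<forall>z\<in>RR I \<inter> T. f z < a"
      unfolding near_def XX_def openin_open by blast
    then show "\<forall>\<^sub>F z in at x within D. f z < a"
      unfolding eventually_at_topological by (auto simp: D_def)
  qed
  ultimately have 2: "decomposable I (\<lambda>C. continuous_on C f) (A \<inter> D)"
    unfolding decomposable_def by (metis (no_types, lifting) Int_lower2 Union_upper continuous_on_subset subset_trans)
  show "decomposable I (\<lambda>C. continuous_on C f) A"
    using decomposable_Un [OF 2 1] by (simp add: Int_Diff_Un)
qed

end

section \<open>Uniform finiteness of fibres\<close>

text \<open>
  A point \<open>x\<close> is good for \<open>A\<close> when nearby fibres of \<open>A\<close> are bounded and every real \<open>r\<close> has a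
  neighbourhood in which nearby fibres behave like the one over \<open>x\<close>. This is first order, and it makes
  the number of points of the fibre locally constant.
\<close>

definition good :: "nat set \<Rightarrow> nat \<Rightarrow> (nat \<Rightarrow> real) set \<Rightarrow> (nat \<Rightarrow> real) \<Rightarrow> bool" where
  "good I j A x \<longleftrightarrow>
     (\<exists>s t. near I x (\<lambda>z. \<forall>y. z(j := y) \<in> A \<longrightarrow> s < y \<and> y < t)) \<and>
     (\<forall>r. (\<exists>s t. s < r \<and> r < t \<and> near I x (\<lambda>z. \<forall>y. s < y \<and> y < t \<longrightarrow> z(j := y) \<notin> A)) \<or>
          (\<exists>s0 t0. s0 < r \<and> r < t0 \<and> (\<forall>s t. s0 < s \<and> s < r \<and> r < t \<and> t < t0 \<longrightarrow>
             near I x (\<lambda>z. \<exists>y. (s < y \<and> y < t \<and> z(j := y) \<in> A) \<and>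
               (\<forall>y'. s < y' \<and> y' < t \<and> z(j := y') \<in> A \<longrightarrow> y' = y)))))"

lemma near_self: "near I x Q \<Longrightarrow> Q x"
  by (auto simp: near_def)

lemma unique_in_interval_iff:
  fixes s t :: real
  shows "(\<exists>y. (s < y \<and> y < t \<and> Q y) \<and> (\<forall>y'. s < y' \<and> y' < t \<and> Q y' \<longrightarrow> y' = y)) \<longleftrightarrow>
    (\<exists>y. {a. Q a} \<inter> {s<..<t} = {y})"
  by (intro iff_exI, simp only: set_eq_iff Int_iff mem_Collect_eq greaterThanLessThan_iff singleton_iff) blast

lemma finite_separation:
  fixes F :: "real set"
  assumes "finite F" "\<And>r. r \<in> F \<Longrightarrow> e r > 0"
  obtains d where "d > 0" "\<And>r. r \<in> F \<Longrightarrow> d < e r" "\<And>r r'. r \<in> F \<Longrightarrow> r' \<in> F \<Longrightarrow> r \<noteq> r' \<Longrightarrow> 2 * d < \<bar>r - r'\<bar>"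
proof -
  define D where "D = insert 1 (e ` F \<union> (\<lambda>(r, r'). \<bar>r - r'\<bar> / 2) ` {(r, r') \<in> F \<times> F. r \<noteq> r'})"
  have "finite {(r, r') \<in> F \<times> F. r \<noteq> r'}"
    by (rule finite_subset [of _ "F \<times> F"]) (use assms(1) in auto)
  then have D: "finite D" "D \<noteq> {}" "\<And>a. a \<in> D \<Longrightarrow> a > 0"
    using assms by (auto simp: D_def)
  define d where "d = Min D / 2"
  have "Min D > 0" using D by simp
  have m: "d < a" if "a \<in> D" for a
    using Min_le [OF D(1) that] \<open>Min D > 0\<close> by (simp add: d_def)
  have 3: "\<bar>r - r'\<bar> / 2 \<in> D" if "r \<in> F" "r' \<in> F" "r \<noteq> r'" for r r'
    using that by (force simp: D_def)
  show ?thesis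
  proof
    show "d > 0" using \<open>Min D > 0\<close> by (simp add: d_def)
    show "d < e r" if "r \<in> F" for r by (rule m) (use that in \<open>simp add: D_def\<close>)
    show "2 * d < \<bar>r - r'\<bar>" if "r \<in> F" "r' \<in> F" "r \<noteq> r'" for r r'
      using m [OF 3 [OF that]] by simp
  qed
qed

text \<open>Each point of the fibre over \<open>x\<close> has a small interval in which nearby
  fibres have exactly one point. The rest of a bounded interval is compact and is covered by
  finitely many intervals that nearby fibres avoid, so points neither appear nor vanish.\<close>

lemma good_card:
  assumes good: "good I j A x" and fin: "finite {a. x(j := a) \<in> A}" and x: "x \<in> RR I"
  shows "near I x (\<lambda>z. card {a. z(j := a) \<in> A} = card {a. x(j := a) \<in> A})"
proof -
  define fb where "fb z = {a. z(j := a) \<in> A}" for z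
  define F where "F = fb x"
  have F: "finite F" using fin by (simp add: F_def fb_def)
  have "\<exists>s0 t0. s0 < r \<and> r < t0 \<and> (\<forall>s t. s0 < s \<and> s < r \<and> r < t \<and> t < t0 \<longrightarrow>
          near I x (\<lambda>z. \<exists>y. fb z \<inter> {s<..<t} = {y}))" if "r \<in> F" for r
  proof -
    have "\<not> (\<exists>s t. s < r \<and> r < t \<and> near I x (\<lambda>z. \<forall>y. s < y \<and> y < t \<longrightarrow> z(j := y) \<notin> A))"
      using that near_self by (force simp: F_def fb_def)
    then obtain s0 t0 where st0: "s0 < r" "r < t0" and *: "\<And>s t. s0 < s \<and> s < r \<and> r < t \<and> t < t0 \<Longrightarrow>
             near I x (\<lambda>z. \<exists>y. (s < y \<and> y < t \<and> z(j := y) \<in> A) \<and>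
               (\<forall>y'. s < y' \<and> y' < t \<and> z(j := y') \<in> A \<longrightarrow> y' = y))"
      using good unfolding good_def by meson
    have "near I x (\<lambda>z. \<exists>y. fb z \<inter> {s<..<t} = {y})" if "s0 < s \<and> s < r \<and> r < t \<and> t < t0" for s t
      using * [OF that] by (simp only: unique_in_interval_iff fb_def)
    then show ?thesis using st0 by blast
  qed
  then obtain s0 t0 where st0: "\<And>r. r \<in> F \<Longrightarrow> s0 r < r \<and> r < t0 r"
    and one: "\<And>r s t. r \<in> F \<Longrightarrow> s0 r < s \<and> s < r \<and> r < t \<and> t < t0 r \<Longrightarrow>
          near I x (\<lambda>z. \<exists>y. fb z \<inter> {s<..<t} = {y})"
    by metis
  \<comment> \<open>Radius \<open>d\<close> lies within the range in which nearby fibres have one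
    point, and the separation by \<open>2 * d\<close> makes the intervals \<open>J r\<close>
    disjoint.\<close>
  obtain d where d: "d > 0" "\<And>r. r \<in> F \<Longrightarrow> d < min (r - s0 r) (t0 r - r)"
    "\<And>r r'. r \<in> F \<Longrightarrow> r' \<in> F \<Longrightarrow> r \<noteq> r' \<Longrightarrow> 2 * d < \<bar>r - r'\<bar>"
    by (rule finite_separation [OF F, of "\<lambda>r. min (r - s0 r) (t0 r - r)"]) (use st0 in auto)
  define J where "J r = {r - d<..<r + d}" for r
  have J1: "near I x (\<lambda>z. \<exists>y. fb z \<inter> J r = {y})" if "r \<in> F" for r
    unfolding J_def by (rule one [OF that]) (use d that in fastforce)
  have "\<exists>s t. s < r \<and> r < t \<and> near I x (\<lambda>z. fb z \<inter> {s<..<t} = {})" if r: "r \<notin> F" for r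
  proof -
    \<comment> \<open>For \<open>r\<close> outside \<open>F\<close> the second alternative of
      \<open>good\<close> fails at \<open>x\<close> itself: it would put a point of \<open>F\<close>
      into every small interval around \<open>r\<close>, but \<open>F\<close> is finite and misses
      \<open>r\<close>.\<close>
    have "\<not> (\<exists>s0 t0. s0 < r \<and> r < t0 \<and> (\<forall>s t. s0 < s \<and> s < r \<and> r < t \<and> t < t0 \<longrightarrow>
             near I x (\<lambda>z. \<exists>y. (s < y \<and> y < t \<and> z(j := y) \<in> A) \<and>
               (\<forall>y'. s < y' \<and> y' < t \<and> z(j := y') \<in> A \<longrightarrow> y' = y))))"
    proof clarify
      fix s0 t0 assume st0: "s0 < r" "r < t0" and *: "\<forall>s t. s0 < s \<and> s < r \<and> r < t \<and> t < t0 \<longrightarrow>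
             near I x (\<lambda>z. \<exists>y. (s < y \<and> y < t \<and> z(j := y) \<in> A) \<and>
               (\<forall>y'. s < y' \<and> y' < t \<and> z(j := y') \<in> A \<longrightarrow> y' = y))"
      obtain e where e: "e > 0" "\<And>a. a \<in> insert r F \<Longrightarrow> e < min (r - s0) (t0 - r)"
        "\<And>a a'. a \<in> insert r F \<Longrightarrow> a' \<in> insert r F \<Longrightarrow> a \<noteq> a' \<Longrightarrow> 2 * e < \<bar>a - a'\<bar>"
        by (rule finite_separation [of "insert r F" "\<lambda>_. min (r - s0) (t0 - r)"]) (use F st0 in auto)
      have "s0 < r - e \<and> r - e < r \<and> r < r + e \<and> r + e < t0"
        using e(1,2) by fastforce
      from near_self [OF * [rule_format, OF this]] obtain y where y: "r - e < y" "y < r + e" "y \<in> F"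
        by (auto simp: F_def fb_def)
      then have "r \<noteq> y" using r by blast
      then have "2 * e < \<bar>r - y\<bar>" using e(3) y(3) by blast
      then show False using y e(1) by linarith
    qed
    then obtain s t where st: "s < r" "r < t" and *: "near I x (\<lambda>z. \<forall>y. s < y \<and> y < t \<longrightarrow> z(j := y) \<notin> A)"
      using good unfolding good_def by meson
    have "near I x (\<lambda>z. fb z \<inter> {s<..<t} = {})"
      by (rule near_mono [OF *]) (auto simp: fb_def)
    then show ?thesis using st by blast
  qed
  then obtain s t where st: "\<And>r. r \<notin> F \<Longrightarrow> s r < r \<and> r < t r \<and> near I x (\<lambda>z. fb z \<inter> {s r<..<t r} = {})"
    by metis
  obtain a b where ab: "near I x (\<lambda>z. fb z \<subseteq> {a<..<b})"
  proof -
    obtain a b where *: "near I x (\<lambda>z. \<forall>y. z(j := y) \<in> A \<longrightarrow> a < y \<and> y < b)"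
      using good unfolding good_def by blast
    show ?thesis by (rule that [of a b], rule near_mono [OF *]) (auto simp: fb_def)
  qed
  have JF: "r \<in> J r" for r using d(1) by (simp add: J_def)
  have comp: "compact ({a..b} - (\<Union>r\<in>F. J r))"
    by (intro compact_diff compact_Icc open_UN) (simp add: J_def)
  \<comment> \<open>A point outside all \<open>J r\<close> is not in \<open>F\<close>, hence has an
    interval avoided by nearby fibres.\<close>
  have sub: "{a..b} - (\<Union>r\<in>F. J r) \<subseteq> (\<Union>r\<in>-F. {s r<..<t r})"
    using st JF by fastforce
  obtain G where G: "G \<subseteq> -F" "finite G" "{a..b} - (\<Union>r\<in>F. J r) \<subseteq> (\<Union>r\<in>G. {s r<..<t r})"
    by (rule compactE_image [OF comp _ sub]) auto
  have "near I x (\<lambda>z. (fb z \<subseteq> {a<..<b} \<and> (\<forall>r\<in>F. \<exists>y. fb z \<inter> J r = {y})) \<and> (\<forall>r\<in>G. fb z \<inter> {s r<..<t r} = {}))"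
    by (intro near_conj ab near_Ball F J1 G x) (use G st in auto)
  then have "near I x (\<lambda>z. card (fb z) = card F)"
  proof (rule near_mono)
    fix z assume *: "(fb z \<subseteq> {a<..<b} \<and> (\<forall>r\<in>F. \<exists>y. fb z \<inter> J r = {y})) \<and> (\<forall>r\<in>G. fb z \<inter> {s r<..<t r} = {})"
    then obtain y where y: "\<And>r. r \<in> F \<Longrightarrow> fb z \<inter> J r = {y r}" by metis
    have "fb z = y ` F"
    proof
      show "y ` F \<subseteq> fb z" using y by blast
      show "fb z \<subseteq> y ` F"
      proof
        fix w assume w: "w \<in> fb z"
        then have "w \<in> {a..b}" using * by auto
        moreover have "w \<notin> (\<Union>r\<in>G. {s r<..<t r})" using * w by blast
        ultimately obtain r where "r \<in> F" "w \<in> J r" using G(3) by blast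
        then show "w \<in> y ` F" using y w by blast
      qed
    qed
    moreover have "inj_on y F"
    proof (rule inj_onI, rule ccontr)
      fix r r' assume r: "r \<in> F" "r' \<in> F" "y r = y r'" "r \<noteq> r'"
      have "y r \<in> J r" "y r \<in> J r'" using y [OF r(1)] y [OF r(2)] r(3) by auto
      then show False using d(3) [OF r(1,2,4)] by (auto simp: J_def)
    qed
    ultimately show "card (fb z) = card F" by (simp add: card_image)
  qed
  then show ?thesis by (simp add: fb_def F_def)
qed

context ordered_structure
begin

lemma dset_good:
  assumes I: "finite I" and j: "j \<notin> I" and A: "dset (insert j I) A"
  shows "dset I {x \<in> RR I. good I j A x}"
proof -
  have fin: "finite (insert j I)" using I by simp
  have up: "DefV M (\<Gamma> \<otimes>\<^sub>c vec_ctx I \<otimes>\<^sub>c real_ctx) (insert j I) (\<lambda>c. (snd (fst c))(j := snd c))" for \<Gamma> :: "'c ctx"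
    by (rule DefV_upd [OF DefV_fst [OF DefV_snd] _ DefF_snd]) auto
  have up2: "DefV M (\<Gamma> \<otimes>\<^sub>c vec_ctx I \<otimes>\<^sub>c real_ctx \<otimes>\<^sub>c real_ctx) (insert j I) (\<lambda>c. (snd (fst (fst c)))(j := snd c))"
    for \<Gamma> :: "'c ctx"
    by (rule DefV_upd [OF DefV_fst [OF DefV_fst [OF DefV_snd]] _ DefF_snd]) auto
  show ?thesis
    unfolding good_def
    by (intro dset_Collect Def_conj Def_disj Def_imp Def_ex Def_all Def_not Def_near [OF I] Def_less Def_eq
        Def_mem [OF fin A] up up2 DefF_snd DefF_fst DefV_fst DefV_id)
qed

text \<open>Rational versions of the three conditions in \<open>good\<close> form a countable
  family, so outside a meager set each one that holds at \<open>x\<close> persists near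
  \<open>x\<close>. Isolation of the points of a finite fibre supplies enough rational intervals at
  which they hold.\<close>

lemma meager_bad:
  assumes I: "finite I" "Decomp I" and j: "j \<notin> I" and A: "dset (insert j I) A"
    and fin: "\<forall>x\<in>RR I. finite (fib j A x)"
  shows "meager I {x \<in> RR I. \<not> good I j A x}"
proof -
  define P where "P s t z \<longleftrightarrow> (\<exists>y. (s < y \<and> y < t \<and> z(j := y) \<in> A) \<and>
      (\<forall>y'. s < y' \<and> y' < t \<and> z(j := y') \<in> A \<longrightarrow> y' = y))" for s t and z :: "nat \<Rightarrow> real"
  define Z where "Z s t z \<longleftrightarrow> (\<forall>y. s < y \<and> y < t \<longrightarrow> z(j := y) \<notin> A)" for s t and z :: "nat \<Rightarrow> real"
  define B where "B s t z \<longleftrightarrow> (\<forall>y. z(j := y) \<in> A \<longrightarrow> s < y \<and> y < t)" for s t and z :: "nat \<Rightarrow> real"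
  have fin': "finite (insert j I)" using I by simp
  have up: "DefV M (vec_ctx I \<otimes>\<^sub>c real_ctx) (insert j I) (\<lambda>c. (fst c)(j := snd c))"
    by (rule DefV_upd [OF DefV_fst [OF DefV_id] _ DefF_snd]) auto
  have up2: "DefV M (vec_ctx I \<otimes>\<^sub>c real_ctx \<otimes>\<^sub>c real_ctx) (insert j I) (\<lambda>c. (fst (fst c))(j := snd c))"
    by (rule DefV_upd [OF DefV_fst [OF DefV_fst [OF DefV_id]] _ DefF_snd]) auto
  have PZB: "dset I {z \<in> RR I. P s t z}" "dset I {z \<in> RR I. Z s t z}" "dset I {z \<in> RR I. B s t z}" for s t
    unfolding P_def Z_def B_def
    by (intro dset_Collect Def_conj Def_imp Def_ex Def_all Def_not Def_less Def_eq Def_mem [OF fin' A] up up2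
        DefF_const DefF_snd DefF_fst)+
  define \<S> where "\<S> = (\<Union>(q, r)\<in>(UNIV :: (rat \<times> rat) set).
     {{z \<in> RR I. P (of_rat q) (of_rat r) z}, {z \<in> RR I. Z (of_rat q) (of_rat r) z}, {z \<in> RR I. B (of_rat q) (of_rat r) z}})"
  have \<S>: "{z \<in> RR I. P (of_rat q) (of_rat r) z} \<in> \<S>" "{z \<in> RR I. Z (of_rat q) (of_rat r) z} \<in> \<S>"
     "{z \<in> RR I. B (of_rat q) (of_rat r) z} \<in> \<S>" for q r
    by (auto simp: \<S>_def)
  have m: "meager I (\<Union>S\<in>\<S>. S - XX I interior_of S)"
  proof (rule meager_boundaries [OF I(2)])
    show "countable \<S>" unfolding \<S>_def by (intro countable_UN) auto
    show "dset I S" if "S \<in> \<S>" for S using that PZB by (auto simp: \<S>_def)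
  qed
  have "good I j A x" if x: "x \<in> RR I" and nx: "x \<notin> (\<Union>S\<in>\<S>. S - XX I interior_of S)" for x
  proof -
    note nP = not_in_boundaries [OF nx \<S>(1) x] and nZ = not_in_boundaries [OF nx \<S>(2) x]
      and nB = not_in_boundaries [OF nx \<S>(3) x]
    define F where "F = fib j A x"
    have F: "finite F" using fin x by (simp add: F_def)
    have memF: "y \<in> F \<longleftrightarrow> x(j := y) \<in> A" for y by (simp add: F_def fib_def)
    have iso: "\<exists>e>0. \<forall>y\<in>F. y \<noteq> r \<longrightarrow> e < \<bar>y - r\<bar>" for r
    proof -
      obtain d where "d > 0" "\<And>a a'. a \<in> insert r F \<Longrightarrow> a' \<in> insert r F \<Longrightarrow> a \<noteq> a' \<Longrightarrow> 2 * d < \<bar>a - a'\<bar>"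
        by (rule finite_separation [of "insert r F" "\<lambda>_. 1"]) (use F in auto)
      then have "d < \<bar>y - r\<bar>" if "y \<in> F" "y \<noteq> r" for y
        using that by (smt (verit) insertCI)
      then show ?thesis using \<open>d > 0\<close> by blast
    qed
    have "\<exists>q r. B (of_rat q) (of_rat r) x"
    proof -
      obtain q r where "of_rat q < Min (insert 0 F)" "Max (insert 0 F) < of_rat r"
        using of_rat_dense lt_ex gt_ex by metis
      then have "B (of_rat q) (of_rat r) x"
        unfolding B_def using F memF by auto
      then show ?thesis by blast
    qed
    then have 1: "\<exists>s t. near I x (B s t)" using nB by blast
    have 2: "(\<exists>s t. s < r \<and> r < t \<and> near I x (Z s t)) \<or>
          (\<exists>s0 t0. s0 < r \<and> r < t0 \<and> (\<forall>s t. s0 < s \<and> s < r \<and> r < t \<and> t < t0 \<longrightarrow> near I x (P s t)))" for r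
    proof -
      obtain e where e: "e > 0" "\<And>y. y \<in> F \<Longrightarrow> y \<noteq> r \<Longrightarrow> e < \<bar>y - r\<bar>" using iso by blast
      obtain q0 r0 where q0: "r - e < of_rat q0" "of_rat q0 < r" and r0: "r < of_rat r0" "of_rat r0 < r + e"
        using of_rat_dense [of "r - e" r] of_rat_dense [of r "r + e"] e(1) by auto
      have onlyr: "y = r" if "y \<in> F" "of_rat q0 < y" "y < of_rat r0" for y
        using e(2) [OF that(1)] that q0 r0 by (cases "y = r") auto
      show ?thesis
      proof (cases "r \<in> F")
        case False
        then have "Z (of_rat q0) (of_rat r0) x"
          using onlyr memF unfolding Z_def by blast
        then show ?thesis using nZ q0 r0 by blast
      next
        case True
        have Px: "P (of_rat q) (of_rat q') x" if "of_rat q0 \<le> (of_rat q :: real)" "of_rat q < r" "r < of_rat q'" "of_rat q' \<le> (of_rat r0 :: real)"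
          for q q'
          unfolding P_def
        proof (intro exI [of _ r] conjI allI impI)
          show "x(j := r) \<in> A" using True memF by simp
          fix y' assume "of_rat q < y' \<and> y' < of_rat q' \<and> x(j := y') \<in> A"
          then show "y' = r" using that memF by (intro onlyr) auto
        qed (use that in auto)
        have "near I x (P s t)" if st: "of_rat q0 < s \<and> s < r \<and> r < t \<and> t < of_rat r0" for s t
        proof -
          obtain q q' where q: "s < of_rat q" "of_rat q < r" "r < of_rat q'" "of_rat q' < t"
            using of_rat_dense st by metis
          \<comment> \<open>The interval from \<open>s\<close> to \<open>t\<close> is squeezed
            between two rational ones: the inner one gives existence of a point, the outer one its
            uniqueness.\<close>
          have "near I x (\<lambda>z. P (of_rat q) (of_rat q') z \<and> P (of_rat q0) (of_rat r0) z)"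
            by (intro near_conj nP Px) (use q st q0 r0 in auto)
          then show ?thesis
          proof (rule near_mono)
            fix z assume "P (of_rat q) (of_rat q') z \<and> P (of_rat q0) (of_rat r0) z"
            then obtain y w where "of_rat q < y" "y < of_rat q'" "z(j := y) \<in> A"
              "\<And>y'. of_rat q0 < y' \<Longrightarrow> y' < of_rat r0 \<Longrightarrow> z(j := y') \<in> A \<Longrightarrow> y' = w"
              unfolding P_def by blast
            note yw = this
            have "y = w" by (rule yw(4)) (use yw q st in auto)
            show "P s t z"
              unfolding P_def
            proof (intro exI [of _ y] conjI allI impI)
              fix y' assume "s < y' \<and> y' < t \<and> z(j := y') \<in> A"
              then show "y' = y" unfolding \<open>y = w\<close> using st by (intro yw(4)) auto
            qed (use yw q in auto)
          qed
        qed
        then show ?thesis using q0 r0 by blast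
      qed
    qed
    show ?thesis
      unfolding good_def using 1 2 unfolding B_def Z_def P_def by blast
  qed
  then show ?thesis
    by (intro meager_subset [OF m]) blast
qed

text \<open>On the good set the size of the fibre is locally constant, hence constant on each
  connected piece. The remaining set is meager, so its nonempty pieces are thin and smaller
  coordinate spaces bound the fibres there.\<close>

lemma UF_step:
  assumes I: "finite I" "Decomp I" and UF: "\<And>i. i \<in> I \<Longrightarrow> UF (I - {i})"
  shows "UF I"
  unfolding UF_def
proof (intro allI impI)
  fix j A assume j: "j \<notin> I" and A: "dset (insert j I) A" and fin: "\<forall>x\<in>RR I. finite (fib j A x)"
  define G where "G = {x \<in> RR I. good I j A x}"
  have G: "dset I G" unfolding G_def by (rule dset_good [OF I(1) j A])
  have mG: "meager I (RR I - G)"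
    by (rule meager_subset [OF meager_bad [OF I j A fin]]) (auto simp: G_def)
  obtain \<C> where \<C>: "finite \<C>" "\<forall>C\<in>\<C>. piece I C" "G = \<Union>\<C>"
    using DecompD [OF I(2) G] by blast
  obtain \<D> where "finite \<D> \<and> (\<forall>C\<in>\<D>. piece I C) \<and> RR I - G = \<Union>\<D>"
    using DecompD [OF I(2) dset_Diff [OF I(1) dset_RR G]] by (rule exE)
  then have \<D>: "finite \<D>" "\<forall>C\<in>\<D>. piece I C" "RR I - G = \<Union>\<D>" by simp_all
  have "\<exists>K. \<forall>x\<in>C. card (fib j A x) \<le> K" if C: "C \<in> \<C> \<union> \<D>" for C
  proof (cases "C \<in> \<C>")
    case True
    have "(\<lambda>x. card (fib j A x)) constant_on C"
    proof (rule locally_constant_imp_constant)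
      show "connected C" using True \<C>(2) by (simp add: piece_def path_connected_imp_connected)
      fix x assume x: "x \<in> C"
      then have xG: "x \<in> RR I" "good I j A x" and CR: "C \<subseteq> RR I" using True \<C>(3) by (auto simp: G_def)
      obtain U where U: "openin (XX I) U" "x \<in> U" "\<And>z. z \<in> U \<Longrightarrow> card (fib j A z) = card (fib j A x)"
        using good_card [OF xG(2) _ xG(1)] fin [rule_format, OF xG(1)] unfolding near_def fib_def by blast
      obtain T where T: "open T" "U = RR I \<inter> T" using U(1) unfolding XX_def openin_open by blast
      have "openin (top_of_set C) (C \<inter> T)" using T(1) by (rule openin_open_Int)
      moreover have "x \<in> C \<inter> T" using U(2) T(2) x by blast
      moreover have "\<forall>z\<in>C \<inter> T. card (fib j A z) = card (fib j A x)"
      proof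
        fix z assume "z \<in> C \<inter> T"
        then show "card (fib j A z) = card (fib j A x)" using T(2) CR by (intro U(3)) blast
      qed
      ultimately show "\<exists>T. openin (top_of_set C) T \<and> x \<in> T \<and> (\<forall>z\<in>T. card (fib j A z) = card (fib j A x))"
        by blast
    qed
    then show ?thesis unfolding constant_on_def by (metis order_refl)
  next
    case False
    then have CD: "C \<in> \<D>" using C by blast
    show ?thesis
    proof (cases "C = {}")
      case False
      have "meager I C" using mG by (rule meager_subset) (use CD \<D>(3) in blast)
      then have "\<not> openin (XX I) C" using not_meager_open False by blast
      then have "thin I C" "dset I C" using \<D>(2) CD by (auto simp: piece_def)
      then show ?thesis by (intro UF_thin [OF I(1) _ _ UF j A fin])
    qed auto
  qed
  then obtain K where K: "\<And>C x. C \<in> \<C> \<union> \<D> \<Longrightarrow> x \<in> C \<Longrightarrow> card (fib j A x) \<le> K C" by metis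
  have "card (fib j A x) \<le> (\<Sum>C\<in>\<C> \<union> \<D>. K C)" if "x \<in> RR I" for x
  proof -
    have "x \<in> \<Union>\<C> \<union> \<Union>\<D>"
      unfolding \<C>(3) [symmetric] \<D>(3) [symmetric] using that by blast
    then obtain C where C: "C \<in> \<C> \<union> \<D>" "x \<in> C" by blast
    then have "card (fib j A x) \<le> K C" by (rule K)
    also have "\<dots> \<le> (\<Sum>C\<in>\<C> \<union> \<D>. K C)" using C \<C>(1) \<D>(1) by (intro member_le_sum) auto
    finally show ?thesis .
  qed
  then show "\<exists>K. \<forall>x\<in>RR I. card (fib j A x) \<le> K" by blast
qed

end

section \<open>Boundary points of subsets of the line\<close>

lemma finite_frontier_open_interval:
  assumes "open_interval S"
  shows "finite (frontier S)"
proof -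
  obtain a b :: ereal where S: "S = {x. a < ereal x \<and> ereal x < b}"
    using assms by (auto simp: open_interval_def)
  have "finite (frontier {x. a < ereal x})"
    by (cases a) (simp_all flip: greaterThan_def)
  moreover have "finite (frontier {x. ereal x < b})"
    by (cases b) (simp_all flip: lessThan_def)
  moreover have "S = {x. a < ereal x} \<inter> {x. ereal x < b}"
    by (auto simp: S)
  ultimately show ?thesis
    using frontier_Int_subset by (metis finite_UnI finite_subset)
qed

text \<open>A description by the order alone, which makes the boundary of a fibre definable
  uniformly in the base point.\<close>

lemma frontier_real_iff:
  fixes S :: "real set"
  shows "y \<in> frontier S \<longleftrightarrow> (\<forall>s t. s < y \<and> y < t \<longrightarrow>
    (\<exists>w. (s < w \<and> w < t) \<and> w \<in> S) \<and> (\<exists>w. (s < w \<and> w < t) \<and> w \<notin> S))" (is "_ \<longleftrightarrow> ?R")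
proof
  assume y: "y \<in> frontier S"
  show ?R
  proof (intro allI impI)
    fix s t assume st: "s < y \<and> y < t"
    define e where "e = min (y - s) (t - y)"
    have "e > 0" using st by (simp add: e_def)
    then obtain v w where "v \<in> S" "dist y v < e" "w \<notin> S" "dist y w < e"
      using y unfolding frontier_straddle by blast
    moreover have "s < u \<and> u < t" if "dist y u < e" for u
      using that unfolding e_def dist_real_def by linarith
    ultimately show "(\<exists>w. (s < w \<and> w < t) \<and> w \<in> S) \<and> (\<exists>w. (s < w \<and> w < t) \<and> w \<notin> S)" by blast
  qed
next
  assume R: ?R
  show "y \<in> frontier S"
    unfolding frontier_straddle
  proof (intro allI impI)
    fix e :: real assume "e > 0"
    then have "y - e < y \<and> y < y + e" by simp
    with R have "(\<exists>w. (y - e < w \<and> w < y + e) \<and> w \<in> S) \<and> (\<exists>w. (y - e < w \<and> w < y + e) \<and> w \<notin> S)"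
      by blast
    moreover have "dist y w < e" if "y - e < w \<and> w < y + e" for w
      using that unfolding dist_real_def by linarith
    ultimately show "(\<exists>x\<in>S. dist y x < e) \<and> (\<exists>x. x \<notin> S \<and> dist y x < e)" by blast
  qed
qed

lemma all_or_none_of_no_frontier:
  fixes S T :: "real set"
  assumes "connected T" "frontier S \<inter> T = {}" "a \<in> T" "a \<in> S" "b \<in> T"
  shows "b \<in> S"
  using connected_Int_frontier [OF assms(1), of S] assms by blast

lemma connected_ray: "connected {y::real. (L \<longrightarrow> a < y) \<and> (U \<longrightarrow> y < b)}"
proof -
  have "{y::real. (L \<longrightarrow> a < y) \<and> (U \<longrightarrow> y < b)} = (if L then {a<..} else UNIV) \<inter> (if U then {..<b} else UNIV)"
    by auto
  then have "convex {y::real. (L \<longrightarrow> a < y) \<and> (U \<longrightarrow> y < b)}" by (auto intro!: convex_Int convex_real_interval)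
  then show ?thesis by (rule convex_connected)
qed

section \<open>Cutting a definable set into graphs and bands\<close>

context ordered_structure
begin

lemma dset_UNION:
  assumes "finite \<C>" "\<And>C. C \<in> \<C> \<Longrightarrow> dset I C"
  shows "dset I (\<Union>\<C>)"
  using assms
proof (induction \<C> rule: finite_induct)
  case empty
  then show ?case by (simp add: dset_empty)
next
  case (insert C \<C>)
  then have "dset I C" "dset I (\<Union>\<C>)" by auto
  then show ?case unfolding dset_def by (auto intro: Def_disj)
qed

context
  fixes I :: "nat set" and j :: nat
  assumes I: "finite I" and j: "j \<notin> I"
begin

lemma fin_insert: "finite (insert j I)"
  using I by simp

lemma DefV_drop_coord: "DefV M (vec_ctx (insert j I)) I (\<lambda>z. z(j := 0))"
  by (rule DefV_drop [OF DefV_id]) auto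

text \<open>A band over an open piece is open. Over a thin piece it stays thin in the same
  coordinate \<open>i\<close>, which is still determined by the base point.\<close>

lemma piece_band:
  assumes C: "piece I C" and gf: "continuous_on C g" "continuous_on C f"
    and d: "DefF M (vec_ctx I) g" "DefF M (vec_ctx I) f" and less: "L \<Longrightarrow> U \<Longrightarrow> \<forall>x\<in>C. g x < f x"
  shows "piece (insert j I) (band j L U C g f)"
proof -
  have dC: "dset I C" and CR: "C \<subseteq> RR I" and pc: "path_connected C" using C by (auto simp: piece_def dset_def)
  have eq: "band j L U C g f = {z \<in> RR (insert j I). z(j := 0) \<in> C \<and>
      (L \<longrightarrow> g (z(j := 0)) < z j) \<and> (U \<longrightarrow> z j < f (z(j := 0)))}"
    using CR drop_in_RR_iff [OF j] by (auto simp: band_def)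
  have "dset (insert j I) (band j L U C g f)"
    unfolding eq
    by (intro dset_Collect Def_conj Def_imp Def_const Def_less Def_mem [OF I dC] DefF_vec [OF I d(1)]
        DefF_vec [OF I d(2)] DefV_drop_coord DefF_coord)
  moreover have "path_connected (band j L U C g f)"
    by (rule path_connected_band [OF j CR pc gf less])
  moreover have "openin (XX (insert j I)) (band j L U C g f) \<or> thin (insert j I) (band j L U C g f)"
  proof (cases "openin (XX I) C")
    case True
    then show ?thesis using openin_band [OF j True gf] by blast
  next
    case False
    then obtain i \<gamma> where mC: "meager I C" and i: "i \<in> I" "continuous_on ((\<lambda>x. x(i := 0)) ` C) \<gamma>"
      "\<And>x. x \<in> C \<Longrightarrow> x i = \<gamma> (x(i := 0))"
      using C unfolding piece_def thin_def by blast
    have ij: "i \<noteq> j" using i(1) j by blast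
    have "thin (insert j I) (band j L U C g f)"
      unfolding thin_def
    proof (intro conjI bexI exI ballI)
      show "meager (insert j I) (band j L U C g f)"
        by (rule meager_subset [OF meager_cylinder [OF j mC]]) (auto simp: eq)
      show "continuous_on ((\<lambda>z. z(i := 0)) ` band j L U C g f) (\<lambda>w. \<gamma> (w(j := 0)))"
      proof (rule continuous_on_compose2 [OF i(2) continuous_on_drop])
        show "(\<lambda>w. w(j := 0)) ` (\<lambda>z. z(i := 0)) ` band j L U C g f \<subseteq> (\<lambda>x. x(i := 0)) ` C"
        proof (clarsimp simp: band_def)
          fix z assume "z(j := 0) \<in> C"
          then show "z(i := 0, j := 0) \<in> (\<lambda>x. x(i := 0)) ` C"
            using fun_upd_twist [OF ij, of z] by (metis imageI)
        qed
      qed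
      fix z assume "z \<in> band j L U C g f"
      then have "z(j := 0) \<in> C" by (simp add: band_def)
      from i(3) [OF this] show "z i = \<gamma> (z(i := 0, j := 0))"
        using fun_upd_twist [OF ij, of z] ij by simp
    qed (use i(1) in simp)
    then show ?thesis ..
  qed
  ultimately show ?thesis by (simp add: piece_def)
qed

text \<open>The coordinate that can be forgotten is \<open>j\<close> itself. For meagerness, the
  graph is treated directly over an open piece, and otherwise it lies in the cylinder over a meager
  set.\<close>

lemma piece_graph:
  assumes C: "piece I C" and f: "continuous_on C f" "DefF M (vec_ctx I) f"
  shows "piece (insert j I) ((\<lambda>x. x(j := f x)) ` C)"
proof -
  have dC: "dset I C" and CR: "C \<subseteq> RR I" and pc: "path_connected C" using C by (auto simp: piece_def dset_def)
  have xj: "x(j := 0) = x" if "x \<in> C" for x using CR that drop_RR j by blast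
  have eq: "(\<lambda>x. x(j := f x)) ` C = {z \<in> RR (insert j I). z(j := 0) \<in> C \<and> f (z(j := 0)) = z j}" (is "?G = ?R")
  proof
    show "?G \<subseteq> ?R" using CR xj by (auto intro: upd_in_RR)
    show "?R \<subseteq> ?G"
    proof
      fix z assume "z \<in> ?R"
      then have "z(j := 0) \<in> C" "z = (z(j := 0))(j := f (z(j := 0)))" by auto
      then show "z \<in> ?G" by (intro image_eqI)
    qed
  qed
  have "dset (insert j I) ?G"
    unfolding eq
    by (intro dset_Collect Def_conj Def_eq Def_mem [OF I dC] DefF_vec [OF I f(2)] DefV_drop_coord DefF_coord)
  moreover have "path_connected ?G"
    by (intro path_connected_continuous_image continuous_on_upd f(1) pc continuous_on_id)
  moreover have "thin (insert j I) ?G"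
    unfolding thin_def
  proof (intro conjI bexI exI ballI)
    show "meager (insert j I) ?G"
    proof (cases "openin (XX I) C")
      case False
      then have "meager I C" using C by (auto simp: piece_def thin_def)
      from meager_cylinder [OF j this] show ?thesis by (rule meager_subset) (auto simp: eq)
    qed (rule meager_graph [OF j _ f(1)])
    have "(\<lambda>x. x(j := 0)) ` ?G = (\<lambda>x. x) ` C"
      unfolding image_image by (rule image_cong) (use xj in auto)
    then show "continuous_on ((\<lambda>x. x(j := 0)) ` ?G) f" using f(1) by simp
    show "z j = f (z(j := 0))" if "z \<in> ?G" for z using that by (simp add: eq)
  qed simp
  ultimately show ?thesis by (simp add: piece_def)
qed

context
  assumes Cont: "Cont I"
begin

lemma decomposable_Cont: "dset I B \<Longrightarrow> DefF M (vec_ctx I) f \<Longrightarrow> decomposable I (\<lambda>C. continuous_on C f) B"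
  using Cont by (simp add: Cont_def)

lemma decomposable_Cont2:
  assumes B: "dset I B" and f: "DefF M (vec_ctx I) f" and g: "DefF M (vec_ctx I) g"
  shows "decomposable I (\<lambda>C. continuous_on C f \<and> continuous_on C g) B"
proof -
  obtain \<C> where \<C>: "finite \<C>" "\<And>C. C \<in> \<C> \<Longrightarrow> piece I C \<and> continuous_on C f" "B = \<Union>\<C>"
    using decomposable_Cont [OF B f] unfolding decomposable_def by blast
  have "decomposable I (\<lambda>C. continuous_on C f \<and> continuous_on C g) C" if C: "C \<in> \<C>" for C
  proof -
    have "dset I C" using \<C>(2) [OF C] by (simp add: piece_def)
    then obtain \<D> where \<D>: "finite \<D>" "\<And>D. D \<in> \<D> \<Longrightarrow> piece I D \<and> continuous_on D g" "C = \<Union>\<D>"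
      using decomposable_Cont [OF _ g] unfolding decomposable_def by blast
    have "continuous_on D f" if "D \<in> \<D>" for D
      using \<C>(2) [OF C] \<D>(3) that by (metis Union_upper continuous_on_subset)
    then show ?thesis unfolding decomposable_def using \<D> by blast
  qed
  then show ?thesis unfolding \<C>(3) by (rule decomposable_Union [OF \<C>(1)])
qed

lemma decomposable_band:
  assumes B: "dset I B" and g: "DefF M (vec_ctx I) g" and f: "DefF M (vec_ctx I) f"
    and less: "L \<Longrightarrow> U \<Longrightarrow> \<forall>x\<in>B. g x < f x"
  shows "decomposable (insert j I) (\<lambda>_. True) (band j L U B g f)"
proof -
  obtain \<C> where \<C>: "finite \<C>" "\<And>C. C \<in> \<C> \<Longrightarrow> piece I C \<and> continuous_on C g \<and> continuous_on C f" "B = \<Union>\<C>"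
    using decomposable_Cont2 [OF B g f] unfolding decomposable_def by blast
  have "decomposable (insert j I) (\<lambda>_. True) (band j L U C g f)" if C: "C \<in> \<C>" for C
    by (rule decomposable_piece [OF piece_band]) (use \<C>(2) [OF C] g f less C \<C>(3) in auto)
  then have "decomposable (insert j I) (\<lambda>_. True) (\<Union>C\<in>\<C>. band j L U C g f)"
    by (rule decomposable_UN [OF \<C>(1)])
  moreover have "(\<Union>C\<in>\<C>. band j L U C g f) = band j L U B g f"
    by (auto simp: band_def \<C>(3))
  ultimately show ?thesis by simp
qed

lemma decomposable_graph:
  assumes B: "dset I B" and f: "DefF M (vec_ctx I) f"
  shows "decomposable (insert j I) (\<lambda>_. True) ((\<lambda>x. x(j := f x)) ` B)"
proof -
  obtain \<C> where \<C>: "finite \<C>" "\<And>C. C \<in> \<C> \<Longrightarrow> piece I C \<and> continuous_on C f" "B = \<Union>\<C>"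
    using decomposable_Cont [OF B f] unfolding decomposable_def by blast
  have "decomposable (insert j I) (\<lambda>_. True) ((\<lambda>x. x(j := f x)) ` C)" if C: "C \<in> \<C>" for C
    by (rule decomposable_piece [OF piece_graph]) (use \<C>(2) [OF C] f in auto)
  then have "decomposable (insert j I) (\<lambda>_. True) (\<Union>C\<in>\<C>. (\<lambda>x. x(j := f x)) ` C)"
    by (rule decomposable_UN [OF \<C>(1)])
  then show ?thesis unfolding \<C>(3) by (simp add: image_Union)
qed

lemma Def_fib:
  assumes "dset (insert j I) A" "DefV M \<Gamma> I h" "DefF M \<Gamma> v"
  shows "Def M \<Gamma> (\<lambda>c. v c \<in> fib j A (h c))"
  unfolding fib_def mem_Collect_eq
  by (rule Def_mem [OF fin_insert assms(1) DefV_upd [OF assms(2) _ assms(3)]]) auto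

lemma Def_frontier_fib:
  assumes A: "dset (insert j I) A" and h: "DefV M \<Gamma> I h" and v: "DefF M \<Gamma> v"
  shows "Def M \<Gamma> (\<lambda>c. v c \<in> frontier (fib j A (h c)))"
  unfolding frontier_real_iff
  by (intro Def_all Def_imp Def_conj Def_ex Def_not Def_less Def_fib [OF A] DefV_fst h DefF_snd DefF_fst v)

text \<open>
  Induction on the number of boundary points of the fibres lying above \<open>g\<close>: below the least one, \<open>f x\<close>,
  the set is a band or empty, and \<open>f\<close> takes over the role of \<open>g\<close>.
\<close>

lemma decomposable_above:
  assumes "dset I B" "DefF M (vec_ctx I) g" "dset (insert j I) A"
    and "\<And>z. z \<in> A \<Longrightarrow> z(j := 0) \<in> B \<and> (L \<longrightarrow> g (z(j := 0)) < z j)"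
    and "\<And>x. x \<in> B \<Longrightarrow> finite (frontier (fib j A x)) \<and> card (frontier (fib j A x) \<inter> {y. L \<longrightarrow> g x < y}) \<le> K"
  shows "decomposable (insert j I) (\<lambda>_. True) A"
  using assms
proof (induction K arbitrary: L B g A rule: less_induct)
  case (less K)
  note B = less.prems(1) and g = less.prems(2) and A = less.prems(3) and sub = less.prems(4) and fr = less.prems(5)
  have AR: "A \<subseteq> RR (insert j I)" and BR: "B \<subseteq> RR I" using A B by (auto simp: dset_def)
  have memA: "z \<in> A \<longleftrightarrow> z j \<in> fib j A (z(j := 0))" for z by (simp add: fib_def)
  define Fr where "Fr x = frontier (fib j A x) \<inter> {y. L \<longrightarrow> g x < y}" for x
  define B1 where "B1 = {x \<in> RR I. x \<in> B \<and> (\<exists>y. y \<in> Fr x)}"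
  \<comment> \<open>\<open>B1\<close> consists of the base points with a boundary point above
    \<open>g\<close>; elsewhere the value 0 only makes \<open>f\<close> total.\<close>
  define f where "f x = (if x \<in> B1 then Min (Fr x) else 0)" for x
  have Fr: "finite (Fr x)" "card (Fr x) \<le> K" if "x \<in> B" for x
    using fr [OF that] by (auto simp: Fr_def)
  have f: "f x \<in> Fr x" "\<And>y. y \<in> Fr x \<Longrightarrow> f x \<le> y" if "x \<in> B1" for x
  proof -
    have "finite (Fr x)" "Fr x \<noteq> {}" using that Fr [of x] by (auto simp: B1_def)
    then show "f x \<in> Fr x" "\<And>y. y \<in> Fr x \<Longrightarrow> f x \<le> y"
      using that by (simp_all add: f_def)
  qed
  have gf: "L \<longrightarrow> g x < f x" if "x \<in> B1" for x using f(1) [OF that] by (simp add: Fr_def)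
  note defs = Def_conj Def_disj Def_imp Def_ex Def_all Def_not Def_const Def_less Def_eq
    Def_frontier_fib [OF A] Def_fib [OF A] DefV_fst DefV_id DefF_vec [OF I g] DefF_snd DefF_fst
    Def_mem [OF I B] DefF_const
  have dB1: "dset I B1"
    unfolding B1_def Fr_def Int_iff mem_Collect_eq by (intro dset_Collect defs)
  have df: "DefF M (vec_ctx I) f"
  proof -
    have "Def M (vec_ctx I \<otimes>\<^sub>c real_ctx) (\<lambda>c. (fst c \<in> B1 \<and>
        ((snd c \<in> frontier (fib j A (fst c)) \<and> (L \<longrightarrow> g (fst c) < snd c)) \<and>
         (\<forall>y. (y \<in> frontier (fib j A (fst c)) \<and> (L \<longrightarrow> g (fst c) < y)) \<longrightarrow> \<not> y < snd c))) \<or>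
        (fst c \<notin> B1 \<and> 0 = snd c))"
      by (intro defs Def_mem [OF I dB1])
    then show ?thesis
      unfolding DefF_def
    proof (rule Def_eqI)
      fix c :: "(nat \<Rightarrow> real) \<times> real"
      have "f x = y \<longleftrightarrow> (y \<in> Fr x \<and> (\<forall>y'. y' \<in> Fr x \<longrightarrow> \<not> y' < y))" if "x \<in> B1" for x y
        using f [OF that] by (metis linorder_not_less order_antisym)
      then show "f (fst c) = snd c \<longleftrightarrow> ((fst c \<in> B1 \<and>
        ((snd c \<in> frontier (fib j A (fst c)) \<and> (L \<longrightarrow> g (fst c) < snd c)) \<and>
         (\<forall>y. (y \<in> frontier (fib j A (fst c)) \<and> (L \<longrightarrow> g (fst c) < y)) \<longrightarrow> \<not> y < snd c))) \<or>
        (fst c \<notin> B1 \<and> 0 = snd c))"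
        by (cases "fst c \<in> B1") (simp_all add: Fr_def f_def)
    qed
  qed
  \<comment> \<open>Between consecutive boundary points a fibre contains everything or nothing, so
    one point decides. \<open>B0\<close> collects base points whose fibre is the whole ray,
    \<open>B2\<close> those whose fibre contains the stretch below \<open>f\<close>, and
    \<open>B3\<close> those whose fibre contains the value \<open>f x\<close>; \<open>A3\<close> is
    the part of \<open>A\<close> above \<open>f\<close>.\<close>
  define B0 where "B0 = {x \<in> RR I. (x \<in> B \<and> x \<notin> B1) \<and> (\<exists>y. y \<in> fib j A x)}"
  define B2 where "B2 = {x \<in> RR I. x \<in> B1 \<and> (\<exists>y. y \<in> fib j A x \<and> y < f x)}"
  define B3 where "B3 = {x \<in> RR I. x \<in> B1 \<and> f x \<in> fib j A x}"
  define A3 where "A3 = {z \<in> RR (insert j I). z \<in> A \<and> (z(j := 0) \<in> B1 \<and> f (z(j := 0)) < z j)}"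
  have dB: "dset I B0" "dset I B2" "dset I B3"
    unfolding B0_def B2_def B3_def
    by (intro dset_Collect defs Def_mem [OF I dB1] df DefF_vec [OF I df])+
  have dA3: "dset (insert j I) A3"
    unfolding A3_def
    by (intro dset_Collect Def_conj Def_less Def_mem [OF fin_insert A] Def_mem [OF I dB1] DefF_vec [OF I df]
        DefV_id DefV_drop_coord DefF_coord)
  have low: "y \<in> fib j A x \<Longrightarrow> L \<longrightarrow> g x < y" if "x \<in> B" for x y
  proof -
    have x: "x(j := y, j := 0) = x" using that BR drop_RR [OF _ j] by auto
    assume "y \<in> fib j A x"
    then have "x(j := y) \<in> A" by (simp add: fib_def)
    from sub [OF this, unfolded x] show "L \<longrightarrow> g x < y" by simp
  qed
  have A0: "z \<in> A \<longleftrightarrow> z \<in> band j L False B0 g g" if z: "z \<in> RR (insert j I)" "z(j := 0) \<notin> B1" for z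
  proof
    assume "z \<in> A"
    from sub [OF this] this show "z \<in> band j L False B0 g g"
      using z drop_in_RR [OF j z(1)] memA [of z] unfolding band_def B0_def by blast
  next
    assume *: "z \<in> band j L False B0 g g"
    define x where "x = z(j := 0)"
    have x: "x \<in> RR I" "x \<in> B" "x \<notin> B1" "L \<longrightarrow> g x < z j" using * by (auto simp: band_def B0_def x_def)
    obtain y where y: "y \<in> fib j A x" using * by (auto simp: band_def B0_def x_def)
    have "frontier (fib j A x) \<inter> {y. (L \<longrightarrow> g x < y) \<and> (False \<longrightarrow> y < g x)} = {}"
      using x(1-3) by (auto simp: B1_def Fr_def)
    from all_or_none_of_no_frontier [OF connected_ray this, of y "z j"]
    have "z j \<in> fib j A x" using y low [OF x(2) y] x(4) by simp
    then show "z \<in> A" using memA x_def by simp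
  qed
  have A1: "z \<in> A \<longleftrightarrow> z \<in> band j L True B2 g f" if z: "z \<in> RR (insert j I)" "z(j := 0) \<in> B1" "z j < f (z(j := 0))" for z
  proof
    assume "z \<in> A"
    from sub [OF this] this show "z \<in> band j L True B2 g f"
      using z drop_in_RR [OF j z(1)] memA [of z] unfolding band_def B2_def by blast
  next
    assume *: "z \<in> band j L True B2 g f"
    define x where "x = z(j := 0)"
    have x: "x \<in> B" "x \<in> B1" "L \<longrightarrow> g x < z j" using * by (auto simp: band_def B2_def B1_def x_def)
    obtain y where y: "y \<in> fib j A x" "y < f x" using * by (auto simp: band_def B2_def x_def)
    have "frontier (fib j A x) \<inter> {y. (L \<longrightarrow> g x < y) \<and> (True \<longrightarrow> y < f x)} = {}"
      using f(2) [OF x(2)] by (force simp: Fr_def)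
    from all_or_none_of_no_frontier [OF connected_ray this, of y "z j"]
    have "z j \<in> fib j A x" using y low [OF x(1) y(1)] x(3) z(3) by (simp add: x_def)
    then show "z \<in> A" using memA x_def by simp
  qed
  have A2: "z \<in> A \<longleftrightarrow> z \<in> (\<lambda>x. x(j := f x)) ` B3" if z: "z \<in> RR (insert j I)" "z(j := 0) \<in> B1" "z j = f (z(j := 0))" for z
  proof
    assume "z \<in> A"
    then have "z(j := 0) \<in> B3" using z drop_in_RR [OF j z(1)] memA by (simp add: B3_def)
    moreover have "z = (z(j := 0))(j := f (z(j := 0)))" using z(3) by auto
    ultimately show "z \<in> (\<lambda>x. x(j := f x)) ` B3" by (intro image_eqI)
  next
    assume "z \<in> (\<lambda>x. x(j := f x)) ` B3"
    then show "z \<in> A" by (auto simp: B3_def fib_def)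
  qed
  have sub2: "band j L True B2 g f \<subseteq> {z \<in> RR (insert j I). z(j := 0) \<in> B1 \<and> z j < f (z(j := 0))}"
    using drop_in_RR_iff [OF j] by (auto simp: band_def B2_def)
  have sub0: "band j L False B0 g g \<subseteq> {z \<in> RR (insert j I). z(j := 0) \<notin> B1}"
    using drop_in_RR_iff [OF j] by (auto simp: band_def B0_def)
  have sub1: "(\<lambda>x. x(j := f x)) ` B3 \<subseteq> {z \<in> RR (insert j I). z(j := 0) \<in> B1 \<and> z j = f (z(j := 0))}"
    using drop_RR [OF _ j] by (auto simp: B3_def intro: upd_in_RR)
  have "A = band j L False B0 g g \<union> band j L True B2 g f \<union> (\<lambda>x. x(j := f x)) ` B3 \<union> A3" (is "A = ?R")
  proof
    show "A \<subseteq> ?R"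
    proof
      fix z assume z: "z \<in> A"
      then have zR: "z \<in> RR (insert j I)" using AR by blast
      consider "z(j := 0) \<notin> B1" | "z(j := 0) \<in> B1" "z j < f (z(j := 0))" | "z(j := 0) \<in> B1" "z j = f (z(j := 0))"
        | "z(j := 0) \<in> B1" "f (z(j := 0)) < z j" by force
      then show "z \<in> ?R"
      proof cases
        case 1 then show ?thesis using A0 [OF zR 1] z by blast
      next
        case 2 then show ?thesis using A1 [OF zR 2] z by blast
      next
        case 3 then show ?thesis using A2 [OF zR 3] z by blast
      next
        case 4 then show ?thesis using z zR by (simp add: A3_def)
      qed
    qed
    have "A3 \<subseteq> A" by (auto simp: A3_def)
    moreover have "band j L False B0 g g \<subseteq> A" using A0 sub0 by blast
    moreover have "band j L True B2 g f \<subseteq> A" using A1 sub2 by blast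
    moreover have "(\<lambda>x. x(j := f x)) ` B3 \<subseteq> A" using A2 sub1 by blast
    ultimately show "?R \<subseteq> A" by simp
  qed
  moreover have "decomposable (insert j I) (\<lambda>_. True) (band j L False B0 g g)"
    by (rule decomposable_band [OF dB(1) g g]) simp
  moreover have "decomposable (insert j I) (\<lambda>_. True) (band j L True B2 g f)"
    by (rule decomposable_band [OF dB(2) g df]) (use gf in \<open>auto simp: B2_def\<close>)
  moreover have "decomposable (insert j I) (\<lambda>_. True) ((\<lambda>x. x(j := f x)) ` B3)"
    by (rule decomposable_graph [OF dB(3) df])
  moreover have "decomposable (insert j I) (\<lambda>_. True) A3"
  proof (cases "B1 = {}")
    case True
    then have "A3 = {}" by (simp add: A3_def)
    then show ?thesis by (simp add: decomposable_empty)
  next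
    case False
    then obtain x0 where "x0 \<in> B1" by blast
    then have "Fr x0 \<noteq> {}" "x0 \<in> B" by (auto simp: B1_def)
    then have K: "K > 0" using Fr [of x0] by (metis card_gt_0_iff order_less_le_trans)
    have fib3: "fib j A3 x = fib j A x \<inter> {f x<..}" if x: "x \<in> B1" for x
    proof -
      have xR: "x \<in> RR I" using x by (simp add: B1_def)
      show ?thesis using x drop_RR [OF xR j] upd_in_RR [OF xR, of j] by (auto simp: fib_def A3_def)
    qed
    \<comment> \<open>Truncating at \<open>f x\<close> can create only the boundary point
      \<open>f x\<close>, which the strict condition \<open>f x < y\<close> excludes from the count.
      The count drops because \<open>f x\<close> itself was counted before.\<close>
    have "frontier (fib j A3 x) \<subseteq> frontier (fib j A x) \<union> {f x}" if "x \<in> B1" for x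
      unfolding fib3 [OF that] using frontier_Int_subset [of "fib j A x" "{f x<..}"] by simp
    note fr3 = this
    have K3: "finite (frontier (fib j A3 x)) \<and> card (frontier (fib j A3 x) \<inter> {y. True \<longrightarrow> f x < y}) \<le> K - 1"
      if x: "x \<in> B1" for x
    proof
      have xB: "x \<in> B" using x by (simp add: B1_def)
      show "finite (frontier (fib j A3 x))"
        by (rule finite_subset [OF fr3 [OF x]]) (use fr [OF xB] in simp)
      have "frontier (fib j A3 x) \<inter> {y. True \<longrightarrow> f x < y} \<subseteq> Fr x - {f x}"
      proof
        fix y assume "y \<in> frontier (fib j A3 x) \<inter> {y. True \<longrightarrow> f x < y}"
        then have "y \<in> frontier (fib j A x)" "f x < y" using fr3 [OF x] by auto
        moreover have "L \<longrightarrow> g x < y" using gf [OF x] \<open>f x < y\<close> by auto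
        ultimately show "y \<in> Fr x - {f x}" by (simp add: Fr_def)
      qed
      then have "card (frontier (fib j A3 x) \<inter> {y. True \<longrightarrow> f x < y}) \<le> card (Fr x - {f x})"
        using Fr(1) [OF xB] by (intro card_mono) auto
      also have "\<dots> \<le> K - 1" using Fr [OF xB] f(1) [OF x] by simp
      finally show "card (frontier (fib j A3 x) \<inter> {y. True \<longrightarrow> f x < y}) \<le> K - 1" .
    qed
    show ?thesis
    proof (rule less.IH [of "K - 1" B1 f A3 True])
      show "z(j := 0) \<in> B1 \<and> (True \<longrightarrow> f (z(j := 0)) < z j)" if "z \<in> A3" for z
        using that unfolding A3_def by blast
    qed (use K in simp, rule dB1, rule df, rule dA3, rule K3)
  qed
  ultimately show ?case
    using decomposable_Un by metis
qed

lemma Decomp_insert: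
  assumes fr: "\<And>A x. dset (insert j I) A \<Longrightarrow> x \<in> RR I \<Longrightarrow> finite (frontier (fib j A x))" and UF: "UF I"
  shows "Decomp (insert j I)"
  unfolding Decomp_def
proof (intro allI impI)
  fix A assume A: "dset (insert j I) A"
  \<comment> \<open>Its fibres are the boundaries of the fibres of \<open>A\<close>. They are
    finite, so \<open>UF\<close> yields the uniform bound that starts the induction, with all of
    \<open>RR I\<close> as base and no lower bound.\<close>
  define Bd where "Bd = {z \<in> RR (insert j I). z j \<in> frontier (fib j A (z(j := 0)))}"
  have "dset (insert j I) Bd"
    unfolding Bd_def by (intro dset_Collect Def_frontier_fib A DefV_drop_coord DefF_coord)
  moreover have Bd: "fib j Bd x = frontier (fib j A x)" if "x \<in> RR I" for x
    using upd_in_RR [OF that, of j] drop_RR [OF that j] by (auto simp: Bd_def fib_def)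
  ultimately obtain K where K: "\<And>x. x \<in> RR I \<Longrightarrow> card (fib j Bd x) \<le> K"
    using UF j fr [OF A] unfolding UF_def by metis
  show "decomposable (insert j I) (\<lambda>_. True) A"
  proof (rule decomposable_above [of "RR I" "\<lambda>_. 0" A False K])
    show "z(j := 0) \<in> RR I \<and> (False \<longrightarrow> 0 < z j)" if "z \<in> A" for z
      using that dset_subset [OF A] drop_in_RR [OF j] by auto
    show "finite (frontier (fib j A x)) \<and> card (frontier (fib j A x) \<inter> {y. False \<longrightarrow> 0 < y}) \<le> K" if "x \<in> RR I" for x
      using fr [OF A that] K [OF that] Bd [OF that] by simp
  qed (intro dset_RR DefF_const A)+
qed

end

end

end

section \<open>The joint induction and components in o-minimal structures\<close>

locale o_minimal_structure = ordered_structure +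
  assumes o_minimal: "o_minimal M"
begin

lemma finite_frontier_Def:
  assumes "Def M real_ctx (\<lambda>a. a \<in> S)"
  shows "finite (frontier S)"
proof -
  have "definable M 1 {x \<in> topspace (Euclidean_space 1). x 0 \<in> S}"
    using dset_Collect [OF Def_real [OF assms DefF_coord [of M "{..<1}" 0]]]
    unfolding definable_iff_Def topspace_eq_RR dset_def .
  from o_minimal [unfolded o_minimal_def, rule_format, OF this] obtain \<U> where "finite \<U> \<and> (\<forall>U\<in>\<U>. (\<exists>a. U = {a}) \<or> open_interval U) \<and> S = \<Union>\<U>"
    by (rule exE)
  then have \<U>: "finite \<U>" "\<And>U. U \<in> \<U> \<Longrightarrow> (\<exists>a. U = {a}) \<or> open_interval U" "S = \<Union>\<U>"
    by simp_all
  have "finite (frontier U)" if "U \<in> \<U>" for U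
    using \<U>(2) [OF that] finite_frontier_open_interval by (auto simp: frontier_def)
  then have "finite (\<Union>U\<in>\<U>. frontier U)" using \<U>(1) by blast
  then show ?thesis
    unfolding \<U>(3) by (rule finite_subset [OF frontier_Union_subset [OF \<U>(1)]])
qed

lemma finite_frontier_fib:
  assumes "finite I" "dset (insert j I) A" "x \<in> RR I"
  shows "finite (frontier (fib j A x))"
proof (rule finite_frontier_Def)
  have "DefF M real_ctx (\<lambda>a. a)" by (rule DefF_basic [OF basic_real])
  then have "DefV M real_ctx (insert j I) (\<lambda>a. x(j := a))"
    by (intro DefV_upd [OF DefV_const [OF assms(3)]]) auto
  then show "Def M real_ctx (\<lambda>a. a \<in> fib j A x)"
    unfolding fib_def mem_Collect_eq using assms by (intro Def_mem [OF _ assms(2)]) auto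
qed

lemma Decomp_empty: "Decomp {}"
  unfolding Decomp_def
proof (intro allI impI)
  fix A assume A: "dset {} A"
  then consider "A = {}" | "A = RR {}" using dset_subset [OF A] by (auto simp: RR_empty)
  then show "decomposable {} (\<lambda>_. True) A"
  proof cases
    case 2
    have "openin (XX {}) (RR {})" using openin_topspace [of "XX {}"] by (simp del: openin_topspace)
    then show ?thesis using A 2 by (intro decomposable_piece) (auto simp: piece_def RR_empty)
  qed (simp add: decomposable_empty)
qed

text \<open>The three statements feed each other: removing any \<open>j\<close> from
  \<open>I\<close>, \<open>Cont\<close> and \<open>UF\<close> for the rest give
  \<open>Decomp I\<close>; then \<open>Decomp I\<close>, together with \<open>Cont\<close> and
  \<open>UF\<close> for all such smaller sets, gives \<open>Cont I\<close> and
  \<open>UF I\<close>.\<close>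

lemma Decomp_Cont_UF: "finite I \<Longrightarrow> Decomp I \<and> Cont I \<and> UF I"
proof (induction I rule: finite_psubset_induct)
  case (psubset I)
  have IH: "Decomp (I - {i})" "Cont (I - {i})" "UF (I - {i})" if "i \<in> I" for i
    using psubset.IH [of "I - {i}"] that by auto
  have "Decomp I"
  proof (cases "I = {}")
    case False
    then obtain j where j: "j \<in> I" by blast
    define J where "J = I - {j}"
    have "finite J" "j \<notin> J" "I = insert j J" using psubset.hyps j by (auto simp: J_def)
    moreover have "Cont J" "UF J" using IH [OF j] by (auto simp: J_def)
    ultimately show ?thesis
      using Decomp_insert [of J j] finite_frontier_fib [of J j] by blast
  qed (simp add: Decomp_empty)
  then show ?case
    using Cont_step UF_step psubset.hyps IH by blast
qed

text \<open>Each of the three kinds of components is a union of pieces, because pieces are path connected.\<close>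

lemma definable_saturated:
  assumes E: "definable M n E" and CE: "C \<subseteq> E"
    and sat: "\<And>P. path_connectedin (subtopology (Euclidean_space n) E) P \<Longrightarrow> P \<inter> C \<noteq> {} \<Longrightarrow> P \<subseteq> C"
  shows "definable M n C"
proof -
  have dE: "dset {..<n} E" using E by (simp add: definable_iff_Def dset_def)
  have "Decomp {..<n}" using Decomp_Cont_UF [of "{..<n}"] by blast
  from DecompD [OF this dE] obtain \<C> where \<C>: "finite \<C>" "\<forall>P\<in>\<C>. piece {..<n} P" "E = \<Union>\<C>"
    by blast
  have pc: "path_connectedin (subtopology (Euclidean_space n) E) P" if "P \<in> \<C>" for P
  proof -
    have "path_connected P" "P \<subseteq> RR {..<n}" using \<C>(2) that by (auto simp: piece_def dset_def)
    moreover have "P \<subseteq> E" using that \<C>(3) by blast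
    ultimately show ?thesis
      by (simp add: Euclidean_space_eq_XX XX_def path_connectedin_subtopology)
  qed
  have "C = \<Union>{P \<in> \<C>. P \<subseteq> C}"
  proof
    show "C \<subseteq> \<Union>{P \<in> \<C>. P \<subseteq> C}"
    proof
      fix x assume x: "x \<in> C"
      then obtain P where P: "P \<in> \<C>" "x \<in> P" using CE \<C>(3) by blast
      then have "P \<subseteq> C" using sat [OF pc [OF P(1)]] x by blast
      then show "x \<in> \<Union>{P \<in> \<C>. P \<subseteq> C}" using P by blast
    qed
  qed blast
  moreover have "dset {..<n} (\<Union>{P \<in> \<C>. P \<subseteq> C})"
    by (rule dset_UNION) (use \<C> in \<open>auto simp: piece_def\<close>)
  ultimately have "dset {..<n} C" by simp
  then show ?thesis by (simp add: definable_iff_Def dset_def)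
qed

lemma closed_under_components: "PCC M \<and> CC M \<and> QCC M"
proof (intro conjI)
  show "PCC M"
    unfolding PCC_def
  proof (intro allI impI ballI)
    fix n E C assume E: "definable M n E" and C: "C \<in> path_components_of (subtopology (Euclidean_space n) E)"
    show "definable M n C"
    proof (rule definable_saturated [OF E])
      show "C \<subseteq> E" using path_components_of_subset [OF C] by simp
      show "P \<subseteq> C" if "path_connectedin (subtopology (Euclidean_space n) E) P" "P \<inter> C \<noteq> {}" for P
        using path_components_of_maximal [OF C that(1)] that(2) by (auto simp: disjnt_def)
    qed
  qed
  show "CC M"
    unfolding CC_def
  proof (intro allI impI ballI)
    fix n E C assume E: "definable M n E" and C: "C \<in> connected_components_of (subtopology (Euclidean_space n) E)"
    show "definable M n C"
    proof (rule definable_saturated [OF E])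
      show "C \<subseteq> E" using connected_components_of_subset [OF C] by simp
      show "P \<subseteq> C" if "path_connectedin (subtopology (Euclidean_space n) E) P" "P \<inter> C \<noteq> {}" for P
        using connected_components_of_maximal [OF C path_connectedin_imp_connectedin [OF that(1)]] that(2)
        by (auto simp: disjnt_def)
    qed
  qed
  show "QCC M"
    unfolding QCC_def
  proof (intro allI impI ballI)
    fix n E C assume E: "definable M n E" and C: "C \<in> quasi_components_of (subtopology (Euclidean_space n) E)"
    define X where "X = subtopology (Euclidean_space n) E"
    obtain x where x: "C = quasi_component_of_set X x"
      using C unfolding quasi_components_of_def X_def by blast
    show "definable M n C"
    proof (rule definable_saturated [OF E])
      show "C \<subseteq> E" using quasi_components_of_subset [OF C] by simp
      show "P \<subseteq> C" if P: "path_connectedin (subtopology (Euclidean_space n) E) P" "P \<inter> C \<noteq> {}" for P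
      proof
        fix z assume z: "z \<in> P"
        obtain y where y: "y \<in> P" "quasi_component_of X x y" using P(2) x by auto
        \<comment> \<open>A path connected set is connected, and a connected set cannot be split by
          a clopen set, so \<open>P\<close> stays in one quasicomponent.\<close>
        have "connected_component_of X y z"
          using path_connectedin_imp_connectedin [OF P(1)] y(1) z unfolding connected_component_of_def X_def by blast
        then have "quasi_component_of X y z" by (rule connected_imp_quasi_component_of)
        with y(2) have "quasi_component_of X x z" by (rule quasi_component_of_trans)
        then show "z \<in> C" by (simp add: x)
      qed
    qed
  qed
qed

end

section \<open>Expansions of the two base structures\<close>

lemma Def_definable:
  assumes "definable M n E" "DefV M \<Gamma> {..<n} h"
  shows "Def M \<Gamma> (\<lambda>c. h c \<in> E)"
  using assms unfolding definable_iff_Def by (auto intro: Def_vec)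

lemma ordered_structure_expansion:
  assumes "expansion_of M real_order"
  shows "ordered_structure M"
proof
  have d: "definable M 2 (rel_set real_order ())"
    using assms by (auto simp: expansion_of_def real_order_def)
  define h :: "real \<times> real \<Rightarrow> nat \<Rightarrow> real" where "h c = (\<lambda>_. 0)(0 := fst c, 1 := snd c)" for c
  have "DefF M (real_ctx \<otimes>\<^sub>c real_ctx) fst"
    by (rule DefF_fst [OF DefF_basic [OF basic_real]])
  then have "DefV M (real_ctx \<otimes>\<^sub>c real_ctx) {..<2} h"
    unfolding h_def
    by (intro DefV_upd [where J = "{..<2}"] DefV_const DefF_snd) (auto simp: RR_def)
  from Def_definable [OF d this]
  show "Def M (real_ctx \<otimes>\<^sub>c real_ctx) (\<lambda>c. fst c < snd c)"
    by (rule Def_eqI) (auto simp: rel_set_def real_order_def h_def topspace_Euclidean_space)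
qed

locale arithmetic_structure = ordered_structure +
  assumes DefF_add_base: "DefF M (real_ctx \<otimes>\<^sub>c real_ctx) (\<lambda>c. fst c + snd c)"
    and DefF_mult_base: "DefF M (real_ctx \<otimes>\<^sub>c real_ctx) (\<lambda>c. fst c * snd c)"
    and Def_Nats_base: "Def M real_ctx (\<lambda>a. a \<in> \<nat>)"

lemma DefF_real2:
  assumes F: "DefF M (real_ctx \<otimes>\<^sub>c real_ctx) (\<lambda>c. F (fst c) (snd c))" and f: "DefF M \<Gamma> f" "DefF M \<Gamma> g"
  shows "DefF M (\<Gamma> :: 'c ctx) (\<lambda>c. F (f c) (g c))"
proof -
  define \<Theta> where "\<Theta> = \<Gamma> \<otimes>\<^sub>c real_ctx \<otimes>\<^sub>c real_ctx \<otimes>\<^sub>c real_ctx"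
  have b: "basic \<Theta> (\<lambda>c. snd (fst c))" "basic \<Theta> snd" "basic \<Theta> (\<lambda>c. snd (fst (fst c)))"
    unfolding \<Theta>_def using basic_fst [OF basic_snd_fst_real] by (auto intro: basic_snd_fst_real basic_snd_real)
  define h where "h c = ((snd (fst c), snd c), snd (fst (fst c)))" for c :: "(('c \<times> real) \<times> real) \<times> real"
  have "Def M \<Theta> (\<lambda>c. F (fst (fst (h c))) (snd (fst (h c))) = snd (h c))"
  proof (rule Def_subst [OF F [unfolded DefF_def]])
    fix v assume "v \<in> coords (real_ctx \<otimes>\<^sub>c real_ctx \<otimes>\<^sub>c real_ctx)"
    then have "basic \<Theta> (\<lambda>c. v (h c))" using b by (auto simp: prod_ctx_def real_ctx_def h_def)
    then show "\<exists>w. basic \<Theta> w \<and> (\<forall>c\<in>cdom \<Theta>. v (h c) = w c)" by blast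
  qed simp
  then have "Def M \<Theta> (\<lambda>c. F (snd (fst c)) (snd c) = snd (fst (fst c)))"
    by (simp add: h_def)
  then have "Def M (\<Gamma> \<otimes>\<^sub>c real_ctx \<otimes>\<^sub>c real_ctx) (\<lambda>c. F (snd c) (g (fst (fst c))) = snd (fst c))"
    unfolding \<Theta>_def by (rule Def_comp [where P = "\<lambda>c b. F (snd c) b = snd (fst c)"]) (intro DefF_fst f)
  then have "Def M (\<Gamma> \<otimes>\<^sub>c real_ctx) (\<lambda>c. F (f (fst c)) (g (fst c)) = snd c)"
    by (rule Def_comp [where P = "\<lambda>c a. F a (g (fst c)) = snd c"]) (intro DefF_fst f)
  then show ?thesis by (simp add: DefF_def)
qed

lemma arithmetic_structure_expansion:
  assumes "expansion_of M real_field_nat"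
  shows "arithmetic_structure M"
proof -
  have d: "definable M 3 (fun_graph real_field_nat Plus)" "definable M 3 (fun_graph real_field_nat Times)"
    "definable M 1 (rel_set real_field_nat ())"
    using assms by (auto simp: expansion_of_def real_field_nat_def numeral_3_eq_3 numeral_2_eq_2)
  define h :: "(real \<times> real) \<times> real \<Rightarrow> nat \<Rightarrow> real"
    where "h c = (\<lambda>_. 0)(0 := fst (fst c), 1 := snd (fst c), 2 := snd c)" for c
  have id: "DefF M real_ctx (\<lambda>a. a)" by (rule DefF_basic [OF basic_real])
  have "DefF M (real_ctx \<otimes>\<^sub>c real_ctx) fst" by (rule DefF_fst [OF id])
  then have v: "DefV M (real_ctx \<otimes>\<^sub>c real_ctx \<otimes>\<^sub>c real_ctx) {..<3} h"
    unfolding h_def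
    by (intro DefV_upd [where J = "{..<3}"] DefV_const DefF_snd DefF_fst id) (auto simp: RR_def)
  have fg: "h c \<in> fun_graph real_field_nat Plus \<longleftrightarrow> fst (fst c) + snd (fst c) = snd c"
    "h c \<in> fun_graph real_field_nat Times \<longleftrightarrow> fst (fst c) * snd (fst c) = snd c" for c
    by (auto simp: fun_graph_def real_field_nat_def h_def topspace_Euclidean_space)
  have plus: "DefF M (real_ctx \<otimes>\<^sub>c real_ctx) (\<lambda>c. fst c + snd c)"
    unfolding DefF_def by (rule Def_eqI [OF Def_definable [OF d(1) v]]) (simp only: fg)
  have times: "DefF M (real_ctx \<otimes>\<^sub>c real_ctx) (\<lambda>c. fst c * snd c)"
    unfolding DefF_def by (rule Def_eqI [OF Def_definable [OF d(2) v]]) (simp only: fg)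
  have "DefV M real_ctx {..<1} (\<lambda>a. (\<lambda>_. 0)(0 := a))"
    by (intro DefV_upd [where J = "{..<1}"] DefV_const id) (auto simp: RR_def)
  from Def_definable [OF d(3) this] have nat: "Def M real_ctx (\<lambda>a. a \<in> \<nat>)"
    by (rule Def_eqI) (auto simp: rel_set_def real_field_nat_def topspace_Euclidean_space)
  \<comment> \<open>The order comes from the field operations: one real is below another iff their
    difference is a nonzero square.\<close>
  have "Def M (real_ctx \<otimes>\<^sub>c real_ctx) (\<lambda>c. \<exists>a. a \<noteq> 0 \<and> fst c + a * a = snd c)"
  proof (intro Def_ex Def_conj Def_not Def_eq DefF_const DefF_snd)
    have 1: "DefF M (real_ctx \<otimes>\<^sub>c real_ctx \<otimes>\<^sub>c real_ctx) (\<lambda>c. fst (fst c))"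
      by (rule DefF_fst [OF DefF_fst [OF id]])
    show "DefF M (real_ctx \<otimes>\<^sub>c real_ctx \<otimes>\<^sub>c real_ctx) (\<lambda>c. fst (fst c) + snd c * snd c)"
      by (rule DefF_real2 [OF plus 1 DefF_real2 [OF times DefF_snd DefF_snd]])
    show "DefF M (real_ctx \<otimes>\<^sub>c real_ctx \<otimes>\<^sub>c real_ctx) (\<lambda>c. snd (fst c))"
      by (rule DefF_fst [OF DefF_snd])
  qed
  then have "Def M (real_ctx \<otimes>\<^sub>c real_ctx) (\<lambda>c. fst c < snd c)"
  proof (rule Def_eqI)
    fix c :: "real \<times> real"
    show "fst c < snd c \<longleftrightarrow> (\<exists>a. a \<noteq> 0 \<and> fst c + a * a = snd c)"
    proof
      assume "fst c < snd c"
      then show "\<exists>a. a \<noteq> 0 \<and> fst c + a * a = snd c"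
        by (intro exI [of _ "sqrt (snd c - fst c)"]) auto
    next
      assume "\<exists>a. a \<noteq> 0 \<and> fst c + a * a = snd c"
      then show "fst c < snd c" by (metis less_add_same_cancel1 not_real_square_gt_zero)
    qed
  qed
  then show ?thesis
    using plus times nat by unfold_locales
qed

section \<open>Coding open sets by real numbers\<close>

text \<open>
  A first-order definable sequence of at least exponential growth: as in Goedel's \<open>\<beta>\<close> function the numbers
  \<open>1 + j * cL k\<close> with \<open>1 \<le> j \<le> k\<close> are pairwise coprime, so their least common multiple is their product.
\<close>

definition cL :: "nat \<Rightarrow> nat" where
  "cL k = Lcm {1..k + 8}"

definition cD :: "nat \<Rightarrow> nat" where
  "cD k = Lcm ((\<lambda>j. 1 + j * cL k) ` {1..k})"

lemma cL_pos: "cL k > 0"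
  unfolding cL_def by (intro Nat.gr0I) (auto simp: Lcm_0_iff)

lemma dvd_cL: "1 \<le> j \<Longrightarrow> j \<le> k + 8 \<Longrightarrow> j dvd cL k"
  unfolding cL_def by (rule dvd_Lcm) auto

lemma cL_mono: "cL k \<le> cL (Suc k)"
proof (rule dvd_imp_le [OF _ cL_pos])
  show "cL k dvd cL (Suc k)" unfolding cL_def [of k] by (rule Lcm_least) (auto intro: dvd_cL)
qed

lemma cL_ge: "cL k \<ge> 8"
  by (rule dvd_imp_le [OF _ cL_pos]) (auto intro: dvd_cL)

text \<open>A common divisor divides \<open>j - i\<close>, which is at most \<open>k\<close> and so
  divides \<open>cL k\<close>. Then it divides both \<open>i * cL k\<close> and
  \<open>1 + i * cL k\<close>.\<close>

lemma coprime_beta: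
  assumes "i < j" "j \<le> k" "i \<ge> 1"
  shows "coprime (1 + i * cL k) (1 + j * cL k)"
proof (rule coprimeI)
  fix d assume d: "d dvd 1 + i * cL k" "d dvd 1 + j * cL k"
  have "j * (1 + i * cL k) = i * (1 + j * cL k) + (j - i)"
    using assms(1) by (simp add: algebra_simps)
  moreover have "d dvd j * (1 + i * cL k)" "d dvd i * (1 + j * cL k)" by (rule dvd_mult [OF d(1)], rule dvd_mult [OF d(2)])
  ultimately have "d dvd j - i" by (metis dvd_add_right_iff)
  moreover have "j - i dvd cL k" using assms by (intro dvd_cL) auto
  ultimately have "d dvd i * cL k" by (meson dvd_mult dvd_trans)
  then show "d dvd 1" using d(1) by (metis add.commute dvd_add_right_iff)
qed

text \<open>The least common multiple is what formulas can describe; the product is what shows the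
  growth.\<close>

lemma cD_prod: "cD k = (\<Prod>j\<in>{1..k}. 1 + j * cL k)"
proof (cases "k = 0")
  case False
  have inj: "inj_on (\<lambda>j. 1 + j * cL k) {1..k}" using cL_pos [of k] by (auto simp: inj_on_def)
  have "cD k = normalize (\<Prod>((\<lambda>j. 1 + j * cL k) ` {1..k}))"
    unfolding cD_def
  proof (rule Lcm_coprime)
    fix a b assume a: "a \<in> (\<lambda>j. 1 + j * cL k) ` {1..k}" and b: "b \<in> (\<lambda>j. 1 + j * cL k) ` {1..k}" and "a \<noteq> b"
    obtain i where i: "a = 1 + i * cL k" "i \<in> {1..k}" using a by blast
    obtain j where j: "b = 1 + j * cL k" "j \<in> {1..k}" using b by blast
    have ij: "a = 1 + i * cL k" "b = 1 + j * cL k" "i \<in> {1..k}" "j \<in> {1..k}" "i \<noteq> j"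
      using i j \<open>a \<noteq> b\<close> by auto
    then consider "i < j" | "j < i" by linarith
    then show "coprime a b"
      using ij coprime_beta [of i j k] coprime_beta [of j i k]
      by cases (auto simp: coprime_commute simp del: add_Suc_right)
  qed (use False in auto)
  then show ?thesis using prod.reindex [OF inj, of "\<lambda>x. x"] by (simp add: comp_def)
qed (simp add: cD_def)

lemma cD_pos: "cD k > 0"
  unfolding cD_prod by (rule prod_pos) simp

text \<open>Passing to \<open>Suc k\<close> adds a factor greater than 8 and enlarges the old ones.
  The summand 8 in the range of \<open>cL\<close> is there to make this true from the start.\<close>

lemma cD_lacunary: "8 * cD k \<le> cD (Suc k)"
proof -
  have "cD k * 8 \<le> (\<Prod>j\<in>{1..k}. 1 + j * cL (Suc k)) * (1 + Suc k * cL (Suc k))"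
    unfolding cD_prod
  proof (rule mult_le_mono)
    show "(\<Prod>j = 1..k. 1 + j * cL k) \<le> (\<Prod>j = 1..k. 1 + j * cL (Suc k))"
      by (intro prod_mono) (use cL_mono [of k] in simp)
    show "8 \<le> 1 + Suc k * cL (Suc k)" using cL_ge [of "Suc k"] by simp
  qed
  also have "\<dots> = cD (Suc k)"
    unfolding cD_prod by simp
  finally show ?thesis by simp
qed

text \<open>The first-order form: the least positive common multiple. Positivity excludes 0, which
  is a multiple of everything.\<close>

lemma Lcm_nat_unique:
  assumes "finite S" "0 \<notin> S"
  shows "m = Lcm S \<longleftrightarrow> 0 < m \<and> (\<forall>s\<in>S. s dvd m) \<and> (\<forall>m'. 0 < m' \<and> (\<forall>s\<in>S. s dvd m') \<longrightarrow> m \<le> (m'::nat))"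
proof -
  have pos: "0 < Lcm S" using assms by (intro Nat.gr0I) (auto simp: Lcm_0_iff)
  show ?thesis
  proof
    assume "m = Lcm S"
    then show "0 < m \<and> (\<forall>s\<in>S. s dvd m) \<and> (\<forall>m'. 0 < m' \<and> (\<forall>s\<in>S. s dvd m') \<longrightarrow> m \<le> m')"
      using pos by (auto intro!: dvd_imp_le Lcm_least)
  next
    assume m: "0 < m \<and> (\<forall>s\<in>S. s dvd m) \<and> (\<forall>m'. 0 < m' \<and> (\<forall>s\<in>S. s dvd m') \<longrightarrow> m \<le> m')"
    then have "m \<le> Lcm S" using pos by auto
    moreover have "Lcm S \<le> m" using m by (intro dvd_imp_le Lcm_least) auto
    ultimately show "m = Lcm S" by simp
  qed
qed

text \<open>\<open>D\<close> grows so fast that a nested interval argument prescribes independently for all \<open>k\<close> in which half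
  of the unit interval the fractional part of \<open>c * D k\<close> lies.\<close>

lemma lacunary_code:
  fixes D :: "nat \<Rightarrow> nat" and S :: "nat set"
  assumes pos: "\<And>k. D k > 0" and lac: "\<And>k. 8 * D k \<le> D (Suc k)"
  obtains c :: real where "\<And>k. (\<exists>m::nat. real m \<le> c * D k \<and> 4 * (c * D k) \<le> 4 * real m + 1) \<longleftrightarrow> k \<in> S"
proof -
  \<comment> \<open>The fractional part of \<open>c * D k\<close> is steered into the interval from
    0 to 1/4 for members of \<open>S\<close> and from 1/2 to 3/4 for the others; the gaps make the
    test decisive.\<close>
  define \<theta> :: "nat \<Rightarrow> real" where "\<theta> k = (if k \<in> S then 0 else 1/2)" for k
  \<comment> \<open>Rounding up chooses the first integer that puts the next interval to the right
    of the left endpoint \<open>a k\<close>.\<close>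
  define m where "m = rec_nat (0::nat) (\<lambda>k m. nat \<lceil>D (Suc k) * ((real m + \<theta> k) / D k)\<rceil>)"
  define a b where "a k = (real (m k) + \<theta> k) / D k" and "b k = a k + 1 / (4 * D k)" for k
  have a0: "a k \<ge> 0" for k by (simp add: a_def \<theta>_def)
  have mS: "m (Suc k) = nat \<lceil>D (Suc k) * a k\<rceil>" for k by (simp add: m_def a_def)
  have m1: "D (Suc k) * a k \<le> m (Suc k)" "m (Suc k) \<le> D (Suc k) * a k + 1" for k
  proof -
    have "0 \<le> D (Suc k) * a k" using a0 by simp
    then show "D (Suc k) * a k \<le> m (Suc k)" "m (Suc k) \<le> D (Suc k) * a k + 1"
      unfolding mS by linarith+
  qed
  have Da: "D k * a k = m k + \<theta> k" for k using pos [of k] by (simp add: a_def)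
  have Db: "D k * b k = m k + \<theta> k + 1/4" for k using pos [of k] Da [of k] by (simp add: b_def distrib_left)
  have th: "0 \<le> \<theta> k" "\<theta> k \<le> 1/2" for k by (simp_all add: \<theta>_def)
  have aS: "a k \<le> a (Suc k)" for k
  proof -
    have "D (Suc k) * a k \<le> D (Suc k) * a (Suc k)"
      unfolding Da [of "Suc k"] using m1(1) [of k] th(1) [of "Suc k"] by linarith
    then show ?thesis using pos [of "Suc k"] by simp
  qed
  have bS: "b (Suc k) \<le> b k" for k
  proof -
    \<comment> \<open>Scaled by \<open>D (Suc k)\<close>, the old interval has length at least 8/4 =
      2. The new one takes at most 1 for rounding, 1/2 for \<open>\<theta>\<close> and 1/4 for its
      length.\<close>
    have "2 \<le> D (Suc k) * (1 / (4 * D k))"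
      using lac [of k] pos [of k] by (simp add: field_simps)
    then have "D (Suc k) * b (Suc k) \<le> D (Suc k) * b k"
      unfolding Db [of "Suc k"] b_def [of k] distrib_left using m1(2) [of k] th(2) [of "Suc k"] by linarith
    then show ?thesis using pos [of "Suc k"] by simp
  qed
  have ab: "a i \<le> b k" for i k
  proof -
    have "a i \<le> a (max i k)" using lift_Suc_mono_le [of a, OF aS] by simp
    also have "\<dots> \<le> b (max i k)" by (simp add: b_def)
    also have "\<dots> \<le> b k" using lift_Suc_antimono_le [of b, OF bS] by simp
    finally show ?thesis .
  qed
  define c where "c = (SUP i. a i)"
  have ac: "a k \<le> c" for k
    unfolding c_def by (rule cSUP_upper) (use ab in \<open>auto intro!: bdd_aboveI [of _ "b 0"]\<close>)
  have cb: "c \<le> b k" for k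
    unfolding c_def by (rule cSUP_least) (use ab in auto)
  have c: "m k + \<theta> k \<le> c * D k" "c * D k \<le> m k + \<theta> k + 1/4" for k
    using mult_left_mono [OF ac, of "D k" k] mult_left_mono [OF cb, of "D k" k]
    by (simp_all add: Da Db mult.commute [of c])
  show ?thesis
  proof (rule that [of c])
    fix k
    show "(\<exists>m::nat. real m \<le> c * D k \<and> 4 * (c * D k) \<le> 4 * real m + 1) \<longleftrightarrow> k \<in> S"
    proof
      assume "k \<in> S"
      then show "\<exists>m::nat. real m \<le> c * D k \<and> 4 * (c * D k) \<le> 4 * real m + 1"
        using c [of k] by (intro exI [of _ "m k"]) (auto simp: \<theta>_def)
    next
      assume "\<exists>m::nat. real m \<le> c * D k \<and> 4 * (c * D k) \<le> 4 * real m + 1"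
      then obtain m' :: nat where m': "real m' \<le> c * D k" "4 * (c * D k) \<le> 4 * real m' + 1" by blast
      show "k \<in> S"
      proof (rule ccontr)
        assume "k \<notin> S"
        then have "\<theta> k = 1/2" by (simp add: \<theta>_def)
        then have "real (m k) < real m'" "real m' < real (Suc (m k))" using c [of k] m' by simp_all
        then show False unfolding of_nat_less_iff by linarith
      qed
    qed
  qed
qed

section \<open>First-order formulas for the coding of sets of naturals\<close>

text \<open>A pairing given by a polynomial, hence by a term in \<open>+\<close> and
  \<open>*\<close>. It is injective because the value lies between the squares of
  \<open>a + b\<close> and of \<open>a + b + 1\<close>, the latter excluded.\<close>

definition npair :: "nat \<Rightarrow> nat \<Rightarrow> nat" where
  "npair a b = (a + b) * (a + b) + a"

lemma npair_inject: "npair a b = npair a' b' \<longleftrightarrow> a = a' \<and> b = b'"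
proof
  assume eq: "npair a b = npair a' b'"
  have less: "npair a b < npair a' b'" if "a + b < a' + b'" for a b a' b'
  proof -
    have "Suc (a + b) * Suc (a + b) \<le> (a' + b') * (a' + b')"
      using that by (intro mult_le_mono) auto
    then show ?thesis by (simp add: npair_def)
  qed
  have "a + b = a' + b'"
    using less [of a b a' b'] less [of a' b' a b] eq by linarith
  then show "a = a' \<and> b = b'" using eq by (simp add: npair_def)
qed simp

definition rdvd :: "real \<Rightarrow> real \<Rightarrow> bool" where
  "rdvd a b \<longleftrightarrow> (\<exists>q. q \<in> \<nat> \<and> b = q * a)"

lemma rdvd_nat: "rdvd (real a) (real b) \<longleftrightarrow> a dvd b"
proof
  assume "rdvd (real a) (real b)"
  then obtain q :: nat where "real b = real q * real a" unfolding rdvd_def by (auto elim!: Nats_cases)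
  then have "b = q * a" by (simp flip: of_nat_mult)
  then show "a dvd b" by simp
next
  assume "a dvd b"
  then obtain q where "b = q * a" by (metis dvd_def mult.commute)
  then show "rdvd (real a) (real b)" unfolding rdvd_def by (intro exI [of _ "real q"]) auto
qed

text \<open>With the definitions that follow, this writes the graphs of \<open>cL\<close> and
  \<open>cD\<close> as formulas over the reals: quantifiers are restricted to the naturals, and
  least common multiples become minimal positive ones.\<close>

definition multL :: "real \<Rightarrow> real \<Rightarrow> bool" where
  "multL k l \<longleftrightarrow> (\<forall>j. j \<in> \<nat> \<and> (1 \<le> j \<and> j \<le> k + 8) \<longrightarrow> rdvd j l)"

definition gL :: "real \<Rightarrow> real \<Rightarrow> bool" where
  "gL k l \<longleftrightarrow> (l \<in> \<nat> \<and> 0 < l \<and> multL k l) \<and> (\<forall>l'. l' \<in> \<nat> \<and> (0 < l' \<and> multL k l') \<longrightarrow> l \<le> l')"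

definition multD :: "real \<Rightarrow> real \<Rightarrow> real \<Rightarrow> bool" where
  "multD k l d \<longleftrightarrow> (\<forall>j. j \<in> \<nat> \<and> (1 \<le> j \<and> j \<le> k) \<longrightarrow> rdvd (1 + j * l) d)"

definition gD :: "real \<Rightarrow> real \<Rightarrow> bool" where
  "gD k d \<longleftrightarrow> (\<exists>l. gL k l \<and> (d \<in> \<nat> \<and> 0 < d \<and> multD k l d) \<and>
     (\<forall>d'. d' \<in> \<nat> \<and> (0 < d' \<and> multD k l d') \<longrightarrow> d \<le> d'))"

lemma ball_Nats: "(\<forall>x. x \<in> \<nat> \<and> P x \<longrightarrow> Q x) \<longleftrightarrow> (\<forall>n::nat. P (of_nat n) \<longrightarrow> Q (of_nat n))"
  by (metis Nats_cases of_nat_in_Nats)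

lemma bex_Nats: "(\<exists>x. x \<in> \<nat> \<and> P x) \<longleftrightarrow> (\<exists>n::nat. P (of_nat n))"
  by (metis Nats_cases of_nat_in_Nats)

lemma multL_nat: "multL (real k) (real m) \<longleftrightarrow> (\<forall>s\<in>{1..k + 8}. s dvd m)"
proof -
  have "(1 \<le> real j \<and> real j \<le> real k + 8) \<longleftrightarrow> j \<in> {1..k + 8}" for j by auto
  then show ?thesis unfolding multL_def ball_Nats by (simp only: rdvd_nat Ball_def)
qed

lemma multD_nat: "multD (real k) (real l) (real m) \<longleftrightarrow> (\<forall>s\<in>(\<lambda>j. 1 + j * l) ` {1..k}. s dvd m)"
proof -
  have "(1 \<le> real j \<and> real j \<le> real k) \<longleftrightarrow> j \<in> {1..k}" for j by auto
  moreover have "rdvd (1 + real j * real l) (real m) \<longleftrightarrow> 1 + j * l dvd m" for j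
    by (subst rdvd_nat [symmetric]) simp
  ultimately show ?thesis unfolding multD_def ball_Nats by (simp only: Ball_def [of "{1..k}"] ball_simps)
qed

lemma gL_nat: "gL (real k) l \<longleftrightarrow> l = real (cL k)"
proof -
  have "gL (real k) (real m) \<longleftrightarrow> m = cL k" for m
    unfolding gL_def cL_def ball_Nats multL_nat by (subst Lcm_nat_unique) auto
  moreover have "gL (real k) l \<Longrightarrow> l \<in> \<nat>" by (simp add: gL_def)
  ultimately show ?thesis by (metis Nats_cases)
qed

lemma gD_nat: "gD (real k) d \<longleftrightarrow> d = real (cD k)"
proof -
  have "gD (real k) (real m) \<longleftrightarrow> (real m \<in> \<nat> \<and> 0 < real m \<and> multD (real k) (real (cL k)) (real m)) \<and>
     (\<forall>d'. d' \<in> \<nat> \<and> (0 < d' \<and> multD (real k) (real (cL k)) d') \<longrightarrow> real m \<le> d')" for m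
    unfolding gD_def gL_nat by blast
  then have "gD (real k) (real m) \<longleftrightarrow> m = cD k" for m
    unfolding cD_def ball_Nats multD_nat by (subst Lcm_nat_unique) auto
  moreover have "gD (real k) d \<Longrightarrow> d \<in> \<nat>" by (auto simp add: gD_def)
  ultimately show ?thesis by (metis Nats_cases)
qed

text \<open>The real \<open>c\<close> represents the set of those \<open>k\<close> for which
  \<open>c\<close> times the \<open>k\<close>-th term of the sequence exceeds some natural number by
  at most 1/4.\<close>

definition codes :: "real \<Rightarrow> real \<Rightarrow> bool" where
  "codes c k \<longleftrightarrow> k \<in> \<nat> \<and> (\<exists>d. gD k d \<and> (\<exists>m. m \<in> \<nat> \<and> m \<le> c * d \<and> 4 * (c * d) \<le> 4 * m + 1))"

lemma codes_universal: "\<exists>c. \<forall>k. codes c (real k) \<longleftrightarrow> k \<in> S"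
proof -
  obtain c :: real where c: "\<And>k. (\<exists>m::nat. real m \<le> c * cD k \<and> 4 * (c * cD k) \<le> 4 * real m + 1) \<longleftrightarrow> k \<in> S"
    using lacunary_code [of cD S, OF cD_pos cD_lacunary] by blast
  have "codes c (real k) \<longleftrightarrow> (\<exists>m::nat. real m \<le> c * cD k \<and> 4 * (c * cD k) \<le> 4 * real m + 1)" for k
    unfolding codes_def gD_nat bex_Nats by simp
  then show ?thesis using c by blast
qed

definition rpair :: "real \<Rightarrow> real \<Rightarrow> real" where
  "rpair a b = (a + b) * (a + b) + a"

lemma rpair_nat: "rpair (real a) (real b) = real (npair a b)"
  by (simp add: rpair_def npair_def)

section \<open>Definability of arbitrary sets of naturals and sequences of rationals\<close>

context arithmetic_structure
begin

lemma DefF_add: "DefF M \<Gamma> f \<Longrightarrow> DefF M \<Gamma> g \<Longrightarrow> DefF M \<Gamma> (\<lambda>c. f c + g c)"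
  by (rule DefF_real2 [OF DefF_add_base])

lemma DefF_mult: "DefF M \<Gamma> f \<Longrightarrow> DefF M \<Gamma> g \<Longrightarrow> DefF M \<Gamma> (\<lambda>c. f c * g c)"
  by (rule DefF_real2 [OF DefF_mult_base])

lemma Def_Nats: "DefF M \<Gamma> f \<Longrightarrow> Def M \<Gamma> (\<lambda>c. f c \<in> \<nat>)"
  by (rule Def_real [OF Def_Nats_base])

lemma Def_le:
  assumes "DefF M \<Gamma> f" "DefF M \<Gamma> g"
  shows "Def M \<Gamma> (\<lambda>c. f c \<le> g c)"
  by (rule Def_eqI [OF Def_not [OF Def_less [OF assms(2,1)]]]) auto

lemmas arith_intros = Def_conj Def_disj Def_imp Def_not Def_ex Def_all Def_eq Def_le Def_less Def_Nats
  DefF_add DefF_mult DefF_const DefF_snd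

lemma Def_rdvd: "DefF M \<Gamma> f \<Longrightarrow> DefF M \<Gamma> g \<Longrightarrow> Def M \<Gamma> (\<lambda>c. rdvd (f c) (g c))"
  unfolding rdvd_def by (intro arith_intros DefF_fst)

lemma Def_codes: "DefF M \<Gamma> f \<Longrightarrow> DefF M \<Gamma> g \<Longrightarrow> Def M \<Gamma> (\<lambda>c. codes (f c) (g c))"
  unfolding codes_def gD_def gL_def multD_def multL_def by (intro arith_intros DefF_fst Def_rdvd)

text \<open>The set \<open>S\<close> is arbitrary, without any computability: its code serves as a
  parameter.\<close>

lemma Def_nat_set:
  assumes "DefF M \<Gamma> f"
  shows "Def M \<Gamma> (\<lambda>c. f c \<in> real ` S)"
proof -
  obtain c0 where c0: "\<And>k. codes c0 (real k) \<longleftrightarrow> k \<in> S" using codes_universal by blast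
  have "Def M \<Gamma> (\<lambda>c. codes c0 (f c))" by (intro Def_codes assms DefF_const)
  moreover have "codes c0 x \<longleftrightarrow> x \<in> real ` S" for x
  proof -
    have "codes c0 x \<Longrightarrow> x \<in> \<nat>" by (simp add: codes_def)
    then show ?thesis using c0 by (auto elim!: Nats_cases)
  qed
  ultimately show ?thesis by simp
qed

lemma DefF_rpair: "DefF M \<Gamma> f \<Longrightarrow> DefF M \<Gamma> g \<Longrightarrow> DefF M \<Gamma> (\<lambda>c. rpair (f c) (g c))"
  unfolding rpair_def by (intro arith_intros)

lemma Def_rat_seq:
  fixes s :: "nat \<Rightarrow> rat"
  assumes "DefF M \<Gamma> f" "DefF M \<Gamma> g"
  shows "Def M \<Gamma> (\<lambda>c. \<exists>k. f c = real k \<and> g c = of_rat (s k))"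
proof -
  \<comment> \<open>The rational \<open>s k\<close> is written as \<open>(p - q) / r\<close> with
    naturals \<open>p\<close>, \<open>q\<close>, \<open>r\<close>, and the equation is cleared of
    subtraction and division. All representations are included, so no fraction has to be
    reduced.\<close>
  define T where "T = {npair k (npair p (npair q r)) | k p q r. of_rat (s k) * real r + real q = real p \<and> r \<noteq> 0}"
  have T: "rpair (real k) (rpair (real p) (rpair (real q) (real r))) \<in> real ` T \<longleftrightarrow>
      of_rat (s k) * real r + real q = real p \<and> r \<noteq> 0" for k p q r
    unfolding rpair_nat T_def by (auto simp: npair_inject)
  have "Def M \<Gamma> (\<lambda>c. f c \<in> \<nat> \<and> (\<exists>p q r. (p \<in> \<nat> \<and> q \<in> \<nat> \<and> r \<in> \<nat>) \<and>
      (g c * r + q = p \<and> rpair (f c) (rpair p (rpair q r)) \<in> real ` T)))"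
    by (intro arith_intros Def_nat_set DefF_rpair DefF_fst assms)
  then show ?thesis
  proof (rule Def_eqI)
    fix c
    show "(\<exists>k. f c = real k \<and> g c = of_rat (s k)) \<longleftrightarrow> (f c \<in> \<nat> \<and> (\<exists>p q r. (p \<in> \<nat> \<and> q \<in> \<nat> \<and> r \<in> \<nat>) \<and>
      (g c * r + q = p \<and> rpair (f c) (rpair p (rpair q r)) \<in> real ` T)))" (is "?L \<longleftrightarrow> ?R")
    proof
      assume ?L
      then obtain k where k: "f c = real k" "g c = of_rat (s k)" by blast
      obtain a b where ab: "s k = rat_of_int a / rat_of_int b" "b > 0"
        using quotient_of_div [of "s k"] quotient_of_denom_pos [of "s k"] by (metis surj_pair)
      define p q r where "p = nat a" and "q = nat (- a)" and "r = nat b"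
      have a: "real_of_int a = real p - real q" and b: "real_of_int b = real r" "r \<noteq> 0"
        using ab(2) by (auto simp: p_def q_def r_def)
      have eq: "of_rat (s k) * real r + real q = real p"
        using b unfolding ab(1) by (simp add: of_rat_divide a)
      then show ?R
        using T [of k p q r] b(2) k
        by (intro conjI exI [of _ "real p"] exI [of _ "real q"] exI [of _ "real r"]) auto
    next
      assume ?R
      then obtain k p q r :: nat where *: "f c = real k" "g c * real r + real q = real p"
        "rpair (real k) (rpair (real p) (rpair (real q) (real r))) \<in> real ` T"
        by (auto elim!: Nats_cases)
      then have "of_rat (s k) * real r + real q = real p" "r \<noteq> 0" using T by auto
      then have "g c * real r = of_rat (s k) * real r" using *(2) by linarith
      then have "g c = of_rat (s k)" using \<open>r \<noteq> 0\<close> by simp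
      then show ?L using *(1) by blast
    qed
  qed
qed

end

section \<open>Coded open subsets of Euclidean space\<close>

text \<open>The \<open>k\<close>-th rational box has the sides \<open>(lo i k, hi i k)\<close>.\<close>

definition lo :: "nat \<Rightarrow> nat \<Rightarrow> rat" where
  "lo i k = fst ((from_nat k :: (rat \<times> rat) list) ! i)"

definition hi :: "nat \<Rightarrow> nat \<Rightarrow> rat" where
  "hi i k = snd ((from_nat k :: (rat \<times> rat) list) ! i)"

lemma rational_box:
  assumes "openin (XX {..<n}) V" "x \<in> V"
  obtains k where "\<And>i. i < n \<Longrightarrow> of_rat (lo i k) < x i \<and> x i < of_rat (hi i k)"
    "\<And>z. z \<in> RR {..<n} \<Longrightarrow> (\<And>i. i < n \<Longrightarrow> of_rat (lo i k) < z i \<and> z i < of_rat (hi i k)) \<Longrightarrow> z \<in> V"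
proof -
  obtain e where e: "e > 0" "\<And>z. z \<in> RR {..<n} \<Longrightarrow> (\<And>i. i \<in> {..<n} \<Longrightarrow> \<bar>z i - x i\<bar> < e) \<Longrightarrow> z \<in> V"
    using open_contains_box [OF assms] by blast
  have "\<exists>q r. x i - e < of_rat q \<and> of_rat q < x i \<and> x i < of_rat r \<and> of_rat r < x i + e" for i
    using of_rat_dense [of "x i - e" "x i"] of_rat_dense [of "x i" "x i + e"] e(1) by auto
  then obtain q r where qr: "\<And>i. x i - e < of_rat (q i) \<and> of_rat (q i) < x i \<and> x i < of_rat (r i) \<and> of_rat (r i) < x i + e"
    by metis
  define k where "k = to_nat (map (\<lambda>i. (q i, r i)) [0..<n])"
  have k: "lo i k = q i" "hi i k = r i" if "i < n" for i
    using that by (simp_all add: lo_def hi_def k_def)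
  show ?thesis
  proof
    show "of_rat (lo i k) < x i \<and> x i < of_rat (hi i k)" if "i < n" for i
      using qr [of i] by (simp add: k that)
    fix z assume z: "z \<in> RR {..<n}" "\<And>i. i < n \<Longrightarrow> of_rat (lo i k) < z i \<and> z i < of_rat (hi i k)"
    have "\<bar>z i - x i\<bar> < e" if "i < n" for i
      using z(2) [OF that] qr [of i] unfolding k [OF that] by linarith
    then show "z \<in> V" using e(2) z(1) by simp
  qed
qed

text \<open>A universal open set: \<open>c\<close> represents the union of the rational boxes whose
  indices it codes. The rational endpoints are named by quantifiers because only the graphs of the
  endpoint sequences are available as formulas.\<close>

definition wopen :: "nat \<Rightarrow> real \<Rightarrow> (nat \<Rightarrow> real) \<Rightarrow> bool" where
  "wopen n c x \<longleftrightarrow> (\<exists>k. codes c k \<and> (\<forall>i\<in>{..<n}.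
     (\<exists>y. (\<exists>k'. k = real k' \<and> y = of_rat (lo i k')) \<and> y < x i) \<and>
     (\<exists>y. (\<exists>k'. k = real k' \<and> y = of_rat (hi i k')) \<and> x i < y)))"

lemma wopen_iff:
  "wopen n c x \<longleftrightarrow> (\<exists>k::nat. codes c (real k) \<and> (\<forall>i<n. of_rat (lo i k) < x i \<and> x i < of_rat (hi i k)))"
proof
  assume "wopen n c x"
  then obtain k where k: "codes c k" "\<forall>i\<in>{..<n}.
     (\<exists>y. (\<exists>k'. k = real k' \<and> y = of_rat (lo i k')) \<and> y < x i) \<and>
     (\<exists>y. (\<exists>k'. k = real k' \<and> y = of_rat (hi i k')) \<and> x i < y)"
    unfolding wopen_def by blast
  moreover obtain k' where "k = real k'" using k(1) unfolding codes_def by (auto elim: Nats_cases)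
  ultimately show "\<exists>k::nat. codes c (real k) \<and> (\<forall>i<n. of_rat (lo i k) < x i \<and> x i < of_rat (hi i k))"
    by (intro exI [of _ k']) auto
next
  assume "\<exists>k::nat. codes c (real k) \<and> (\<forall>i<n. of_rat (lo i k) < x i \<and> x i < of_rat (hi i k))"
  then show "wopen n c x" unfolding wopen_def by auto
qed

lemma openin_wopen: "openin (XX {..<n}) {x \<in> RR {..<n}. wopen n c x}"
proof -
  have "{x \<in> RR {..<n}. wopen n c x} =
      (\<Union>k\<in>{k. codes c (real k)}. obox {..<n} (\<lambda>i. of_rat (lo i k)) (\<lambda>i. of_rat (hi i k)))"
    by (auto simp: wopen_iff obox_def)
  then show ?thesis by (auto intro!: openin_Union openin_obox)
qed

lemma wopen_universal:
  assumes "openin (XX {..<n}) V"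
  obtains c where "\<And>x. x \<in> RR {..<n} \<Longrightarrow> wopen n c x \<longleftrightarrow> x \<in> V"
proof -
  \<comment> \<open>All rational boxes contained in \<open>V\<close> are taken; together they cover
    it.\<close>
  define S where "S = {k. \<forall>z\<in>RR {..<n}. (\<forall>i<n. of_rat (lo i k) < z i \<and> z i < of_rat (hi i k)) \<longrightarrow> z \<in> V}"
  obtain c where c: "\<And>k. codes c (real k) \<longleftrightarrow> k \<in> S" using codes_universal by blast
  show ?thesis
  proof (rule that [of c])
    fix x assume x: "x \<in> RR {..<n}"
    show "wopen n c x \<longleftrightarrow> x \<in> V"
    proof
      assume "wopen n c x"
      then show "x \<in> V" using x by (auto simp: wopen_iff c S_def)
    next
      assume "x \<in> V"
      from rational_box [OF assms this] obtain k
        where k: "\<And>i. i < n \<Longrightarrow> of_rat (lo i k) < x i \<and> x i < of_rat (hi i k)"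
          "\<And>z. z \<in> RR {..<n} \<Longrightarrow> (\<And>i. i < n \<Longrightarrow> of_rat (lo i k) < z i \<and> z i < of_rat (hi i k)) \<Longrightarrow> z \<in> V"
        by blast
      then have "k \<in> S" by (simp add: S_def)
      then show "wopen n c x" unfolding wopen_iff c using k(1) by blast
    qed
  qed
qed

lemma openin_subset_iff_wopen:
  assumes "E \<subseteq> RR {..<n}"
  shows "openin (top_of_set E) U \<longleftrightarrow> (\<exists>c. U = {x \<in> E. wopen n c x})"
proof
  assume "openin (top_of_set E) U"
  then obtain T where T: "open T" "U = E \<inter> T" by (auto simp: openin_open)
  have "openin (XX {..<n}) (RR {..<n} \<inter> T)" unfolding XX_def using T(1) by (rule openin_open_Int)
  then obtain c where c: "\<And>x. x \<in> RR {..<n} \<Longrightarrow> wopen n c x \<longleftrightarrow> x \<in> RR {..<n} \<inter> T"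
    using wopen_universal by blast
  have "U = {x \<in> E. wopen n c x}" using c assms T(2) by blast
  then show "\<exists>c. U = {x \<in> E. wopen n c x}" ..
next
  assume "\<exists>c. U = {x \<in> E. wopen n c x}"
  then obtain c where c: "U = {x \<in> E. wopen n c x}" ..
  obtain T where T: "open T" "{x \<in> RR {..<n}. wopen n c x} = RR {..<n} \<inter> T"
    using openin_wopen [of n c] unfolding XX_def openin_open by blast
  have "U = E \<inter> T" using c T(2) assms by blast
  then show "openin (top_of_set E) U" using T(1) by (simp add: openin_open_Int)
qed

lemma subtopology_Euclidean_space:
  "E \<subseteq> RR {..<n} \<Longrightarrow> subtopology (Euclidean_space n) E = top_of_set E"
  by (simp add: Euclidean_space_eq_XX XX_def subtopology_subtopology inf_absorb2)

section \<open>Components described by coded open sets\<close>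

text \<open>A clopen subset of \<open>E\<close> is a pair of codes \<open>u\<close>,
  \<open>v\<close> whose open sets are complementary on \<open>E\<close>.\<close>

lemma quasi_component_iff:
  assumes E: "E \<subseteq> RR {..<n}" and x: "x \<in> E"
  shows "quasi_component_of (top_of_set E) x y \<longleftrightarrow> y \<in> E \<and>
    (\<forall>u v. (\<forall>z\<in>RR {..<n}. z \<in> E \<longrightarrow> (wopen n u z \<longleftrightarrow> \<not> wopen n v z)) \<longrightarrow> (wopen n u x \<longleftrightarrow> wopen n u y))"
    (is "?L \<longleftrightarrow> ?R")
proof
  assume L: ?L
  have y: "y \<in> E" using quasi_component_in_topspace [OF L] by simp
  moreover have "wopen n u x \<longleftrightarrow> wopen n u y"
    if uv: "\<forall>z\<in>RR {..<n}. z \<in> E \<longrightarrow> (wopen n u z \<longleftrightarrow> \<not> wopen n v z)" for u v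
  proof -
    have "E - {z \<in> E. wopen n u z} = {z \<in> E. wopen n v z}" using uv E by blast
    then have "openin (top_of_set E) {z \<in> E. wopen n u z}" "closedin (top_of_set E) {z \<in> E. wopen n u z}"
      using openin_subset_iff_wopen [OF E] by (auto simp: closedin_def)
    then have "x \<in> {z \<in> E. wopen n u z} \<longleftrightarrow> y \<in> {z \<in> E. wopen n u z}"
      using L unfolding quasi_component_of_def by blast
    then show ?thesis using x y by simp
  qed
  ultimately show ?R by blast
next
  assume R: ?R
  have "x \<in> T \<longleftrightarrow> y \<in> T" if T: "closedin (top_of_set E) T" "openin (top_of_set E) T" for T
  proof -
    obtain u where u: "T = {z \<in> E. wopen n u z}" using T(2) openin_subset_iff_wopen [OF E] by blast
    have "openin (top_of_set E) (E - T)" using T(1) by (simp add: closedin_def)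
    then obtain v where v: "E - T = {z \<in> E. wopen n v z}" using openin_subset_iff_wopen [OF E] by blast
    have "wopen n u z \<longleftrightarrow> \<not> wopen n v z" if "z \<in> E" for z
      using that u v by blast
    then have "wopen n u x \<longleftrightarrow> wopen n u y" using R by blast
    then show ?thesis using u x R by blast
  qed
  then show ?L unfolding quasi_component_of_def using x R by simp
qed

text \<open>Components are closed in \<open>E\<close>, so it suffices to quantify over coded closed sets.\<close>

lemma connected_component_iff:
  assumes E: "E \<subseteq> RR {..<n}" and x: "x \<in> E"
  shows "connected_component_of (top_of_set E) x y \<longleftrightarrow> y \<in> E \<and> (\<exists>c. (\<not> wopen n c x \<and> \<not> wopen n c y) \<and>
    \<not> (\<exists>u v. (\<forall>z\<in>RR {..<n}. z \<in> E \<and> \<not> wopen n c z \<longrightarrow> (wopen n u z \<longleftrightarrow> \<not> wopen n v z)) \<and>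
      ((\<exists>z\<in>RR {..<n}. (z \<in> E \<and> \<not> wopen n c z) \<and> wopen n u z) \<and>
       (\<exists>z\<in>RR {..<n}. (z \<in> E \<and> \<not> wopen n c z) \<and> wopen n v z))))" (is "?L \<longleftrightarrow> ?R")
proof -
  have conn: "connected K \<longleftrightarrow>
    \<not> (\<exists>u v. (\<forall>z\<in>RR {..<n}. z \<in> E \<and> \<not> wopen n c z \<longrightarrow> (wopen n u z \<longleftrightarrow> \<not> wopen n v z)) \<and>
      ((\<exists>z\<in>RR {..<n}. (z \<in> E \<and> \<not> wopen n c z) \<and> wopen n u z) \<and>
       (\<exists>z\<in>RR {..<n}. (z \<in> E \<and> \<not> wopen n c z) \<and> wopen n v z)))" (is "_ \<longleftrightarrow> \<not> (\<exists>u v. ?S u v)")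
    if K: "K = {z \<in> E. \<not> wopen n c z}" for K c
  proof -
    have KR: "K \<subseteq> RR {..<n}" using K E by blast
    \<comment> \<open>The single equivalence between \<open>u\<close> and the negation of
      \<open>v\<close> on \<open>K\<close> says both that the two open sets cover \<open>K\<close>
      and that they are disjoint there.\<close>
    have S: "?S u v \<longleftrightarrow> K \<subseteq> {z \<in> K. wopen n u z} \<union> {z \<in> K. wopen n v z} \<and>
        {z \<in> K. wopen n u z} \<inter> {z \<in> K. wopen n v z} = {} \<and> {z \<in> K. wopen n u z} \<noteq> {} \<and> {z \<in> K. wopen n v z} \<noteq> {}" for u v
      using KR unfolding K by blast
    show ?thesis
      unfolding connected_openin openin_subset_iff_wopen [OF KR] S by blast
  qed
  show ?thesis
  proof
    assume L: ?L
    define C where "C = connected_component_of_set (top_of_set E) x"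
    have CE: "C \<subseteq> E" using connected_component_of_subset_topspace [of "top_of_set E" x] by (simp add: C_def)
    have "C \<in> connected_components_of (top_of_set E)"
      using x unfolding C_def connected_components_of_def by simp
    then have "closedin (top_of_set E) C" by (rule closedin_connected_components_of)
    then have "openin (top_of_set E) (E - C)" by (simp add: closedin_def)
    then obtain c where c: "E - C = {z \<in> E. wopen n c z}" using openin_subset_iff_wopen [OF E] by blast
    have K: "C = {z \<in> E. \<not> wopen n c z}" using c CE by blast
    have "connectedin (top_of_set E) C" unfolding C_def by (rule connectedin_connected_component_of)
    then have "connected C" by (simp add: connectedin_subtopology)
    moreover have "x \<in> C" "y \<in> C" using L x by (auto simp: C_def connected_component_of_refl)
    ultimately show ?R using conn [OF K] K by blast
  next
    assume ?R
    then obtain c where y: "y \<in> E" "\<not> wopen n c x" "\<not> wopen n c y" and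
      c: "connected {z \<in> E. \<not> wopen n c z}"
      unfolding conn [OF refl, symmetric] by blast
    then show ?L
      unfolding connected_component_of_def
      by (intro exI [of _ "{z \<in> E. \<not> wopen n c z}"]) (use x in \<open>auto simp: connectedin_subtopology\<close>)
  qed
qed

text \<open>
  A path in \<open>E\<close> is coded by its graph, a compact set whose projection to the time coordinate \<open>n\<close> is a
  bijection onto the unit interval.
\<close>

definition path_code :: "nat \<Rightarrow> (nat \<Rightarrow> real) set \<Rightarrow> real \<Rightarrow> bool" where
  "path_code n E c \<longleftrightarrow>
     (\<exists>a b. \<forall>w\<in>RR {..<Suc n}. \<not> wopen (Suc n) c w \<longrightarrow>
        (0 \<le> w n \<and> w n \<le> 1) \<and> (w(n := 0) \<in> E \<and> (\<forall>i\<in>{..<n}. a \<le> w i \<and> w i \<le> b))) \<and>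
     (\<forall>t. 0 \<le> t \<and> t \<le> 1 \<longrightarrow> (\<exists>w\<in>RR {..<Suc n}. \<not> wopen (Suc n) c w \<and> w n = t)) \<and>
     (\<forall>w\<in>RR {..<Suc n}. \<forall>w'\<in>RR {..<Suc n}. (\<not> wopen (Suc n) c w \<and> \<not> wopen (Suc n) c w') \<and> w n = w' n \<longrightarrow>
        (\<forall>i\<in>{..<n}. w i = w' i))"

text \<open>The graph of a path is compact, so its complement is open and has a code. Conversely,
  the time coordinate is a continuous bijection from the compact set described by a code onto the
  unit interval, so its inverse is continuous and traces a path. The time coordinate of
  \<open>x\<close> is already 0, so \<open>x\<close> itself is the starting point of the
  graph.\<close>

lemma path_component_iff:
  assumes E: "E \<subseteq> RR {..<n}" and x: "x \<in> E"
  shows "path_component_of (top_of_set E) x y \<longleftrightarrow> y \<in> E \<and> (\<exists>c. path_code n E c \<and>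
    (\<not> wopen (Suc n) c x \<and> \<not> wopen (Suc n) c (y(n := 1))))" (is "?L \<longleftrightarrow> ?R")
proof
  assume L: ?L
  then obtain g :: "real \<Rightarrow> nat \<Rightarrow> real" where g: "continuous_on {0..1} g" "g ` {0..1} \<subseteq> E" "g 0 = x" "g 1 = y"
    unfolding path_component_of_def pathin_canon_iff by (auto simp: path_def image_subset_iff_funcset)
  have gR: "g t \<in> RR {..<n}" if "t \<in> {0..1}" for t using g(2) E that by blast
  have gn: "g t n = 0" "(g t)(n := 0) = g t" if "t \<in> {0..1}" for t
    using gR [OF that] RR_zero [of "g t" "{..<n}" n] drop_RR [of "g t" "{..<n}" n] by auto
  define G where "G = (\<lambda>t. (g t)(n := t)) ` {0..1}"
  have "compact G"
    unfolding G_def by (intro compact_continuous_image continuous_on_upd g(1) continuous_on_id compact_Icc)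
  then have "closed G" by (rule compact_imp_closed)
  then have "open (- G)" by blast
  then have "openin (XX {..<Suc n}) (RR {..<Suc n} \<inter> - G)"
    unfolding XX_def by (rule openin_open_Int)
  then obtain c where "\<And>w. w \<in> RR {..<Suc n} \<Longrightarrow> wopen (Suc n) c w \<longleftrightarrow> w \<in> RR {..<Suc n} \<inter> - G"
    using wopen_universal by blast
  then have c: "\<And>w. w \<in> RR {..<Suc n} \<Longrightarrow> \<not> wopen (Suc n) c w \<longleftrightarrow> w \<in> G" by blast
  have GR: "G \<subseteq> RR {..<Suc n}" using gR by (auto simp: G_def lessThan_Suc intro: upd_in_RR)
  have "\<exists>b. \<forall>t\<in>{0..1}. \<bar>g t i\<bar> \<le> b" for i
  proof -
    have "compact ((\<lambda>t. g t i) ` {0..1})"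
      by (intro compact_continuous_image continuous_on_product_then_coordinatewise [OF g(1)] compact_Icc)
    from compact_imp_bounded [OF this] show ?thesis unfolding bounded_iff by auto
  qed
  then obtain b where b: "\<And>i t. t \<in> {0..1} \<Longrightarrow> \<bar>g t i\<bar> \<le> b i" by metis
  define B where "B = (\<Sum>i<n. \<bar>b i\<bar>)"
  have B: "\<bar>g t i\<bar> \<le> B" if "t \<in> {0..1}" "i < n" for i t
  proof -
    have "\<bar>g t i\<bar> \<le> \<bar>b i\<bar>" using b [OF that(1), of i] by linarith
    also have "\<dots> \<le> B" unfolding B_def using that(2) by (intro member_le_sum) auto
    finally show ?thesis .
  qed
  have "path_code n E c"
    unfolding path_code_def
  proof (intro conjI exI)
    show "\<forall>w\<in>RR {..<Suc n}. \<not> wopen (Suc n) c w \<longrightarrow>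
        (0 \<le> w n \<and> w n \<le> 1) \<and> (w(n := 0) \<in> E \<and> (\<forall>i\<in>{..<n}. - B \<le> w i \<and> w i \<le> B))"
    proof (intro ballI impI)
      fix w assume "w \<in> RR {..<Suc n}" "\<not> wopen (Suc n) c w"
      then obtain t where t: "t \<in> {0..1}" "w = (g t)(n := t)" using c by (auto simp: G_def)
      have "w(n := 0) \<in> E" using t gn(2) [OF t(1)] g(2) by auto
      moreover have "- B \<le> w i \<and> w i \<le> B" if "i \<in> {..<n}" for i
        using B [OF t(1), of i] that t(2) by auto
      ultimately show "(0 \<le> w n \<and> w n \<le> 1) \<and> (w(n := 0) \<in> E \<and> (\<forall>i\<in>{..<n}. - B \<le> w i \<and> w i \<le> B))"
        using t by auto
    qed
    show "\<forall>t. 0 \<le> t \<and> t \<le> 1 \<longrightarrow> (\<exists>w\<in>RR {..<Suc n}. \<not> wopen (Suc n) c w \<and> w n = t)"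
    proof (intro allI impI)
      fix t :: real assume "0 \<le> t \<and> t \<le> 1"
      then have "(g t)(n := t) \<in> G" by (auto simp: G_def)
      then show "\<exists>w\<in>RR {..<Suc n}. \<not> wopen (Suc n) c w \<and> w n = t"
        using GR c by (intro bexI [of _ "(g t)(n := t)"]) auto
    qed
    show "\<forall>w\<in>RR {..<Suc n}. \<forall>w'\<in>RR {..<Suc n}. (\<not> wopen (Suc n) c w \<and> \<not> wopen (Suc n) c w') \<and> w n = w' n \<longrightarrow>
        (\<forall>i\<in>{..<n}. w i = w' i)"
      using c by (auto simp: G_def)
  qed
  moreover have "(g 0)(n := 0) \<in> G" "(g 1)(n := 1) \<in> G" by (auto simp: G_def)
  then have "\<not> wopen (Suc n) c x" "\<not> wopen (Suc n) c (y(n := 1))"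
    using c GR gn(2) [of 0] g(3,4) by auto
  moreover have "y \<in> E" using g by auto
  ultimately show ?R by blast
next
  assume ?R
  then obtain c where y: "y \<in> E" and c: "path_code n E c"
    and xy: "\<not> wopen (Suc n) c x" "\<not> wopen (Suc n) c (y(n := 1))"
    by blast
  note pc = c [unfolded path_code_def]
  obtain a b where 1: "\<And>w. w \<in> RR {..<Suc n} \<Longrightarrow> \<not> wopen (Suc n) c w \<Longrightarrow>
        (0 \<le> w n \<and> w n \<le> 1) \<and> (w(n := 0) \<in> E \<and> (\<forall>i\<in>{..<n}. a \<le> w i \<and> w i \<le> b))"
    using conjunct1 [OF pc] by blast
  note 2 = conjunct1 [OF conjunct2 [OF pc], rule_format]
  note 3 = conjunct2 [OF conjunct2 [OF pc], rule_format, OF _ _ conjI, OF _ _ conjI]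
  define G where "G = {w \<in> RR {..<Suc n}. \<not> wopen (Suc n) c w}"
  have "closedin (XX {..<Suc n}) (RR {..<Suc n} - {w \<in> RR {..<Suc n}. wopen (Suc n) c w})"
    by (intro closedin_diff openin_wopen) (metis closedin_topspace topspace_XX)
  moreover have "RR {..<Suc n} - {w \<in> RR {..<Suc n}. wopen (Suc n) c w} = G"
    by (auto simp: G_def)
  ultimately have "closedin (XX {..<Suc n}) G" by simp
  then have "closed G" using closed_RR closedin_closed_trans unfolding XX_def by blast
  \<comment> \<open>The bounds \<open>a\<close>, \<open>b\<close> in \<open>path_code\<close> give
    compactness, without which the inverse of the projection to the time coordinate could be
    discontinuous.\<close>
  define K where "K = (\<Pi>\<^sub>E i\<in>UNIV. if i < n then {a..b} else if i = n then {0..1} else {0::real})"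
  have "compactin (product_topology (\<lambda>_. euclidean) UNIV) K"
    unfolding K_def compactin_PiE by auto
  then have "compact K" by (simp add: euclidean_product_topology)
  moreover have "G \<subseteq> K"
  proof
    fix w assume "w \<in> G"
    then have w: "w \<in> RR {..<Suc n}" "\<not> wopen (Suc n) c w" by (auto simp: G_def)
    show "w \<in> K" using 1 [OF w] w(1) by (auto simp: K_def RR_def)
  qed
  ultimately have "compact G" using \<open>closed G\<close> by (metis compact_Int_closed inf.absorb2)
  have inj: "inj_on (\<lambda>w. w n) G"
  proof (rule inj_onI)
    fix w w' assume w: "w \<in> G" "w' \<in> G" "w n = w' n"
    then have R: "w \<in> RR {..<Suc n}" "w' \<in> RR {..<Suc n}" by (auto simp: G_def)
    have *: "\<forall>i\<in>{..<n}. w i = w' i" by (rule ballI, rule 3) (use w in \<open>auto simp: G_def\<close>)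
    show "w = w'"
    proof
      fix i show "w i = w' i"
        using * w(3) RR_zero [OF R(1), of i] RR_zero [OF R(2), of i] by (cases "i < n"; cases "i = n") auto
    qed
  qed
  have im: "(\<lambda>w. w n) ` G = {0..1}"
    using 1 2 by (fastforce simp: G_def)
  \<comment> \<open>The inverse of the projection to time; erasing the time coordinate from its
    values gives the path in \<open>E\<close>.\<close>
  define h where "h = the_inv_into G (\<lambda>w. w n)"
  have "continuous_on ((\<lambda>w. w n) ` G) h"
    by (rule continuous_on_inv [OF continuous_on_coord \<open>compact G\<close>]) (simp add: h_def the_inv_into_f_f [OF inj])
  then have h: "continuous_on {0..1} h" unfolding im .
  have hG: "h t \<in> G" if "t \<in> {0..1}" for t
    unfolding h_def by (rule the_inv_into_into [OF inj _ subset_refl]) (use that im in auto)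
  have heq: "h (w n) = w" if "w \<in> G" for w unfolding h_def by (rule the_inv_into_f_f [OF inj that])
  have xR: "x \<in> RR {..<n}" "y \<in> RR {..<n}" using E x y by auto
  have xG: "x \<in> G" "y(n := 1) \<in> G"
    using xy xR upd_in_RR [of y "{..<n}" n 1] by (auto simp: G_def lessThan_Suc) (auto simp: RR_def)
  have "h 0 = x" "h 1 = y(n := 1)"
    using heq [OF xG(1)] heq [OF xG(2)] RR_zero [OF xR(1), of n] by auto
  then have ends: "(h 0)(n := 0) = x" "(h 1)(n := 0) = y"
    using drop_RR [OF xR(1), of n] drop_RR [OF xR(2), of n] by auto
  have "continuous_on {0..1} (\<lambda>t. (h t)(n := 0))"
    by (intro continuous_on_upd h continuous_on_const)
  moreover have "(\<lambda>t. (h t)(n := 0)) ` {0..1} \<subseteq> E"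
    using hG 1 by (auto simp: G_def)
  ultimately show ?L
    unfolding path_component_of_def pathin_canon_iff
    by (intro exI [of _ "\<lambda>t. (h t)(n := 0)"]) (use ends in \<open>auto simp: path_def\<close>)
qed

section \<open>Definability of the components\<close>

context arithmetic_structure
begin

lemma Def_wopen:
  assumes c: "DefF M \<Gamma> f" and x: "DefV M \<Gamma> {..<n} h"
  shows "Def M \<Gamma> (\<lambda>c. wopen n (f c) (h c))"
  unfolding wopen_def
  by (intro Def_ex Def_conj Def_codes Def_Ball_finite Def_less Def_rat_seq DefF_fst DefF_snd c DefF_app [OF x]) auto

lemma definable_Collect:
  assumes "Def M (vec_ctx {..<n}) P"
  shows "definable M n {x \<in> RR {..<n}. P x}"
  using dset_Collect [OF assms] by (simp add: definable_iff_Def dset_def)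

text \<open>A point \<open>x\<close> of the quasicomponent enters the formula as a tuple of
  parameters, and the codes \<open>u\<close>, \<open>v\<close> are ordinary real variables.\<close>

lemma QCC: "QCC M"
  unfolding QCC_def
proof (intro allI impI ballI)
  fix n E C assume E: "definable M n E" and C: "C \<in> quasi_components_of (subtopology (Euclidean_space n) E)"
  have ER: "E \<subseteq> RR {..<n}" and dE: "dset {..<n} E" using E by (auto simp: definable_iff_Def dset_def)
  obtain x where x: "x \<in> E" "C = quasi_component_of_set (top_of_set E) x"
    using C unfolding subtopology_Euclidean_space [OF ER] quasi_components_of_def by auto
  have "C = {y \<in> RR {..<n}. y \<in> E \<and>
    (\<forall>u v. (\<forall>z\<in>RR {..<n}. z \<in> E \<longrightarrow> (wopen n u z \<longleftrightarrow> \<not> wopen n v z)) \<longrightarrow> (wopen n u x \<longleftrightarrow> wopen n u y))}"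
    unfolding x(2) quasi_component_iff [OF ER x(1)] using ER by blast
  also have "definable M n \<dots>"
    by (intro definable_Collect Def_conj Def_all Def_imp Def_iff Def_not Def_allV finite_lessThan
        Def_mem [OF finite_lessThan dE] Def_wopen DefF_snd DefF_fst DefV_snd DefV_fst DefV_id)
      (use x(1) ER in \<open>auto intro: DefV_const\<close>)
  finally show "definable M n C" .
qed

lemma CC: "CC M"
  unfolding CC_def
proof (intro allI impI ballI)
  fix n E C assume E: "definable M n E" and C: "C \<in> connected_components_of (subtopology (Euclidean_space n) E)"
  have ER: "E \<subseteq> RR {..<n}" and dE: "dset {..<n} E" using E by (auto simp: definable_iff_Def dset_def)
  obtain x where x: "x \<in> E" "C = connected_component_of_set (top_of_set E) x"
    using C unfolding subtopology_Euclidean_space [OF ER] connected_components_of_def by auto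
  have "C = {y \<in> RR {..<n}. y \<in> E \<and> (\<exists>c. (\<not> wopen n c x \<and> \<not> wopen n c y) \<and>
    \<not> (\<exists>u v. (\<forall>z\<in>RR {..<n}. z \<in> E \<and> \<not> wopen n c z \<longrightarrow> (wopen n u z \<longleftrightarrow> \<not> wopen n v z)) \<and>
      ((\<exists>z\<in>RR {..<n}. (z \<in> E \<and> \<not> wopen n c z) \<and> wopen n u z) \<and>
       (\<exists>z\<in>RR {..<n}. (z \<in> E \<and> \<not> wopen n c z) \<and> wopen n v z))))}"
    unfolding x(2) connected_component_iff [OF ER x(1)] using ER by blast
  also have "definable M n \<dots>"
    by (intro definable_Collect Def_conj Def_all Def_ex Def_imp Def_iff Def_not Def_allV Def_exV finite_lessThan
        Def_mem [OF finite_lessThan dE] Def_wopen DefF_snd DefF_fst DefV_snd DefV_fst DefV_id)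
      (use x(1) ER in \<open>auto intro: DefV_const\<close>)
  finally show "definable M n C" .
qed

lemma PCC: "PCC M"
  unfolding PCC_def
proof (intro allI impI ballI)
  fix n E C assume E: "definable M n E" and C: "C \<in> path_components_of (subtopology (Euclidean_space n) E)"
  have ER: "E \<subseteq> RR {..<n}" and dE: "dset {..<n} E" using E by (auto simp: definable_iff_Def dset_def)
  obtain x where x: "x \<in> E" "C = path_component_of_set (top_of_set E) x"
    using C unfolding subtopology_Euclidean_space [OF ER] path_components_of_def by auto
  have xR: "x \<in> RR {..<Suc n}" using x(1) ER by (auto simp: RR_def)
  have "C = {y \<in> RR {..<n}. y \<in> E \<and> (\<exists>c. path_code n E c \<and>
    (\<not> wopen (Suc n) c x \<and> \<not> wopen (Suc n) c (y(n := 1))))}"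
    unfolding x(2) path_component_iff [OF ER x(1)] using ER by blast
  also have "definable M n \<dots>"
  proof -
    have y: "DefV M (vec_ctx {..<n} \<otimes>\<^sub>c real_ctx) {..<Suc n} (\<lambda>c. (fst c)(n := 1))"
      by (rule DefV_upd [OF DefV_fst [OF DefV_id] _ DefF_const]) auto
    have w: "DefV M (\<Gamma> \<otimes>\<^sub>c vec_ctx {..<Suc n}) {..<n} (\<lambda>c. (snd c)(n := 0))" for \<Gamma> :: "'c ctx"
      by (rule DefV_drop [OF DefV_snd]) auto
    show ?thesis
      unfolding path_code_def
      by (intro definable_Collect Def_conj Def_all Def_ex Def_imp Def_not Def_allV Def_exV finite_lessThan
          Def_Ball_finite Def_mem [OF finite_lessThan dE] Def_wopen Def_le Def_eq y w DefF_snd DefF_coord_snd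
          DefF_const DefF_fst DefV_snd DefV_fst DefV_id DefV_const xR)
  qed
  finally show "definable M n C" .
qed

end

theorem proposition1p1:
  shows "(\<forall>M :: ('f, 'r) real_structure.
            expansion_of M real_order \<and> o_minimal M \<longrightarrow> PCC M \<and> CC M \<and> QCC M) \<and>
         (\<forall>M :: ('f, 'r) real_structure.
            expansion_of M real_field_nat \<longrightarrow> PCC M \<and> CC M \<and> QCC M)"
proof (intro conjI allI impI)
  fix M :: "('f, 'r) real_structure"
  assume M: "expansion_of M real_order \<and> o_minimal M"
  interpret ordered_structure M by (rule ordered_structure_expansion) (use M in blast)
  interpret o_minimal_structure M by unfold_locales (use M in blast)
  show "PCC M" "CC M" "QCC M" using closed_under_components by blast+
next
  fix M :: "('f, 'r) real_structure"
  assume "expansion_of M real_field_nat"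
  then interpret arithmetic_structure M by (rule arithmetic_structure_expansion)
  show "PCC M" "CC M" "QCC M" by (rule PCC, rule CC, rule QCC)
qed

end
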